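(* Let $d\ge 1$, fix $m\in\mathbb N^{+}=\{1,2,\dots\}$, $V_+>0$ and a Bravais lattice $\Gamma\subset\mathbb R^d$. Then there exists a potential $V^\star\in\mathcal A(\Gamma,V_+)$ such that $$G_m[V^\star]=\sup_{V\in\mathcal A(\Gamma,V_+)}G_m[V].$$
   Context: A Bravais lattice $\Gamma\subset\mathbb R^d$ is a full-rank lattice; $\Gamma^*$ is its reciprocal (dual) lattice $\{\xi: \xi\cdot X\in 2\pi\mathbb Z\ \forall X\in\Gamma\}$, and the Brillouin zone $\mathcal B\subset\mathbb R^d$ is the Voronoi cell of the origin in $\Gamma^*$. The admissible set is $$\mathcal A(\Gamma,V_+)=\{V\in L^\infty(\mathbb R^d): V \text{ real-valued},\ V(x+X)=V(x)\text{ and }V(x)\in[0,V_+]\text{ for a.e. }x\in\mathbb R^d\text{ and all }X\in\Gamma\}.$$ For $V\in\mathcal A(\Gamma,V_+)$ and $k\in\mathcal B$, let $H_V(k)=-(\nabla+ik)\cdot(\nabla+ik)+V$ acting on $\Gamma$-periodic functions, i.e. on $L^2(\mathbb R^d/\Gamma)$. It is self-adjoint with discrete spectrum; its eigenvalues, in nondecreasing order counted with multiplicity, are $E_1(k)\le E_2(k)\le\cdots$. Put $$\alpha_m=\max_{k\in\mathcal B}E_m(k),\qquad \beta_m=\min_{k\in\mathcal B}E_{m+1}(k),\qquad G_m[V]=\frac{\beta_m-\alpha_m}{(\alpha_m+\beta_m)/2}.$$ *)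

theory Defs
  imports "HOL-Analysis.Analysis"
begin

definition bravais_lattice :: "(real ^ 'd) set \<Rightarrow> bool" where
  "bravais_lattice \<Gamma> \<longleftrightarrow>
     (\<exists>B. independent B \<and> span B = UNIV \<and>
          \<Gamma> = {(\<Sum>b\<in>B. of_int (c b) *\<^sub>R b) | c :: real ^ 'd \<Rightarrow> int. True})"

definition dual_lattice :: "(real ^ 'd) set \<Rightarrow> (real ^ 'd) set" where
  "dual_lattice \<Gamma> = {\<xi>. \<forall>X\<in>\<Gamma>. \<exists>n :: int. \<xi> \<bullet> X = 2 * pi * of_int n}"

text \<open>The closed Voronoi cell of the origin.\<close>
definition voronoi_cell :: "(real ^ 'd) set \<Rightarrow> (real ^ 'd) set" where
  "voronoi_cell L = {x. \<forall>y\<in>L. dist x 0 \<le> dist x y}"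

definition brillouin_zone :: "(real ^ 'd) set \<Rightarrow> (real ^ 'd) set" where
  "brillouin_zone \<Gamma> = voronoi_cell (dual_lattice \<Gamma>)"

text \<open>Elements of \<open>L\<^sup>\<infinity>\<close> and \<open>L\<^sup>2\<close> are represented by Lebesgue measurable functions;
  equality of elements is equality almost everywhere.\<close>
definition admissible :: "(real ^ 'd) set \<Rightarrow> real \<Rightarrow> (real ^ 'd \<Rightarrow> real) set" where
  "admissible \<Gamma> Vmax = {V. V \<in> borel_measurable lebesgue \<and>
     (AE x in lebesgue. (\<forall>X\<in>\<Gamma>. V (x + X) = V x) \<and> V x \<in> {0..Vmax})}"

text \<open>\<open>L\<^sup>2(\<real>\<^sup>d / \<Gamma>)\<close>. The torus is integrated over through the fundamental domain
  \<^term>\<open>voronoi_cell \<Gamma>\<close>.\<close>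
definition L2_torus :: "(real ^ 'd) set \<Rightarrow> (real ^ 'd \<Rightarrow> complex) set" where
  "L2_torus \<Gamma> = {u. u \<in> borel_measurable lebesgue \<and>
     (AE x in lebesgue. \<forall>X\<in>\<Gamma>. u (x + X) = u x) \<and>
     set_integrable lebesgue (voronoi_cell \<Gamma>) (\<lambda>x. (cmod (u x))\<^sup>2)}"

definition partial_deriv :: "'d \<Rightarrow> (real ^ 'd \<Rightarrow> complex) \<Rightarrow> real ^ 'd \<Rightarrow> complex" where
  "partial_deriv j \<phi> x = frechet_derivative \<phi> (at x) (axis j 1)"

text \<open>\<open>C\<^sup>\<infinity>\<close>: all iterated partial derivatives are differentiable (hence also continuous).\<close>
definition smooth :: "(real ^ 'd \<Rightarrow> complex) \<Rightarrow> bool" where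
  "smooth \<phi> \<longleftrightarrow> (\<forall>js. foldr partial_deriv js \<phi> differentiable_on UNIV)"

definition test_functions :: "(real ^ 'd) set \<Rightarrow> (real ^ 'd \<Rightarrow> complex) set" where
  "test_functions \<Gamma> = {\<phi>. smooth \<phi> \<and> (\<forall>X\<in>\<Gamma>. \<forall>x. \<phi> (x + X) = \<phi> x)}"

definition weak_deriv ::
  "(real ^ 'd) set \<Rightarrow> 'd \<Rightarrow> (real ^ 'd \<Rightarrow> complex) \<Rightarrow> (real ^ 'd \<Rightarrow> complex) \<Rightarrow> bool" where
  "weak_deriv \<Gamma> j u w \<longleftrightarrow> u \<in> L2_torus \<Gamma> \<and> w \<in> L2_torus \<Gamma> \<and>
     (\<forall>\<phi>\<in>test_functions \<Gamma>.
        (LINT x:voronoi_cell \<Gamma>|lebesgue. u x * partial_deriv j \<phi> x) =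
        - (LINT x:voronoi_cell \<Gamma>|lebesgue. w x * \<phi> x))"

text \<open>\<open>v = (\<partial>\<^sub>j + i k\<^sub>j) u\<close> as a relation, the derivative being weak.\<close>
definition bloch_deriv ::
  "(real ^ 'd) set \<Rightarrow> real ^ 'd \<Rightarrow> 'd \<Rightarrow> (real ^ 'd \<Rightarrow> complex) \<Rightarrow> (real ^ 'd \<Rightarrow> complex) \<Rightarrow> bool" where
  "bloch_deriv \<Gamma> k j u v \<longleftrightarrow> weak_deriv \<Gamma> j u (\<lambda>x. v x - \<i> * of_real (k $ j) * u x)"

text \<open>The graph of \<open>H\<^sub>V(k) = -(\<nabla> + ik) \<cdot> (\<nabla> + ik) + V\<close> on \<open>L\<^sup>2(\<real>\<^sup>d / \<Gamma>)\<close>: \<open>f = H\<^sub>V(k) u\<close>.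
  Existence of the \<open>w j\<close> in \<open>L\<^sup>2\<close> cuts out the domain \<open>H\<^sup>2(\<real>\<^sup>d / \<Gamma>)\<close>, on which the operator
  is self-adjoint.\<close>
definition bloch_operator ::
  "(real ^ 'd) set \<Rightarrow> (real ^ 'd \<Rightarrow> real) \<Rightarrow> real ^ 'd \<Rightarrow>
   (real ^ 'd \<Rightarrow> complex) \<Rightarrow> (real ^ 'd \<Rightarrow> complex) \<Rightarrow> bool" where
  "bloch_operator \<Gamma> V k u f \<longleftrightarrow> u \<in> L2_torus \<Gamma> \<and> f \<in> L2_torus \<Gamma> \<and>
     (\<exists>v w. (\<forall>j. v j \<in> L2_torus \<Gamma> \<and> w j \<in> L2_torus \<Gamma> \<and>
                 bloch_deriv \<Gamma> k j u (v j) \<and> bloch_deriv \<Gamma> k j (v j) (w j)) \<and>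
            (AE x in lebesgue. f x = - (\<Sum>j\<in>UNIV. w j x) + of_real (V x) * u x))"

definition eigenspace ::
  "(real ^ 'd) set \<Rightarrow> (real ^ 'd \<Rightarrow> real) \<Rightarrow> real ^ 'd \<Rightarrow> real \<Rightarrow> (real ^ 'd \<Rightarrow> complex) set" where
  "eigenspace \<Gamma> V k \<mu> = {u. bloch_operator \<Gamma> V k u (\<lambda>x. of_real \<mu> * u x)}"

text \<open>The eigenspace of \<open>\<mu>\<close>, modulo equality almost everywhere, has complex dimension \<open>n\<close>.
  The case \<open>n = 0\<close> says that \<open>\<mu>\<close> is not an eigenvalue.\<close>
definition has_multiplicity ::
  "(real ^ 'd) set \<Rightarrow> (real ^ 'd \<Rightarrow> real) \<Rightarrow> real ^ 'd \<Rightarrow> real \<Rightarrow> nat \<Rightarrow> bool" where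
  "has_multiplicity \<Gamma> V k \<mu> n \<longleftrightarrow>
     (\<exists>u :: nat \<Rightarrow> real ^ 'd \<Rightarrow> complex.
        (\<forall>i<n. u i \<in> eigenspace \<Gamma> V k \<mu>) \<and>
        (\<forall>c :: nat \<Rightarrow> complex.
           (AE x in lebesgue. (\<Sum>i<n. c i * u i x) = 0) \<longrightarrow> (\<forall>i<n. c i = 0)) \<and>
        (\<forall>w\<in>eigenspace \<Gamma> V k \<mu>. \<exists>c :: nat \<Rightarrow> complex.
           AE x in lebesgue. w x = (\<Sum>i<n. c i * u i x)))"

text \<open>\<open>E\<close> (indexed from \<open>0\<close>) lists the eigenvalues of \<open>H\<^sub>V(k)\<close> in nondecreasing order, each
  repeated according to its multiplicity. There is exactly one such \<open>E\<close> when \<open>V\<close> is admissible.\<close>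
definition eigenvalue_list ::
  "(real ^ 'd) set \<Rightarrow> (real ^ 'd \<Rightarrow> real) \<Rightarrow> real ^ 'd \<Rightarrow> (nat \<Rightarrow> real) \<Rightarrow> bool" where
  "eigenvalue_list \<Gamma> V k E \<longleftrightarrow> mono E \<and>
     (\<forall>\<mu>. finite {i. E i = \<mu>} \<and> has_multiplicity \<Gamma> V k \<mu> (card {i. E i = \<mu>}))"

text \<open>\<open>E\<^sub>m(k)\<close>, with \<open>m \<ge> 1\<close>.\<close>
definition band ::
  "(real ^ 'd) set \<Rightarrow> (real ^ 'd \<Rightarrow> real) \<Rightarrow> nat \<Rightarrow> real ^ 'd \<Rightarrow> real" where
  "band \<Gamma> V m k = (THE E. eigenvalue_list \<Gamma> V k E) (m - 1)"

definition band_top :: "(real ^ 'd) set \<Rightarrow> (real ^ 'd \<Rightarrow> real) \<Rightarrow> nat \<Rightarrow> real" where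
  "band_top \<Gamma> V m = (GREATEST a. a \<in> band \<Gamma> V m ` brillouin_zone \<Gamma>)"

definition next_band_bottom :: "(real ^ 'd) set \<Rightarrow> (real ^ 'd \<Rightarrow> real) \<Rightarrow> nat \<Rightarrow> real" where
  "next_band_bottom \<Gamma> V m = (LEAST b. b \<in> band \<Gamma> V (m + 1) ` brillouin_zone \<Gamma>)"

definition gap_to_midgap :: "(real ^ 'd) set \<Rightarrow> nat \<Rightarrow> (real ^ 'd \<Rightarrow> real) \<Rightarrow> real" where
  "gap_to_midgap \<Gamma> m V =
     (next_band_bottom \<Gamma> V m - band_top \<Gamma> V m) /
     ((band_top \<Gamma> V m + next_band_bottom \<Gamma> V m) / 2)"

end

theory Submission
  imports Defs "HOL-Complex_Analysis.Great_Picard"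
begin

text \<open>Fourier series identify \<open>L\<^sup>2\<close> of the torus with square-summable sequences, on which the Bloch
  operator becomes a diagonal operator with entries \<open>|\<xi> + k|\<^sup>2\<close> plus the bounded operator of
  multiplication by \<open>V\<close>. Minimising the quadratic form successively on orthogonal complements
  yields all eigenvalues. Along potentials converging weakly and quasi-momenta converging in
  \<open>\<real>\<^sup>d\<close>, each eigenvalue converges: trial vectors from the limit problem bound the upper limit,
  and compactness of the form domain in \<open>L\<^sup>2\<close> bounds the lower one.
  The Fourier coefficients of a maximising sequence converge along a subsequence to those of an
  admissible potential. Because \<open>\<alpha>\<close> is a maximum and \<open>\<beta>\<close> a minimum over \<open>k\<close>, convergence of the
  bands at the two extremal quasi-momenta of the limit potential is enough to compare the gaps,
  the ratio being decreasing in \<open>\<alpha>\<close> and increasing in \<open>\<beta>\<close>.\<close>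


section \<open>The complex Hilbert space of square-summable sequences\<close>

text \<open>Weak convergence of the potentials gives neither norm convergence of the operators nor
  strong convergence of the products \<open>V u\<close>. What rescues the eigenvalues is that
  bounded energy forces strongly convergent subsequences, and along strongly convergent vectors
  uniformly bounded, weakly convergent operators have convergent quadratic forms. All estimates are
  therefore relative to one fixed weight, with constants independent of the potential and uniform
  for bounded \<open>k\<close>. The bands are given by a definite description and their edges by
  \<open>GREATEST\<close> and \<open>LEAST\<close>. So the minimisers must exhaust every eigenspace,
  the multiplicities must determine the list, and the bands must be continuous in \<open>k\<close>
  for the extrema to be attained. Continuity is the same convergence theorem with the potential held
  constant. The ratio also needs a nonzero denominator. For the zero potential the lowest band
  vanishes at \<open>k = 0\<close>, but the dual lattice is countable, so some point of the
  Brillouin zone lies off it; all kinetic entries are positive there, and hence so is the band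
  top.\<close>

typedef ell2 = "{a :: nat \<Rightarrow> complex. summable (\<lambda>n. (cmod (a n))\<^sup>2)}"
  morphisms coord Ell2
  by (rule exI[of _ "\<lambda>_. 0"]) simp

lemma summable_coord: "summable (\<lambda>n. (cmod (coord a n))\<^sup>2)"
  using coord[of a] by simp

lemma ell2_eqI: "(\<And>n. coord a n = coord b n) \<Longrightarrow> a = b"
  by (metis coord_inject ext)

lemma coord_Ell2: "summable (\<lambda>n. (cmod (f n))\<^sup>2) \<Longrightarrow> coord (Ell2 f) = f"
  by (simp add: Ell2_inverse)

lemma cmod_add_square_le: "(cmod (a + b))\<^sup>2 \<le> 2 * (cmod a)\<^sup>2 + 2 * (cmod b)\<^sup>2"
proof -
  have "(cmod (a + b))\<^sup>2 \<le> (cmod a + cmod b)\<^sup>2"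
    by (simp add: norm_triangle_ineq)
  also have "\<dots> \<le> 2 * (cmod a)\<^sup>2 + 2 * (cmod b)\<^sup>2"
    using sum_squares_bound[of "cmod a" "cmod b"] by (simp add: power2_sum)
  finally show ?thesis .
qed

lemma summable_cmod_add:
  assumes "summable (\<lambda>n. (cmod (f n))\<^sup>2)" "summable (\<lambda>n. (cmod (g n))\<^sup>2)"
  shows "summable (\<lambda>n. (cmod (f n + g n))\<^sup>2)"
  by (rule summable_comparison_test'[OF summable_add[OF summable_mult[OF assms(1), of 2]
        summable_mult[OF assms(2), of 2]], of 0]) (simp add: cmod_add_square_le)

lemma summable_cmod_mult:
  assumes "summable (\<lambda>n. (cmod (f n))\<^sup>2)" "summable (\<lambda>n. (cmod (g n))\<^sup>2)"
  shows "summable (\<lambda>n. cmod (f n * cnj (g n)))"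
proof (rule summable_comparison_test'[OF summable_add[OF assms], of 0])
  fix n
  show "norm (cmod (f n * cnj (g n))) \<le> (cmod (f n))\<^sup>2 + (cmod (g n))\<^sup>2"
    using sum_squares_bound[of "cmod (f n)" "cmod (g n)"] mult_nonneg_nonneg[OF norm_ge_zero norm_ge_zero, of "f n" "g n"]
    by (simp only: norm_mult complex_mod_cnj real_norm_def abs_norm_cancel abs_mult norm_ge_zero)
qed

lemma summable_cmod_scale:
  "summable (\<lambda>n. (cmod (f n))\<^sup>2) \<Longrightarrow> summable (\<lambda>n. (cmod (c * f n))\<^sup>2)"
  by (simp add: norm_mult power_mult_distrib summable_mult)

lemma Re_mult_cnj_self: "Re (z * cnj z) = (cmod z)\<^sup>2"
  by (simp only: cmod_power2) (simp add: power2_eq_square)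

lemma Re_mult_cnj_le: "\<bar>Re (a * cnj b)\<bar> \<le> cmod (a * cnj b)"
  by (rule abs_Re_le_cmod)

lemma summable_Re_mult:
  "summable (\<lambda>n. Re (coord a n * cnj (coord b n)))"
  by (rule summable_comparison_test'[OF summable_cmod_mult[OF summable_coord[of a] summable_coord[of b]], of 0])
     (simp add: Re_mult_cnj_le del: times_complex.simps complex_cnj)

text \<open>Only the real structure is registered, which already gives norm, topology and
  Cauchy-Schwarz. The complex structure is layered on top by \<open>scaleC\<close> and by
  \<open>ip\<close>, whose real part is this \<open>inner\<close>.\<close>

instantiation ell2 :: real_inner
begin

definition "0 = Ell2 (\<lambda>_. 0)"
definition "a + b = Ell2 (\<lambda>n. coord a n + coord b n)"
definition "a - b = Ell2 (\<lambda>n. coord a n - coord b n)"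
definition "- a = Ell2 (\<lambda>n. - coord a n)"
definition "r *\<^sub>R a = Ell2 (\<lambda>n. of_real r * coord a n)"
definition "inner a b = (\<Sum>n. Re (coord a n * cnj (coord b n)))"
definition "norm (a::ell2) = sqrt (inner a a)"
definition "sgn (a::ell2) = inverse (norm a) *\<^sub>R a"
definition "dist (a::ell2) b = norm (a - b)"
definition "(uniformity :: (ell2 \<times> ell2) filter) = (INF e\<in>{0<..}. principal {(x, y). dist x y < e})"
definition "open (U :: ell2 set) \<longleftrightarrow> (\<forall>x\<in>U. \<forall>\<^sub>F (x', y) in uniformity. x' = x \<longrightarrow> y \<in> U)"

lemma coord_zero [simp]: "coord 0 n = 0"
  by (simp add: zero_ell2_def coord_Ell2)

lemma coord_add [simp]: "coord (a + b) n = coord a n + coord b n"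
  by (simp add: plus_ell2_def coord_Ell2 summable_cmod_add summable_coord)

lemma coord_uminus [simp]: "coord (- a) n = - coord a n"
  by (simp add: uminus_ell2_def coord_Ell2 summable_coord)

lemma coord_diff [simp]: "coord (a - b) n = coord a n - coord b n"
  using summable_cmod_add[OF summable_coord[of a], of "\<lambda>n. - coord b n"]
  by (simp add: minus_ell2_def coord_Ell2 summable_coord)

lemma coord_scaleR [simp]: "coord (r *\<^sub>R a) n = of_real r * coord a n"
  by (simp add: scaleR_ell2_def coord_Ell2 summable_coord summable_cmod_scale)

instance
proof
  fix a b c :: ell2 and r s :: real
  show "a + b + c = a + (b + c)" "a + b = b + a" "0 + a = a" "- a + a = 0" "a - b = a + - b"
    "r *\<^sub>R (a + b) = r *\<^sub>R a + r *\<^sub>R b" "(r + s) *\<^sub>R a = r *\<^sub>R a + s *\<^sub>R a"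
    "r *\<^sub>R s *\<^sub>R a = (r * s) *\<^sub>R a" "1 *\<^sub>R a = a"
    by (auto intro!: ell2_eqI simp: algebra_simps)
  show "inner a b = inner b a"
    by (simp add: inner_ell2_def algebra_simps)
  show "inner (a + b) c = inner a c + inner b c"
    unfolding inner_ell2_def
    by (subst suminf_add[OF summable_Re_mult summable_Re_mult]) (simp add: algebra_simps)
  show "inner (r *\<^sub>R a) b = r * inner a b"
    unfolding inner_ell2_def
    by (subst suminf_mult[OF summable_Re_mult, symmetric]) (simp add: algebra_simps)
  have sq: "Re (coord a n * cnj (coord a n)) = (cmod (coord a n))\<^sup>2" for n
    by (rule Re_mult_cnj_self)
  show "0 \<le> inner a a"
    unfolding inner_ell2_def sq by (rule suminf_nonneg[OF summable_coord]) simp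
  show "(inner a a = 0) = (a = 0)"
  proof
    assume "inner a a = 0"
    then have "(\<Sum>n. (cmod (coord a n))\<^sup>2) = 0" by (simp only: inner_ell2_def sq)
    then have "\<forall>n. (cmod (coord a n))\<^sup>2 = 0"
      by (subst (asm) suminf_eq_zero_iff) (auto simp: summable_coord)
    then show "a = 0" by (auto intro: ell2_eqI)
  qed (simp add: inner_ell2_def)
qed (auto simp: norm_ell2_def sgn_ell2_def dist_ell2_def uniformity_ell2_def open_ell2_def)

end

lemma coord_sum [simp]: "coord (\<Sum>i\<in>I. f i) n = (\<Sum>i\<in>I. coord (f i) n)"
  by (induction I rule: infinite_finite_induct) auto

definition scaleC :: "complex \<Rightarrow> ell2 \<Rightarrow> ell2" (infixr "*\<^sub>C" 75) where
  "c *\<^sub>C a = Ell2 (\<lambda>n. c * coord a n)"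

lemma coord_scaleC [simp]: "coord (c *\<^sub>C a) n = c * coord a n"
  by (simp add: scaleC_def coord_Ell2 summable_coord summable_cmod_scale)

lemma scaleC_simps [simp]: "1 *\<^sub>C a = a" "0 *\<^sub>C a = 0" "c *\<^sub>C 0 = 0" "c *\<^sub>C d *\<^sub>C a = (c * d) *\<^sub>C a"
  by (auto intro!: ell2_eqI)

lemma scaleR_scaleC: "r *\<^sub>R a = of_real r *\<^sub>C a"
  by (auto intro!: ell2_eqI)

definition ip :: "ell2 \<Rightarrow> ell2 \<Rightarrow> complex" where
  "ip a b = (\<Sum>n. coord a n * cnj (coord b n))"

lemma summable_ip: "summable (\<lambda>n. coord a n * cnj (coord b n))"
  by (rule summable_norm_cancel[OF summable_cmod_mult[OF summable_coord summable_coord]])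

lemma ip_add_left: "ip (a + b) c = ip a c + ip b c"
  unfolding ip_def by (subst suminf_add[OF summable_ip summable_ip]) (simp add: algebra_simps)

lemma ip_scaleC_left: "ip (z *\<^sub>C a) b = z * ip a b"
  unfolding ip_def by (subst suminf_mult[OF summable_ip, symmetric]) (simp add: algebra_simps)

lemma ip_commute: "ip b a = cnj (ip a b)"
proof -
  have "(\<lambda>n. cnj (coord a n * cnj (coord b n))) sums cnj (ip a b)"
    unfolding ip_def sums_cnj by (rule summable_sums[OF summable_ip])
  then show ?thesis unfolding ip_def by (simp add: sums_iff mult.commute)
qed

lemma ip_add_right: "ip a (b + c) = ip a b + ip a c"
  by (metis ip_add_left ip_commute complex_cnj_add)

lemma ip_scaleC_right: "ip a (z *\<^sub>C b) = cnj z * ip a b"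
  by (metis ip_scaleC_left ip_commute complex_cnj_mult)

lemma Re_ip: "Re (ip a b) = inner a b"
  unfolding ip_def inner_ell2_def using Re_suminf[OF summable_ip] by simp

lemma ip_self: "ip a a = of_real ((norm a)\<^sup>2)"
proof (rule complex_eqI)
  show "Re (ip a a) = Re (of_real ((norm a)\<^sup>2))"
    by (simp add: Re_ip power2_norm_eq_inner)
  have "Im (ip a a) = - Im (ip a a)" by (subst ip_commute) simp
  then show "Im (ip a a) = Im (of_real ((norm a)\<^sup>2))" by simp
qed

lemma norm_square_ell2: "(norm a)\<^sup>2 = (\<Sum>n. (cmod (coord a n))\<^sup>2)"
proof -
  have "Re (coord a n * cnj (coord a n)) = (cmod (coord a n))\<^sup>2" for n
    by (rule Re_mult_cnj_self)
  then show ?thesis by (simp only: power2_norm_eq_inner inner_ell2_def)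
qed

lemma norm_scaleC [simp]: "norm (c *\<^sub>C a) = cmod c * norm a"
proof -
  have "(norm (c *\<^sub>C a))\<^sup>2 = (cmod c * norm a)\<^sup>2"
    by (simp add: norm_square_ell2 norm_mult power_mult_distrib suminf_mult summable_coord)
  then show ?thesis by simp
qed

text \<open>Rotating \<open>a\<close> by the phase \<open>c\<close> makes the product real and
  nonnegative, which reduces the bound to Cauchy-Schwarz for \<open>inner\<close>.\<close>

lemma norm_ip_le: "cmod (ip a b) \<le> norm a * norm b"
proof (cases "ip a b = 0")
  case False
  define c where "c = cnj (ip a b) / cmod (ip a b)"
  have c: "cmod c = 1" using False by (simp add: c_def norm_divide)
  have "c * ip a b = of_real (cmod (ip a b))"
    using False complex_norm_square[of "ip a b"] by (simp add: c_def power2_eq_square field_simps)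
  then have "cmod (ip a b) = inner (c *\<^sub>C a) b"
    by (metis Re_complex_of_real Re_ip ip_scaleC_left)
  also have "\<dots> \<le> norm (c *\<^sub>C a) * norm b" by (rule norm_cauchy_schwarz)
  finally show ?thesis using c by simp
qed simp

text \<open>A form that is conjugate-linear in its second argument is still bilinear over the reals;
  this opens the limit and sum rules for bounded bilinear maps.\<close>

lemma bounded_bilinear_ip: "bounded_bilinear ip"
proof
  show "\<exists>K. \<forall>a b. norm (ip a b) \<le> norm a * norm b * K"
    by (rule exI[of _ 1]) (simp add: norm_ip_le)
qed (simp_all add: ip_add_left ip_add_right scaleR_scaleC ip_scaleC_left ip_scaleC_right scaleR_conv_of_real)

lemma bounded_bilinear_scaleC: "bounded_bilinear scaleC"
proof
  show "\<exists>K. \<forall>c a. norm (c *\<^sub>C a) \<le> norm c * norm a * K"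
    by (rule exI[of _ 1]) simp
qed (auto intro!: ell2_eqI simp: algebra_simps scaleR_conv_of_real)

lemmas ip_simps = ip_add_left ip_add_right ip_scaleC_left ip_scaleC_right
  bounded_bilinear.sum_left[OF bounded_bilinear_ip] bounded_bilinear.sum_right[OF bounded_bilinear_ip]
  bounded_bilinear.diff_left[OF bounded_bilinear_ip] bounded_bilinear.diff_right[OF bounded_bilinear_ip]
  bounded_bilinear.minus_left[OF bounded_bilinear_ip] bounded_bilinear.minus_right[OF bounded_bilinear_ip]
  bounded_bilinear.zero_left[OF bounded_bilinear_ip] bounded_bilinear.zero_right[OF bounded_bilinear_ip]

lemmas tendsto_ip = bounded_bilinear.tendsto[OF bounded_bilinear_ip]
lemmas tendsto_scaleC = bounded_bilinear.tendsto[OF bounded_bilinear_scaleC]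

lemma norm_coord_le: "cmod (coord a n) \<le> norm a"
proof -
  have "(cmod (coord a n))\<^sup>2 \<le> (norm a)\<^sup>2"
    unfolding norm_square_ell2
    using sum_le_suminf[OF summable_coord, of "{n}" a] by simp
  then show ?thesis by simp
qed

lemma bounded_linear_coord: "bounded_linear (\<lambda>a. coord a n)"
  by (rule bounded_linear_intro[of _ 1]) (auto simp: scaleR_conv_of_real norm_coord_le)

lemmas tendsto_coord = bounded_linear.tendsto[OF bounded_linear_coord]

definition delta :: "nat \<Rightarrow> ell2" where
  "delta n = Ell2 (\<lambda>k. if k = n then 1 else 0)"

lemma coord_delta [simp]: "coord (delta n) k = (if k = n then 1 else 0)"
proof -
  have "summable (\<lambda>k. (cmod (if k = n then 1 else 0))\<^sup>2)"
    by (rule summable_finite[of "{n}"]) auto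
  then show ?thesis by (simp add: delta_def coord_Ell2)
qed

lemma ip_delta_right [simp]: "ip a (delta n) = coord a n"
proof -
  have "(\<Sum>k. coord a k * cnj (coord (delta n) k)) = (\<Sum>k\<in>{n}. coord a k * cnj (coord (delta n) k))"
    by (rule suminf_finite) auto
  then show ?thesis by (simp add: ip_def)
qed

lemma ip_delta_left [simp]: "ip (delta n) a = cnj (coord a n)"
  by (metis ip_commute ip_delta_right)

text \<open>By Pythagoras the squared error is the tail of the convergent series for the squared
  norm.\<close>

lemma truncation_tendsto: "(\<lambda>N. \<Sum>n<N. coord a n *\<^sub>C delta n) \<longlonglongrightarrow> a"
proof -
  define t where "t N = (\<Sum>n<N. coord a n *\<^sub>C delta n)" for N
  have ct: "coord (t N) n = (if n < N then coord a n else 0)" for N n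
    unfolding t_def by (simp add: if_distrib[of "(*) _"] sum.delta cong: if_cong)
  have "(norm (a - t N))\<^sup>2 = (norm a)\<^sup>2 - (\<Sum>n<N. (cmod (coord a n))\<^sup>2)" for N
  proof -
    have "(\<Sum>n. (cmod (coord (a - t N) n))\<^sup>2)
        = (\<Sum>n. (cmod (coord (a - t N) (n + N)))\<^sup>2) + (\<Sum>n<N. (cmod (coord (a - t N) n))\<^sup>2)"
      by (rule suminf_split_initial_segment[OF summable_coord])
    also have "\<dots> = (\<Sum>n. (cmod (coord a (n + N)))\<^sup>2)" by (simp add: ct)
    also have "\<dots> = (norm a)\<^sup>2 - (\<Sum>n<N. (cmod (coord a n))\<^sup>2)"
      using suminf_split_initial_segment[OF summable_coord, of a N] by (simp add: norm_square_ell2)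
    finally show ?thesis by (simp add: norm_square_ell2)
  qed
  moreover have "(\<lambda>N. (norm a)\<^sup>2 - (\<Sum>n<N. (cmod (coord a n))\<^sup>2)) \<longlonglongrightarrow> (norm a)\<^sup>2 - (norm a)\<^sup>2"
    unfolding norm_square_ell2 by (intro tendsto_diff tendsto_const summable_LIMSEQ summable_coord)
  ultimately have "(\<lambda>N. (norm (a - t N))\<^sup>2) \<longlonglongrightarrow> 0" by simp
  then have "(\<lambda>N. norm (a - t N)) \<longlonglongrightarrow> 0"
    using tendsto_real_sqrt by fastforce
  then show ?thesis
    unfolding t_def[symmetric] by (subst LIM_zero_iff[symmetric], subst tendsto_norm_zero_iff[symmetric])
       (simp add: norm_minus_commute)
qed

text \<open>This serves every dimension count below: trial vectors orthogonal to given ones, and the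
  comparison of multiplicities. The induction eliminates from the remaining equations an unknown
  whose coefficient in equation \<open>j0\<close> is nonzero.\<close>

lemma linear_system_nontrivial:
  fixes M :: "'a \<Rightarrow> 'b \<Rightarrow> complex"
  assumes "finite J" "finite I" "card J < card I"
  shows "\<exists>c. (\<exists>i\<in>I. c i \<noteq> 0) \<and> (\<forall>j\<in>J. (\<Sum>i\<in>I. c i * M i j) = 0)"
  using assms
proof (induction J arbitrary: I M rule: finite_induct)
  case empty
  then obtain i where "i \<in> I" by fastforce
  then show ?case by (intro exI[of _ "\<lambda>_. 1"]) auto
next
  case (insert j0 J)
  show ?case
  proof (cases "\<forall>i\<in>I. M i j0 = 0")
    case True
    have "card J < card I" using insert by simp
    then show ?thesis using insert.IH[OF insert.prems(1), of M] True by auto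
  next
    case False
    then obtain i0 where i0: "i0 \<in> I" "M i0 j0 \<noteq> 0" by blast
    define N where "N i j = M i j - M i j0 / M i0 j0 * M i0 j" for i j
    have "card J < card (I - {i0})" using insert i0 by simp
    then obtain c where c: "\<exists>i\<in>I - {i0}. c i \<noteq> 0" "\<forall>j\<in>J. (\<Sum>i\<in>I - {i0}. c i * N i j) = 0"
      using insert.IH[of "I - {i0}" N] insert.prems by auto
    \<comment> \<open>The value at \<open>i0\<close> is forced by equation \<open>j0\<close>;
      substituting it into equation \<open>j\<close> turns the coefficients \<open>M\<close> into
      the reduced ones \<open>N\<close>.\<close>
    define c' where "c' = c(i0 := - (\<Sum>i\<in>I - {i0}. c i * M i j0) / M i0 j0)"
    have *: "(\<Sum>i\<in>I. c' i * M i j) = (\<Sum>i\<in>I - {i0}. c i * N i j)" for j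
    proof -
      have "(\<Sum>i\<in>I. c' i * M i j) = c' i0 * M i0 j + (\<Sum>i\<in>I - {i0}. c' i * M i j)"
        using insert.prems i0 by (simp add: sum.remove)
      also have "(\<Sum>i\<in>I - {i0}. c' i * M i j) = (\<Sum>i\<in>I - {i0}. c i * M i j)"
        by (rule sum.cong) (auto simp: c'_def)
      also have "c' i0 * M i0 j = - (\<Sum>i\<in>I - {i0}. c i * (M i j0 / M i0 j0 * M i0 j))"
        by (simp add: c'_def sum_distrib_right sum_distrib_left sum_divide_distrib algebra_simps)
      finally show ?thesis by (simp add: N_def right_diff_distrib sum_subtractf)
    qed
    have "(\<Sum>i\<in>I - {i0}. c i * N i j0) = 0" using i0 by (simp add: N_def)
    then have "\<forall>j\<in>insert j0 J. (\<Sum>i\<in>I. c' i * M i j) = 0" using c * by auto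
    moreover have "\<exists>i\<in>I. c' i \<noteq> 0" using c by (auto simp: c'_def)
    ultimately show ?thesis by blast
  qed
qed

section \<open>Quadratic forms with compact resolvent\<close>

definition kin :: "(nat \<Rightarrow> real) \<Rightarrow> ell2 \<Rightarrow> real" where
  "kin T a = (\<Sum>n. T n * (cmod (coord a n))\<^sup>2)"

text \<open>The form domain. For the weight \<open>1 + |\<xi>|^2\<close> over the dual lattice it is
  the Sobolev space \<open>H^1\<close> of the torus in Fourier coordinates.\<close>

definition wdom :: "(nat \<Rightarrow> real) \<Rightarrow> ell2 set" where
  "wdom W = {a. summable (\<lambda>n. W n * (cmod (coord a n))\<^sup>2)}"

text \<open>Turns the diagonal form with entries \<open>T\<close> into an inner product. Off \<open>wdom T\<close> the
  argument of \<open>Ell2\<close> is not square-summable and the value is arbitrary.\<close>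
definition wvec :: "(nat \<Rightarrow> real) \<Rightarrow> ell2 \<Rightarrow> ell2" where
  "wvec T a = Ell2 (\<lambda>n. of_real (sqrt (T n)) * coord a n)"

text \<open>The sesquilinear form of the operator with diagonal part \<open>T\<close> and bounded
  part \<open>A\<close>. Passing the diagonal part through \<open>wvec\<close> lets it inherit the
  algebra of \<open>ip\<close>.\<close>

definition fqf :: "(nat \<Rightarrow> real) \<Rightarrow> (ell2 \<Rightarrow> ell2) \<Rightarrow> ell2 \<Rightarrow> ell2 \<Rightarrow> complex" where
  "fqf T A a b = ip (wvec T a) (wvec T b) + ip (A a) b"

definition fq :: "(nat \<Rightarrow> real) \<Rightarrow> (ell2 \<Rightarrow> ell2) \<Rightarrow> ell2 \<Rightarrow> real" where
  "fq T A a = kin T a + inner (A a) a"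

text \<open>Fatou's lemma for series: each finite partial sum passes to the limit and stays below
  the limit of the bounds. The limit \<open>f\<close> is a bare sequence because its
  square-summability may be what has to be derived, and the bound \<open>C p\<close> may move so
  that a convergent potential term can be subtracted.\<close>

lemma kin_Fatou:
  fixes a :: "nat \<Rightarrow> ell2"
  assumes "\<And>n. (\<lambda>p. coord (a p) n) \<longlonglongrightarrow> f n" "\<And>n. (\<lambda>p. T p n) \<longlonglongrightarrow> T' n"
    and "\<And>p n. 0 \<le> T p n" and "\<And>p. a p \<in> wdom (T p)" and "\<And>p. kin (T p) (a p) \<le> C p" "C \<longlonglongrightarrow> C'"
  shows "summable (\<lambda>n. T' n * (cmod (f n))\<^sup>2)" "(\<Sum>n. T' n * (cmod (f n))\<^sup>2) \<le> C'"
proof -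
  have nonneg: "0 \<le> T' n" for n
    by (rule tendsto_lowerbound[OF assms(2)]) (use assms(3) in auto)
  have part: "(\<Sum>n<N. T' n * (cmod (f n))\<^sup>2) \<le> C'" for N
  proof (rule LIMSEQ_le[OF _ assms(6)])
    show "(\<lambda>p. \<Sum>n<N. T p n * (cmod (coord (a p) n))\<^sup>2) \<longlonglongrightarrow> (\<Sum>n<N. T' n * (cmod (f n))\<^sup>2)"
      by (intro tendsto_intros assms)
    have "(\<Sum>n<N. T p n * (cmod (coord (a p) n))\<^sup>2) \<le> kin (T p) (a p)" for p
      unfolding kin_def using assms(3,4) by (intro sum_le_suminf) (auto simp: wdom_def)
    then show "\<exists>N'. \<forall>p\<ge>N'. (\<Sum>n<N. T p n * (cmod (coord (a p) n))\<^sup>2) \<le> C p"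
      using assms(5) order_trans by blast
  qed
  show "summable (\<lambda>n. T' n * (cmod (f n))\<^sup>2)"
    by (rule summableI_nonneg_bounded[OF _ part]) (simp add: nonneg)
  then show "(\<Sum>n. T' n * (cmod (f n))\<^sup>2) \<le> C'"
    by (rule suminf_le_const[OF _ part])
qed

section \<open>Weights tending to infinity and compactness of the form domain\<close>

locale weight =
  fixes W :: "nat \<Rightarrow> real"
  assumes W_ge: "1 \<le> W n" and W_fin: "finite {n. W n \<le> C}"
begin

lemma W_nonneg: "0 \<le> W n"
  using W_ge[of n] by simp

lemma wdom_add: "a \<in> wdom W \<Longrightarrow> b \<in> wdom W \<Longrightarrow> a + b \<in> wdom W"
proof -
  assume ab: "a \<in> wdom W" "b \<in> wdom W"
  have le: "norm (W n * (cmod (coord (a + b) n))\<^sup>2)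
      \<le> 2 * (W n * (cmod (coord a n))\<^sup>2) + 2 * (W n * (cmod (coord b n))\<^sup>2)" for n
    using mult_left_mono[OF cmod_add_square_le[of "coord a n" "coord b n"] W_nonneg[of n]]
    by (simp add: W_nonneg abs_mult algebra_simps)
  have s: "summable (\<lambda>n. 2 * (W n * (cmod (coord a n))\<^sup>2) + 2 * (W n * (cmod (coord b n))\<^sup>2))"
    using ab by (intro summable_add summable_mult) (auto simp: wdom_def)
  show "a + b \<in> wdom W"
    unfolding wdom_def mem_Collect_eq by (rule summable_comparison_test'[OF s, where N = 0]) (rule le)
qed

lemma wdom_scaleC: "a \<in> wdom W \<Longrightarrow> c *\<^sub>C a \<in> wdom W"
  using summable_mult[of "\<lambda>n. W n * (cmod (coord a n))\<^sup>2" "(cmod c)\<^sup>2"]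
  by (simp add: wdom_def norm_mult power_mult_distrib algebra_simps)

lemma wdom_zero: "0 \<in> wdom W"
  by (simp add: wdom_def)

lemma wdom_sum: "(\<And>i. i \<in> I \<Longrightarrow> f i \<in> wdom W) \<Longrightarrow> (\<Sum>i\<in>I. f i) \<in> wdom W"
  by (induction I rule: infinite_finite_induct) (auto simp: wdom_zero wdom_add)

lemma wdom_diff: "a \<in> wdom W \<Longrightarrow> b \<in> wdom W \<Longrightarrow> a - b \<in> wdom W"
proof -
  have "a - b = a + (-1) *\<^sub>C b" by (rule ell2_eqI) simp
  then show "a \<in> wdom W \<Longrightarrow> b \<in> wdom W \<Longrightarrow> a - b \<in> wdom W"
    using wdom_add wdom_scaleC by metis
qed

lemma wdom_delta: "delta n \<in> wdom W"
  unfolding wdom_def mem_Collect_eq by (rule summable_finite[of "{n}"]) auto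

text \<open>Coordinates with weight above \<open>C\<close> satisfy \<open>1 < W n / C\<close>, so
  the energy controls them; the others are finitely many.\<close>

lemma norm_le_tail:
  assumes "a \<in> wdom W" "0 < C"
  shows "(norm a)\<^sup>2 \<le> (\<Sum>n\<in>{n. W n \<le> C}. (cmod (coord a n))\<^sup>2) + kin W a / C"
proof -
  let ?F = "{n. W n \<le> C}"
  let ?f = "\<lambda>n. if n \<in> ?F then (cmod (coord a n))\<^sup>2 else 0"
  let ?g = "\<lambda>n. W n * (cmod (coord a n))\<^sup>2 / C"
  have f: "?f sums (\<Sum>n\<in>?F. (cmod (coord a n))\<^sup>2)"
    by (rule sums_If_finite_set[OF W_fin])
  have g: "?g sums (kin W a / C)"
    unfolding kin_def using assms by (intro sums_divide summable_sums) (simp add: wdom_def)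
  have "(cmod (coord a n))\<^sup>2 \<le> ?f n + ?g n" for n
  proof (cases "n \<in> ?F")
    case False
    then have "C * (cmod (coord a n))\<^sup>2 \<le> W n * (cmod (coord a n))\<^sup>2"
      by (intro mult_right_mono) auto
    then show ?thesis using False assms by (simp add: field_simps)
  qed (use assms W_nonneg in simp)
  then show ?thesis
    unfolding norm_square_ell2 using sums_le[OF _ summable_sums[OF summable_coord] sums_add[OF f g], of a] by simp
qed

text \<open>Rellich compactness in sequence form. A diagonal subsequence converges in every
  coordinate, Fatou places the limit in the form domain, and \<open>norm_le_tail\<close> upgrades
  coordinatewise to norm convergence because the high coordinates are uniformly small.\<close>

lemma wdom_compact:
  fixes a :: "nat \<Rightarrow> ell2"
  assumes dom: "\<And>p. a p \<in> wdom W" and bound: "\<And>p. kin W (a p) \<le> C"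
  shows "\<exists>r l. strict_mono r \<and> (a \<circ> r) \<longlonglongrightarrow> l"
proof -
  have C0: "0 \<le> C"
  proof -
    have "0 \<le> kin W (a 0)"
      unfolding kin_def using dom[of 0] by (intro suminf_nonneg) (auto simp: wdom_def W_nonneg)
    then show ?thesis using bound[of 0] by simp
  qed
  have "norm (coord (a p) n) \<le> sqrt C" for p n
  proof -
    have "(cmod (coord (a p) n))\<^sup>2 \<le> W n * (cmod (coord (a p) n))\<^sup>2"
      using mult_right_mono[OF W_ge, of "(cmod (coord (a p) n))\<^sup>2"] by simp
    also have "\<dots> \<le> kin W (a p)"
      unfolding kin_def using dom[of p]
        sum_le_suminf[of "\<lambda>n. W n * (cmod (coord (a p) n))\<^sup>2" "{n}"] by (simp add: wdom_def W_nonneg)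
    finally show ?thesis using bound[of p] by (intro real_le_rsqrt) simp
  qed
  then obtain r where r: "strict_mono r" "\<And>n. \<exists>l. (\<lambda>p. coord (a (r p)) n) \<longlonglongrightarrow> l"
    using function_convergent_subsequence[of UNIV "\<lambda>p n. coord (a p) n" "sqrt C"] by (metis UNIV_I countableI_type)
  then obtain f where f: "\<And>n. (\<lambda>p. coord (a (r p)) n) \<longlonglongrightarrow> f n" by metis
  have Wf: "summable (\<lambda>n. W n * (cmod (f n))\<^sup>2)" "(\<Sum>n. W n * (cmod (f n))\<^sup>2) \<le> C"
    using kin_Fatou[of "\<lambda>p. a (r p)" f "\<lambda>_. W" W "\<lambda>_. C" C] f dom bound W_nonneg by auto
  have "summable (\<lambda>n. (cmod (f n))\<^sup>2)"
  proof (rule summable_comparison_test'[OF Wf(1), of 0])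
    show "norm ((cmod (f n))\<^sup>2) \<le> W n * (cmod (f n))\<^sup>2" for n
      using mult_right_mono[OF W_ge, of "(cmod (f n))\<^sup>2" n] by simp
  qed
  define l where "l = Ell2 f"
  have l: "coord l = f" unfolding l_def by (rule coord_Ell2) fact
  have ldom: "l \<in> wdom W" and lC: "kin W l \<le> C" using Wf by (auto simp: wdom_def kin_def l)
  define d where "d p = a (r p) - l" for p
  have ddom: "d p \<in> wdom W" for p unfolding d_def by (intro wdom_diff dom ldom)
  \<comment> \<open>The square of a sum is at most twice the sum of the squares, and both energies
    are at most \<open>C\<close>.\<close>
  have dC: "kin W (d p) \<le> 4 * C" for p
  proof -
    have "kin W (d p) \<le> (\<Sum>n. 2 * (W n * (cmod (coord (a (r p)) n))\<^sup>2) + 2 * (W n * (cmod (coord l n))\<^sup>2))"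
      unfolding kin_def
    proof (rule suminf_le)
      fix n
      show "W n * (cmod (coord (d p) n))\<^sup>2 \<le> 2 * (W n * (cmod (coord (a (r p)) n))\<^sup>2) + 2 * (W n * (cmod (coord l n))\<^sup>2)"
        using mult_left_mono[OF cmod_add_square_le[of "coord (a (r p)) n" "- coord l n"] W_nonneg[of n]]
        by (simp add: d_def algebra_simps)
    qed (use ddom[of p] dom[of "r p"] ldom in \<open>auto simp: wdom_def intro!: summable_add summable_mult\<close>)
    also have "\<dots> = 2 * kin W (a (r p)) + 2 * kin W l"
      unfolding kin_def using dom[of "r p"] ldom
      by (intro sums_unique[symmetric] sums_add sums_mult summable_sums) (auto simp: wdom_def)
    finally show ?thesis using bound[of "r p"] lC by simp
  qed
  have "(\<lambda>p. (norm (d p))\<^sup>2) \<longlonglongrightarrow> 0"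
  proof (rule LIMSEQ_I)
    fix e :: real assume e: "0 < e"
    \<comment> \<open>A cut-off level at which the high coordinates contribute at most
      \<open>4 * C / R\<close>, less than half of \<open>e\<close>.\<close>
    define R where "R = 8 * C / e + 1"
    have R: "0 < R" using e C0 by (simp add: R_def add_nonneg_pos)
    have Re: "4 * C / R < e / 2"
    proof -
      have "8 * C < R * e" using e by (simp add: R_def field_simps)
      then show ?thesis using R by (simp add: field_simps)
    qed
    have "(\<lambda>p. \<Sum>n\<in>{n. W n \<le> R}. (cmod (coord (d p) n))\<^sup>2) \<longlonglongrightarrow> (\<Sum>n\<in>{n. W n \<le> R}. (cmod (f n - f n))\<^sup>2)"
      unfolding d_def coord_diff l by (intro tendsto_intros f)
    then have "eventually (\<lambda>p. (\<Sum>n\<in>{n. W n \<le> R}. (cmod (coord (d p) n))\<^sup>2) < e / 2) sequentially"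
      using e by (intro order_tendstoD(2)) auto
    then obtain N where N: "\<And>p. p \<ge> N \<Longrightarrow> (\<Sum>n\<in>{n. W n \<le> R}. (cmod (coord (d p) n))\<^sup>2) < e / 2"
      by (auto simp: eventually_sequentially)
    have "norm ((norm (d p))\<^sup>2 - 0) < e" if "p \<ge> N" for p
    proof -
      have "kin W (d p) / R \<le> 4 * C / R" using dC R by (intro divide_right_mono) auto
      then show ?thesis using norm_le_tail[OF ddom R, of p] N[OF that] Re by simp
    qed
    then show "\<exists>N. \<forall>p\<ge>N. norm ((norm (d p))\<^sup>2 - 0) < e" by blast
  qed
  then have "(\<lambda>p. norm (d p)) \<longlonglongrightarrow> 0"
    using tendsto_real_sqrt by fastforce
  then have "(a \<circ> r) \<longlonglongrightarrow> l"
    unfolding d_def by (simp add: tendsto_norm_zero_iff LIM_zero_iff comp_def)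
  then show ?thesis using r(1) by blast
qed

end

text \<open>The two-sided comparison of \<open>T\<close> with \<open>W\<close> gives every such form
  the same form domain \<open>wdom W\<close>. The constants \<open>c\<close> and \<open>K\<close>
  are parameters so that a whole sequence of forms can share them.\<close>

locale form = weight W for W :: "nat \<Rightarrow> real" +
  fixes T :: "nat \<Rightarrow> real" and A :: "ell2 \<Rightarrow> ell2" and c K :: real
  assumes T_nonneg: "0 \<le> T n" and W_le: "W n \<le> c * (1 + T n)" and T_le: "T n \<le> c * W n"
    and A_add: "A (a + b) = A a + A b" and A_scaleC: "A (z *\<^sub>C a) = z *\<^sub>C A a"
    and A_bound: "norm (A a) \<le> K * norm a"
    and A_herm: "ip (A a) b = ip a (A b)" and A_pos: "0 \<le> inner (A a) a"
begin

lemma c_pos: "0 < c"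
proof (rule ccontr)
  assume "\<not> 0 < c"
  then have "c * (1 + T 0) \<le> 0" using T_nonneg[of 0] by (intro mult_nonpos_nonneg) auto
  then show False using W_le[of 0] W_ge[of 0] by simp
qed

lemma wdom_T: "a \<in> wdom W \<Longrightarrow> a \<in> wdom T"
  unfolding wdom_def mem_Collect_eq
proof (rule summable_comparison_test'[OF summable_mult, of _ 0 _ c])
  fix n show "norm (T n * (cmod (coord a n))\<^sup>2) \<le> c * (W n * (cmod (coord a n))\<^sup>2)"
    using mult_right_mono[OF T_le, of "(cmod (coord a n))\<^sup>2" n] by (simp add: T_nonneg mult.assoc)
qed

lemma wdom_W: "a \<in> wdom T \<Longrightarrow> a \<in> wdom W"
  unfolding wdom_def mem_Collect_eq
proof (rule summable_comparison_test'[OF summable_mult[OF summable_add[OF summable_coord[of a]]], of _ 0 _ c])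
  fix n show "norm (W n * (cmod (coord a n))\<^sup>2) \<le> c * ((cmod (coord a n))\<^sup>2 + T n * (cmod (coord a n))\<^sup>2)"
    using mult_right_mono[OF W_le, of "(cmod (coord a n))\<^sup>2" n] by (simp add: W_nonneg algebra_simps)
qed

lemma kin_T_nonneg: "a \<in> wdom W \<Longrightarrow> 0 \<le> kin T a"
  unfolding kin_def by (rule suminf_nonneg) (use wdom_T[of a] in \<open>auto simp: T_nonneg wdom_def\<close>)

lemma fq_nonneg: "a \<in> wdom W \<Longrightarrow> 0 \<le> fq T A a"
  using kin_T_nonneg A_pos by (simp add: fq_def)

text \<open>Converts bounded norm and energy into the hypothesis of \<open>wdom_compact\<close>;
  positivity of \<open>A\<close> lets the energy dominate its kinetic part.\<close>

lemma kin_W_le: "a \<in> wdom W \<Longrightarrow> kin W a \<le> c * ((norm a)\<^sup>2 + fq T A a)"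
proof -
  assume a: "a \<in> wdom W"
  have s: "summable (\<lambda>n. T n * (cmod (coord a n))\<^sup>2)" using wdom_T[OF a] by (simp add: wdom_def)
  have "kin W a \<le> (\<Sum>n. c * ((cmod (coord a n))\<^sup>2 + T n * (cmod (coord a n))\<^sup>2))"
    unfolding kin_def
  proof (rule suminf_le)
    fix n show "W n * (cmod (coord a n))\<^sup>2 \<le> c * ((cmod (coord a n))\<^sup>2 + T n * (cmod (coord a n))\<^sup>2)"
      using mult_right_mono[OF W_le, of "(cmod (coord a n))\<^sup>2" n] by (simp add: algebra_simps)
  qed (use a s in \<open>auto simp: wdom_def intro!: summable_mult summable_add summable_coord\<close>)
  also have "\<dots> = c * ((norm a)\<^sup>2 + kin T a)"
    unfolding kin_def norm_square_ell2 using s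
    by (simp add: suminf_mult summable_add summable_coord flip: suminf_add)
  also have "\<dots> \<le> c * ((norm a)\<^sup>2 + fq T A a)"
    using c_pos A_pos by (simp add: fq_def)
  finally show ?thesis .
qed

lemma coord_wvec: "a \<in> wdom W \<Longrightarrow> coord (wvec T a) n = of_real (sqrt (T n)) * coord a n"
  unfolding wvec_def using wdom_T[of a]
  by (subst coord_Ell2) (auto simp: norm_mult power_mult_distrib T_nonneg wdom_def)

lemma wvec_add: "a \<in> wdom W \<Longrightarrow> b \<in> wdom W \<Longrightarrow> wvec T (a + b) = wvec T a + wvec T b"
  by (rule ell2_eqI) (simp add: coord_wvec wdom_add algebra_simps)

lemma wvec_scaleC: "a \<in> wdom W \<Longrightarrow> wvec T (z *\<^sub>C a) = z *\<^sub>C wvec T a"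
  by (rule ell2_eqI) (simp add: coord_wvec wdom_scaleC)

lemma wvec_zero: "wvec T 0 = 0"
  by (rule ell2_eqI) (simp add: coord_wvec wdom_zero)

lemma wvec_sum: "(\<And>i. i \<in> I \<Longrightarrow> f i \<in> wdom W) \<Longrightarrow> wvec T (\<Sum>i\<in>I. f i) = (\<Sum>i\<in>I. wvec T (f i))"
  by (induction I rule: infinite_finite_induct) (auto simp: wvec_zero wvec_add wdom_sum)

lemma kin_wvec: "a \<in> wdom W \<Longrightarrow> kin T a = (norm (wvec T a))\<^sup>2"
  by (simp add: norm_square_ell2 coord_wvec kin_def norm_mult power_mult_distrib T_nonneg)

lemma A_zero: "A 0 = 0"
  using A_scaleC[of 0 0] by simp

lemma A_diff: "A (a - b) = A a - A b"
  using A_add[of "a - b" b] by (simp add: algebra_simps)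

lemma A_sum: "A (\<Sum>i\<in>I. f i) = (\<Sum>i\<in>I. A (f i))"
  by (induction I rule: infinite_finite_induct) (auto simp: A_zero A_add)

lemma fqf_self: "a \<in> wdom W \<Longrightarrow> fqf T A a a = of_real (fq T A a)"
proof -
  assume a: "a \<in> wdom W"
  have "Im (ip (A a) a) = 0"
    using A_herm[of a a] ip_commute[of a "A a"] by (simp add: complex_eq_iff)
  then have "ip (A a) a = of_real (inner (A a) a)" by (simp add: complex_eq_iff Re_ip)
  then show ?thesis by (simp add: fqf_def fq_def kin_wvec[OF a] ip_self)
qed

lemma fqf_commute: "fqf T A b a = cnj (fqf T A a b)"
  unfolding fqf_def using ip_commute[of "wvec T a" "wvec T b"] ip_commute[of b "A a"] A_herm[of b a]
  by (metis complex_cnj_add ip_commute)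

lemma fqf_add_left: "a \<in> wdom W \<Longrightarrow> b \<in> wdom W \<Longrightarrow> fqf T A (a + b) d = fqf T A a d + fqf T A b d"
  by (simp add: fqf_def wvec_add ip_add_left A_add)

lemma fqf_scaleC_left: "a \<in> wdom W \<Longrightarrow> fqf T A (z *\<^sub>C a) d = z * fqf T A a d"
  by (simp add: fqf_def wvec_scaleC ip_scaleC_left A_scaleC algebra_simps)

lemma fqf_add_right: "a \<in> wdom W \<Longrightarrow> b \<in> wdom W \<Longrightarrow> fqf T A d (a + b) = fqf T A d a + fqf T A d b"
  by (simp add: fqf_def wvec_add ip_add_right)

lemma fqf_scaleC_right: "a \<in> wdom W \<Longrightarrow> fqf T A d (z *\<^sub>C a) = cnj z * fqf T A d a"
  by (simp add: fqf_def wvec_scaleC ip_scaleC_right algebra_simps)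

lemma fqf_sum_left: "(\<And>i. i \<in> I \<Longrightarrow> f i \<in> wdom W) \<Longrightarrow> fqf T A (\<Sum>i\<in>I. f i) d = (\<Sum>i\<in>I. fqf T A (f i) d)"
  by (simp add: fqf_def wvec_sum A_sum ip_simps sum.distrib)

lemma fqf_sum_right: "(\<And>i. i \<in> I \<Longrightarrow> f i \<in> wdom W) \<Longrightarrow> fqf T A d (\<Sum>i\<in>I. f i) = (\<Sum>i\<in>I. fqf T A d (f i))"
  by (simp add: fqf_def wvec_sum ip_simps sum.distrib)

lemma fq_add:
  assumes "a \<in> wdom W" "b \<in> wdom W"
  shows "fq T A (a + b) = fq T A a + 2 * Re (fqf T A a b) + fq T A b"
proof -
  have "fqf T A (a + b) (a + b) = fqf T A a a + fqf T A a b + (cnj (fqf T A a b) + fqf T A b b)"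
    using assms by (simp add: fqf_add_left fqf_add_right wdom_add fqf_commute[of a b] algebra_simps)
  then have "Re (fqf T A (a + b) (a + b)) = Re (fqf T A a a + fqf T A a b + (cnj (fqf T A a b) + fqf T A b b))"
    by simp
  then show ?thesis using assms by (simp add: fqf_self wdom_add)
qed

lemma fq_scaleC: "a \<in> wdom W \<Longrightarrow> fq T A (z *\<^sub>C a) = (cmod z)\<^sup>2 * fq T A a"
proof -
  assume a: "a \<in> wdom W"
  have "of_real (fq T A (z *\<^sub>C a)) = (z * cnj z) * fqf T A a a"
    using a by (simp add: wdom_scaleC fqf_scaleC_left fqf_scaleC_right flip: fqf_self)
  also have "\<dots> = of_real ((cmod z)\<^sup>2 * fq T A a)"
    unfolding fqf_self[OF a] of_real_mult complex_norm_square ..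
  finally show ?thesis by (simp only: of_real_eq_iff)
qed

definition eig :: "real \<Rightarrow> ell2 \<Rightarrow> bool" where
  "eig \<mu> a \<longleftrightarrow> (\<forall>n. of_real (T n) * coord a n + coord (A a) n = of_real \<mu> * coord a n)"

text \<open>The equation writes \<open>T n * coord a n\<close> as the coordinates of the vector
  \<open>\<mu> a - A a\<close>, so \<open>T n * |coord a n|^2\<close> is summable as a product of
  two square-summable sequences.\<close>

lemma eig_wdom: "eig \<mu> a \<Longrightarrow> a \<in> wdom W"
proof (rule wdom_W)
  assume e: "eig \<mu> a"
  have "coord (of_real \<mu> *\<^sub>C a - A a) n = of_real (T n) * coord a n" for n
    using e by (simp add: eig_def algebra_simps)
  then have "T n * (cmod (coord a n))\<^sup>2 = cmod (coord (of_real \<mu> *\<^sub>C a - A a) n * cnj (coord a n))" for n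
    by (simp only: norm_mult) (simp add: T_nonneg power2_eq_square)
  then show "a \<in> wdom T"
    unfolding wdom_def using summable_cmod_mult[OF summable_coord summable_coord, of "of_real \<mu> *\<^sub>C a - A a" a] by simp
qed

lemma sqrt_sqrt: "complex_of_real (sqrt (T n)) * complex_of_real (sqrt (T n)) = complex_of_real (T n)"
  unfolding of_real_mult[symmetric] by (simp add: T_nonneg)

lemma fqf_eig:
  assumes "eig \<mu> a" "b \<in> wdom W"
  shows "fqf T A a b = of_real \<mu> * ip a b"
proof -
  have a: "a \<in> wdom W" by (rule eig_wdom) fact
  have *: "coord (wvec T a) n * cnj (coord (wvec T b) n) + coord (A a) n * cnj (coord b n)
      = of_real \<mu> * (coord a n * cnj (coord b n))" for n
  proof -
    have "coord (wvec T a) n * cnj (coord (wvec T b) n) = (of_real (sqrt (T n)) * of_real (sqrt (T n))) * coord a n * cnj (coord b n)"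
      using a assms by (simp add: coord_wvec)
    then have "coord (wvec T a) n * cnj (coord (wvec T b) n) + coord (A a) n * cnj (coord b n)
        = (of_real (T n) * coord a n + coord (A a) n) * cnj (coord b n)"
      by (simp only: sqrt_sqrt) (simp add: algebra_simps)
    then show ?thesis using assms by (simp add: eig_def)
  qed
  have "fqf T A a b = (\<Sum>n. coord (wvec T a) n * cnj (coord (wvec T b) n) + coord (A a) n * cnj (coord b n))"
    unfolding fqf_def ip_def by (rule suminf_add[OF summable_ip summable_ip])
  also have "\<dots> = of_real \<mu> * ip a b"
    unfolding * ip_def by (rule suminf_mult[OF summable_ip])
  finally show ?thesis .
qed

text \<open>Testing the form against the basis vectors recovers the coordinates of the operator;
  this turns a variational identity back into the equation \<open>eig\<close>.\<close>

lemma fqf_delta: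
  assumes "a \<in> wdom W"
  shows "fqf T A a (delta n) = of_real (T n) * coord a n + coord (A a) n"
proof -
  have "wvec T (delta n) = of_real (sqrt (T n)) *\<^sub>C delta n"
    by (rule ell2_eqI) (simp add: coord_wvec wdom_delta)
  then have "fqf T A a (delta n) = (of_real (sqrt (T n)) * of_real (sqrt (T n))) * coord a n + coord (A a) n"
    using assms by (simp add: fqf_def ip_scaleC_right coord_wvec)
  then show ?thesis by (simp only: sqrt_sqrt)
qed

lemma fq_eig:
  assumes "eig \<mu> a"
  shows "fq T A a = \<mu> * (norm a)\<^sup>2"
proof -
  have a: "a \<in> wdom W" using assms by (rule eig_wdom)
  have "complex_of_real (fq T A a) = of_real \<mu> * of_real ((norm a)\<^sup>2)"
    unfolding fqf_self[OF a, symmetric] fqf_eig[OF assms a] ip_self ..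
  then show ?thesis unfolding of_real_mult[symmetric] of_real_eq_iff .
qed

end

text \<open>Weak convergence of the operators suffices once the vectors converge in norm: moving
  \<open>a p\<close> to \<open>l\<close> in either slot costs at most \<open>K\<close> times the
  norm of \<open>a p - l\<close>, up to bounded factors, and weak convergence is then used at the
  fixed vector \<open>l\<close> alone.\<close>

lemma pot_tendsto:
  fixes a :: "nat \<Rightarrow> ell2"
  assumes forms: "\<And>p. form W (T p) (B p) c K" and weak: "\<And>x y. (\<lambda>p. ip (B p x) y) \<longlonglongrightarrow> ip (A x) y"
    and lim: "a \<longlonglongrightarrow> l"
  shows "(\<lambda>p. ip (B p (a p)) (a p)) \<longlonglongrightarrow> ip (A l) l"
proof -
  have eq: "ip (B p (a p)) (a p) = ip (B p l) l + (ip (B p (a p - l)) l + ip (B p (a p)) (a p - l))" for p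
    by (simp add: form.A_diff[OF forms] ip_simps)
  have d0: "(\<lambda>p. norm (a p - l)) \<longlonglongrightarrow> 0"
    using lim by (simp add: tendsto_norm_zero_iff LIM_zero_iff)
  have "(\<lambda>p. ip (B p (a p - l)) l + ip (B p (a p)) (a p - l)) \<longlonglongrightarrow> 0"
  proof (rule Lim_null_comparison)
    show "\<forall>\<^sub>F p in sequentially. norm (ip (B p (a p - l)) l + ip (B p (a p)) (a p - l))
        \<le> K * norm (a p - l) * norm l + K * norm (a p) * norm (a p - l)"
    proof (rule always_eventually, rule allI)
      fix p
      have "norm (ip (B p (a p - l)) l) \<le> K * norm (a p - l) * norm l"
        by (rule order_trans[OF norm_ip_le mult_right_mono[OF form.A_bound[OF forms]]]) simp
      moreover have "norm (ip (B p (a p)) (a p - l)) \<le> K * norm (a p) * norm (a p - l)"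
        by (rule order_trans[OF norm_ip_le mult_right_mono[OF form.A_bound[OF forms]]]) simp
      ultimately show "norm (ip (B p (a p - l)) l + ip (B p (a p)) (a p - l))
        \<le> K * norm (a p - l) * norm l + K * norm (a p) * norm (a p - l)"
        using norm_triangle_ineq[of "ip (B p (a p - l)) l" "ip (B p (a p)) (a p - l)"] by linarith
    qed
    have "(\<lambda>p. K * norm (a p - l) * norm l + K * norm (a p) * norm (a p - l)) \<longlonglongrightarrow> K * 0 * norm l + K * norm l * 0"
      by (intro tendsto_intros d0 lim)
    then show "(\<lambda>p. K * norm (a p - l) * norm l + K * norm (a p) * norm (a p - l)) \<longlonglongrightarrow> 0" by simp
  qed
  from tendsto_add[OF weak[of l l] this] show ?thesis by (simp add: eq)
qed

text \<open>The potential part converges by \<open>pot_tendsto\<close> and can be moved to the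
  bound; Fatou handles the kinetic part, where energy can only be lost in the limit.\<close>

lemma fq_lsc:
  fixes a :: "nat \<Rightarrow> ell2"
  assumes forms: "\<And>p. form W (T p) (B p) c K" and form': "form W T' A c K"
    and weak: "\<And>x y. (\<lambda>p. ip (B p x) y) \<longlonglongrightarrow> ip (A x) y" and T: "\<And>n. (\<lambda>p. T p n) \<longlonglongrightarrow> T' n"
    and lim: "a \<longlonglongrightarrow> l" and dom: "\<And>p. a p \<in> wdom W"
    and le: "\<And>p. fq (T p) (B p) (a p) \<le> \<mu> p" "\<mu> \<longlonglongrightarrow> \<mu>'"
  shows "l \<in> wdom W" "fq T' A l \<le> \<mu>'"
proof -
  interpret form W T' A c K by fact
  have pot: "(\<lambda>p. inner (B p (a p)) (a p)) \<longlonglongrightarrow> inner (A l) l"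
    using tendsto_Re[OF pot_tendsto[OF forms weak lim]] by (simp add: Re_ip)
  have F: "summable (\<lambda>n. T' n * (cmod (coord l n))\<^sup>2)"
    "(\<Sum>n. T' n * (cmod (coord l n))\<^sup>2) \<le> \<mu>' - inner (A l) l"
  proof -
    have "(\<lambda>p. coord (a p) n) \<longlonglongrightarrow> coord l n" for n by (rule tendsto_coord[OF lim])
    moreover have "kin (T p) (a p) \<le> \<mu> p - inner (B p (a p)) (a p)" for p
      using le(1)[of p] by (simp add: fq_def)
    moreover have "(\<lambda>p. \<mu> p - inner (B p (a p)) (a p)) \<longlonglongrightarrow> \<mu>' - inner (A l) l"
      by (intro tendsto_intros le pot)
    ultimately show "summable (\<lambda>n. T' n * (cmod (coord l n))\<^sup>2)"
      "(\<Sum>n. T' n * (cmod (coord l n))\<^sup>2) \<le> \<mu>' - inner (A l) l"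
      using kin_Fatou[of a "coord l" T T' "\<lambda>p. \<mu> p - inner (B p (a p)) (a p)"] T
        form.T_nonneg[OF forms] form.wdom_T[OF forms dom] by blast+
  qed
  show "l \<in> wdom W" using F(1) by (intro wdom_W) (simp add: wdom_def)
  show "fq T' A l \<le> \<mu>'" using F(2) by (simp add: fq_def kin_def)
qed

text \<open>The dimension count behind the min-max principle: there are \<open>N + 1\<close>
  coefficients for at most \<open>N\<close> linear conditions, and orthonormality transfers the
  normalisation of the vector to its coefficients.\<close>

lemma unit_combination_orthogonal:
  fixes v :: "nat \<Rightarrow> ell2"
  assumes ortho: "\<forall>i\<le>N. \<forall>j\<le>N. ip (v i) (v j) = (if i = j then 1 else 0)"
    and L: "finite L" "card L \<le> N"
  obtains z where "norm (\<Sum>i\<le>N. z i *\<^sub>C v i) = 1" "(\<Sum>i\<le>N. (cmod (z i))\<^sup>2) = 1" "\<forall>x\<in>L. ip (\<Sum>i\<le>N. z i *\<^sub>C v i) x = 0"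
proof -
  obtain y where y: "\<exists>i\<in>{..N}. y i \<noteq> 0" "\<forall>x\<in>L. (\<Sum>i\<in>{..N}. y i * ip (v i) x) = 0"
    using linear_system_nontrivial[of L "{..N}" "\<lambda>i x. ip (v i) x"] L by auto
  have norm: "(norm (\<Sum>i\<le>N. x i *\<^sub>C v i))\<^sup>2 = (\<Sum>i\<le>N. (cmod (x i))\<^sup>2)" for x
  proof -
    have "of_real ((norm (\<Sum>i\<le>N. x i *\<^sub>C v i))\<^sup>2) = (\<Sum>i\<le>N. \<Sum>j\<le>N. x j * (cnj (x i) * ip (v j) (v i)))"
      unfolding ip_self[symmetric] by (simp add: ip_simps sum_distrib_left mult_ac)
    also have "\<dots> = (\<Sum>i\<le>N. \<Sum>j\<le>N. if j = i then x i * cnj (x i) else 0)"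
      by (intro sum.cong refl) (auto simp: ortho)
    also have "\<dots> = of_real (\<Sum>i\<le>N. (cmod (x i))\<^sup>2)"
      by (simp add: complex_norm_square del: of_real_power)
    finally show ?thesis by (simp only: of_real_eq_iff)
  qed
  define s where "s = norm (\<Sum>i\<le>N. y i *\<^sub>C v i)"
  have "0 < (\<Sum>i\<le>N. (cmod (y i))\<^sup>2)"
    using y(1) by (auto intro!: sum_pos2)
  then have "s\<^sup>2 \<noteq> 0" unfolding s_def norm[of y] by simp
  then have s: "0 < s" by (simp add: s_def)
  define z where "z i = y i / of_real s" for i
  have z: "(\<Sum>i\<le>N. z i *\<^sub>C v i) = (1 / of_real s) *\<^sub>C (\<Sum>i\<le>N. y i *\<^sub>C v i)"
    by (rule ell2_eqI) (simp add: z_def sum_distrib_left divide_inverse mult_ac)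
  have n1: "norm (\<Sum>i\<le>N. z i *\<^sub>C v i) = 1"
    using s by (simp add: z norm_divide flip: s_def)
  then have s1: "(\<Sum>i\<le>N. (cmod (z i))\<^sup>2) = 1" using norm[of z] by simp
  show ?thesis
  proof (rule that[OF n1 s1])
    show "\<forall>x\<in>L. ip (\<Sum>i\<le>N. z i *\<^sub>C v i) x = 0"
      using y(2) by (simp add: z ip_simps)
  qed
qed

text \<open>The fifth clause is the variational half of the min-max principle, and the sixth says
  that the levels tend to infinity. Together they do the work of completeness: a nonzero vector of
  the form domain orthogonal to all \<open>u i\<close> would need infinite energy.\<close>

definition spectral ::
  "(nat \<Rightarrow> real) \<Rightarrow> (nat \<Rightarrow> real) \<Rightarrow> (ell2 \<Rightarrow> ell2) \<Rightarrow> (nat \<Rightarrow> ell2) \<Rightarrow> (nat \<Rightarrow> real) \<Rightarrow> bool" where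
  "spectral W T A u E \<longleftrightarrow> mono E \<and> (\<forall>i. u i \<in> wdom W) \<and>
     (\<forall>i j. ip (u i) (u j) = (if i = j then 1 else 0)) \<and>
     (\<forall>i n. of_real (T n) * coord (u i) n + coord (A (u i)) n = of_real (E i) * coord (u i) n) \<and>
     (\<forall>i. \<forall>w\<in>wdom W. (\<forall>j<i. ip w (u j) = 0) \<longrightarrow> E i * (norm w)\<^sup>2 \<le> fq T A w) \<and>
     (\<forall>C. finite {i. E i \<le> C})"

section \<open>Eigenvalues by successive minimisation\<close>

context form
begin

text \<open>The inequality is homogeneous in \<open>w\<close>, so it applies directly to
  unnormalised perturbations of \<open>a\<close>.\<close>

definition minim :: "ell2 set \<Rightarrow> ell2 \<Rightarrow> bool" where
  "minim L a \<longleftrightarrow> a \<in> wdom W \<and> norm a = 1 \<and> (\<forall>v\<in>L. ip a v = 0) \<and>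
     (\<forall>w\<in>wdom W. (\<forall>v\<in>L. ip w v = 0) \<longrightarrow> fq T A a * (norm w)\<^sup>2 \<le> fq T A w)"

text \<open>The direct method: a minimising sequence has bounded energy, a subsequence converges in
  norm, the constraints survive norm limits, and the energy is lower semicontinuous.\<close>

lemma minim_exists:
  assumes "finite L"
  shows "\<exists>a. minim L a"
proof -
  define S where "S = {a \<in> wdom W. norm a = 1 \<and> (\<forall>v\<in>L. ip a v = 0)}"
  \<comment> \<open>With \<open>card L + 1\<close> basis vectors against \<open>card L\<close>
    conditions the constraint set is nonempty, so the infimum is meaningful.\<close>
  obtain z where z: "norm (\<Sum>i\<le>card L. z i *\<^sub>C delta i) = 1"
    "\<And>x. x \<in> L \<Longrightarrow> ip (\<Sum>i\<le>card L. z i *\<^sub>C delta i) x = 0"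
  proof -
    have "\<forall>i\<le>card L. \<forall>j\<le>card L. ip (delta i) (delta j) = (if i = j then 1 else 0)" by auto
    from unit_combination_orthogonal[OF this assms order_refl] show thesis using that by metis
  qed
  have S0: "(\<Sum>i\<le>card L. z i *\<^sub>C delta i) \<in> S"
    using z by (auto simp: S_def intro!: wdom_sum wdom_scaleC wdom_delta)
  define m where "m = Inf (fq T A ` S)"
  have bdd: "bdd_below (fq T A ` S)"
    by (rule bdd_belowI[of _ 0]) (auto simp: S_def fq_nonneg)
  have m_le: "m \<le> fq T A a" if "a \<in> S" for a
    unfolding m_def using that bdd by (intro cInf_lower) auto
  have "\<exists>a\<in>S. fq T A a < m + 1 / real (Suc p)" for p
  proof -
    have "\<exists>x\<in>fq T A ` S. x < m + 1 / real (Suc p)"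
      using S0 by (subst cInf_less_iff[symmetric]) (auto simp: bdd m_def[symmetric])
    then show ?thesis by auto
  qed
  then obtain a where a: "\<And>p. a p \<in> S" "\<And>p. fq T A (a p) < m + 1 / real (Suc p)" by metis
  have adom: "a p \<in> wdom W" for p using a(1) by (simp add: S_def)
  have "kin W (a p) \<le> c * (1 + (m + 1))" for p
  proof -
    have "fq T A (a p) \<le> m + 1"
    proof -
      have "1 / real (Suc p) \<le> 1" by simp
      then show ?thesis using a(2)[of p] by linarith
    qed
    then show ?thesis
      using kin_W_le[OF adom[of p]] a(1)[of p] mult_left_mono[of "1 + fq T A (a p)" "1 + (m + 1)" c] c_pos
      unfolding S_def mem_Collect_eq by (intro order_trans[OF kin_W_le[OF adom] mult_left_mono]) auto
  qed
  from wdom_compact[where a = a, OF adom this]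
  obtain r l where r: "strict_mono r" and l: "(a \<circ> r) \<longlonglongrightarrow> l" by blast
  have "(\<lambda>p. m + 1 / real (Suc (r p))) \<longlonglongrightarrow> m + 0"
    using LIMSEQ_subseq_LIMSEQ[OF LIMSEQ_inverse_real_of_nat r]
    by (intro tendsto_intros) (simp add: comp_def divide_inverse)
  then have lim: "(\<lambda>p. m + 1 / real (Suc (r p))) \<longlonglongrightarrow> m" by simp
  have L: "l \<in> wdom W" "fq T A l \<le> m"
    using fq_lsc[of W "\<lambda>_. T" "\<lambda>_. A" c K T A "a \<circ> r" l "\<lambda>p. m + 1 / real (Suc (r p))" m] form_axioms l lim adom a(2)
    by (auto simp: less_imp_le)
  have "norm l = 1"
  proof -
    have "(\<lambda>p. norm ((a \<circ> r) p)) \<longlonglongrightarrow> norm l" by (intro tendsto_intros l)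
    moreover have "norm ((a \<circ> r) p) = 1" for p using a(1) by (simp add: S_def)
    ultimately show ?thesis by (simp add: LIMSEQ_const_iff)
  qed
  moreover have "ip l v = 0" if "v \<in> L" for v
  proof -
    have "(\<lambda>p. ip ((a \<circ> r) p) v) \<longlonglongrightarrow> ip l v" by (intro tendsto_ip tendsto_const l)
    moreover have "ip ((a \<circ> r) p) v = 0" for p using a(1) that by (simp add: S_def)
    ultimately show ?thesis by (simp add: LIMSEQ_const_iff)
  qed
  moreover have "fq T A l * (norm w)\<^sup>2 \<le> fq T A w" if w: "w \<in> wdom W" "\<forall>v\<in>L. ip w v = 0" for w
  proof (cases "w = 0")
    case True
    then show ?thesis using fq_nonneg[OF w(1)] by simp
  next
    case False
    define w' where "w' = of_real (1 / norm w) *\<^sub>C w"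
    have "norm w' = 1" using False by (simp add: w'_def norm_divide)
    then have "w' \<in> S" using w by (simp add: S_def w'_def wdom_scaleC ip_scaleC_left)
    then have "m \<le> fq T A w'" by (rule m_le)
    also have "\<dots> = fq T A w / (norm w)\<^sup>2"
      unfolding w'_def using w by (subst fq_scaleC) (auto simp: norm_divide power_divide)
    finally have "m * (norm w)\<^sup>2 \<le> fq T A w" using False by (simp add: field_simps)
    then show ?thesis using L(2) mult_right_mono[of "fq T A l" m "(norm w)\<^sup>2"] by simp
  qed
  ultimately have "minim L l" using L by (simp add: minim_def)
  then show ?thesis by blast
qed

text \<open>First variation. If the defect \<open>r\<close> were nonzero, moving \<open>a\<close> by
  a small multiple of \<open>- r\<close> times \<open>w\<close> would lower the energy below its
  minimum: the first-order change is negative, and \<open>R\<close> controls the second-order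
  one.\<close>

lemma minim_variation:
  assumes a: "minim L a" and w: "w \<in> wdom W" "\<forall>v\<in>L. ip w v = 0"
  shows "fqf T A a w = of_real (fq T A a) * ip a w"
proof (rule ccontr)
  define e where "e = fq T A a"
  define r where "r = fqf T A a w - of_real e * ip a w"
  define R where "R = fq T A w - e * (norm w)\<^sup>2"
  assume "\<not> ?thesis"
  then have r: "r \<noteq> 0" by (simp add: r_def e_def)
  have ad: "a \<in> wdom W" "norm a = 1" "\<forall>v\<in>L. ip a v = 0" using a by (auto simp: minim_def)
  have min: "e * (norm x)\<^sup>2 \<le> fq T A x" if "x \<in> wdom W" "\<forall>v\<in>L. ip x v = 0" for x
    using a that by (auto simp: minim_def e_def)
  have R: "0 \<le> R" using min[OF w] by (simp add: R_def)
  have "0 \<le> - 2 * t * (cmod r)\<^sup>2 + t\<^sup>2 * (cmod r)\<^sup>2 * R" if "0 < t" for t :: real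
  proof -
    define z where "z = - (of_real t * r)"
    have zw: "z *\<^sub>C w \<in> wdom W" by (intro wdom_scaleC w)
    have "e * (norm (a + z *\<^sub>C w))\<^sup>2 \<le> fq T A (a + z *\<^sub>C w)"
      using ad w by (intro min wdom_add zw) (auto simp: ip_simps)
    moreover have "(norm (a + z *\<^sub>C w))\<^sup>2 = 1 + 2 * Re (cnj z * ip a w) + (cmod z)\<^sup>2 * (norm w)\<^sup>2"
    proof -
      have "(norm (a + z *\<^sub>C w))\<^sup>2 = (norm a)\<^sup>2 + 2 * inner a (z *\<^sub>C w) + (norm (z *\<^sub>C w))\<^sup>2"
        by (simp only: power2_norm_eq_inner inner_add_left inner_add_right inner_commute[of "z *\<^sub>C w" a])
      moreover have "inner a (z *\<^sub>C w) = Re (cnj z * ip a w)"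
        by (simp only: ip_scaleC_right flip: Re_ip)
      ultimately show ?thesis by (simp only: ad norm_scaleC power_mult_distrib power_one)
    qed
    moreover have "fq T A (a + z *\<^sub>C w) = e + 2 * Re (cnj z * fqf T A a w) + (cmod z)\<^sup>2 * fq T A w"
      unfolding fq_add[OF ad(1) zw] fq_scaleC[OF w(1)] fqf_scaleC_right[OF w(1)] e_def ..
    ultimately have "0 \<le> 2 * (Re (cnj z * fqf T A a w) - e * Re (cnj z * ip a w)) + (cmod z)\<^sup>2 * R"
      by (simp add: R_def algebra_simps)
    also have "Re (cnj z * fqf T A a w) - e * Re (cnj z * ip a w) = Re (cnj z * r)"
    proof -
      have "cnj z * r = cnj z * fqf T A a w - of_real e * (cnj z * ip a w)"
        by (simp add: r_def algebra_simps)
      moreover have "Re (of_real e * y) = e * Re y" for y by simp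
      ultimately show ?thesis by (simp only: minus_complex.sel)
    qed
    also have "Re (cnj z * r) = - t * (cmod r)\<^sup>2"
    proof -
      have "cnj z * r = - of_real t * (r * cnj r)" by (simp add: z_def)
      also have "\<dots> = of_real (- t * (cmod r)\<^sup>2)"
        by (simp only: of_real_mult complex_norm_square of_real_minus)
      finally show ?thesis by (simp only: Re_complex_of_real)
    qed
    also have "(cmod z)\<^sup>2 = t\<^sup>2 * (cmod r)\<^sup>2" by (simp add: z_def norm_mult power_mult_distrib)
    finally show ?thesis by (simp add: algebra_simps)
  qed
  note quad = this
  \<comment> \<open>Any positive \<open>t\<close> with \<open>t * R < 2\<close> lets the first-order
    term win; the 1 in the denominator covers \<open>R = 0\<close>.\<close>
  define t where "t = 1 / (R + 1)"
  have t: "0 < t" "t * R < 2" using R by (auto simp: t_def field_simps)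
  have "0 \<le> (cmod r)\<^sup>2 * t * (t * R - 2)"
    using quad[OF t(1)] by (simp add: power2_eq_square algebra_simps)
  moreover have "0 < (cmod r)\<^sup>2 * t" using t r by simp
  ultimately show False using t(2) by (simp add: zero_le_mult_iff)
qed

text \<open>\<open>minim_variation\<close> tests only against vectors orthogonal to the earlier
  eigenvectors. A basis vector \<open>delta n\<close> splits into such a vector and a combination
  \<open>s\<close> of earlier eigenvectors; paired with \<open>s\<close>, both the form and the
  inner product vanish, the form because the \<open>u j\<close> are eigenvectors orthogonal to
  \<open>a\<close>.\<close>

lemma minim_eig:
  fixes i :: nat
  assumes a: "minim (u ` {..<i}) a" and eig: "\<And>j. j < i \<Longrightarrow> eig (E j) (u j)"
    and ortho: "\<And>j k. j < i \<Longrightarrow> k < i \<Longrightarrow> ip (u j) (u k) = (if j = k then 1 else 0)"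
  shows "eig (fq T A a) a"
  unfolding eig_def
proof
  fix n
  let ?e = "fq T A a"
  have ad: "a \<in> wdom W" "\<And>j. j < i \<Longrightarrow> ip a (u j) = 0" using a by (auto simp: minim_def)
  have ud: "\<And>j. j < i \<Longrightarrow> u j \<in> wdom W" using eig eig_wdom by blast
  define s where "s = (\<Sum>j<i. ip (delta n) (u j) *\<^sub>C u j)"
  define w where "w = delta n - s"
  have sd: "s \<in> wdom W" unfolding s_def by (intro wdom_sum wdom_scaleC ud) auto
  have wd: "w \<in> wdom W" unfolding w_def by (intro wdom_diff wdom_delta sd)
  have "ip s (u k) = ip (delta n) (u k)" if "k < i" for k
  proof -
    have "ip s (u k) = (\<Sum>j<i. if j = k then ip (delta n) (u j) else 0)"
      unfolding s_def ip_simps by (intro sum.cong) (auto simp: ortho that)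
    also have "\<dots> = ip (delta n) (u k)" by (subst sum.delta) (use that in auto)
    finally show ?thesis .
  qed
  then have "\<forall>v\<in>u ` {..<i}. ip w v = 0" by (auto simp: w_def ip_simps)
  from minim_variation[OF a wd this] have w: "fqf T A a w = of_real ?e * ip a w" .
  have "fqf T A a (u j) = 0" if "j < i" for j
    using fqf_eig[OF eig[OF that] ad(1)] ad(2)[OF that] fqf_commute[of a "u j"] ip_commute[of a "u j"] by simp
  then have "fqf T A a s = 0"
    unfolding s_def using ud by (subst fqf_sum_right) (auto simp: wdom_scaleC fqf_scaleC_right)
  moreover have "ip a s = 0" unfolding s_def ip_simps using ad(2) by (intro sum.neutral) simp
  moreover have "delta n = w + s" by (simp add: w_def)
  ultimately have "fqf T A a (delta n) = of_real ?e * ip a (delta n)"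
    using w fqf_add_right[OF wd sd, of a] ip_add_right[of a w s] by simp
  then show "of_real (T n) * coord a n + coord (A a) n = of_real ?e * coord a n"
    using fqf_delta[OF ad(1)] by simp
qed

lemma spectral_exists: "\<exists>u E. spectral W T A u E"
proof -
  \<comment> \<open>Each choice depends on all earlier vectors, so the recursion runs over the list
    of vectors chosen so far.\<close>
  define next_vec where "next_vec l = (SOME a. minim (set l) a)" for l
  define us where "us = rec_nat [] (\<lambda>_ l. l @ [next_vec l])"
  define u where "u i = next_vec (us i)" for i
  have set_us: "set (us i) = u ` {..<i}" for i
    by (induction i) (auto simp: us_def u_def lessThan_Suc)
  have min: "minim (u ` {..<i}) (u i)" for i
    unfolding u_def[of i] next_vec_def set_us[symmetric] by (rule someI_ex[OF minim_exists]) simp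
  define E where "E i = fq T A (u i)" for i
  have ud: "u i \<in> wdom W" "norm (u i) = 1" for i using min[of i] by (auto simp: minim_def)
  have lt: "ip (u i) (u j) = 0" if "j < i" for i j using min[of i] that by (auto simp: minim_def)
  have ortho: "ip (u i) (u j) = (if i = j then 1 else 0)" for i j
    using lt[of i j] lt[of j i] ud(2)[of i] ip_commute[of "u j" "u i"] ip_self[of "u i"]
    by (cases i j rule: linorder_cases) auto
  have eig: "eig (E i) (u i)" for i
  proof (induction i rule: less_induct)
    case (less i)
    then show ?case unfolding E_def[of i] by (intro minim_eig[OF min, of _ E]) (auto simp: ortho)
  qed
  have var: "E i * (norm w)\<^sup>2 \<le> fq T A w" if "w \<in> wdom W" "\<forall>j<i. ip w (u j) = 0" for i w
    using min[of i] that by (auto simp: minim_def E_def)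
  have mono: "mono E"
  proof (rule monoI)
    fix i j :: nat assume "i \<le> j"
    then show "E i \<le> E j" using var[of "u j" i] ud lt by (auto simp: E_def)
  qed
  \<comment> \<open>If infinitely many levels stayed below \<open>C\<close>, monotonicity would put
    all of them there; compactness would then give a convergent subsequence of vectors that are
    pairwise \<open>sqrt 2\<close> apart.\<close>
  have fin: "finite {i. E i \<le> C}" for C
  proof (rule ccontr)
    assume inf: "infinite {i. E i \<le> C}"
    have EC: "E i \<le> C" for i
    proof -
      obtain j where "i \<le> j" "E j \<le> C" using inf unfolding infinite_nat_iff_unbounded_le by auto
      then show ?thesis using monoD[OF mono, of i j] by simp
    qed
    have "kin W (u i) \<le> c * (1 + C)" for i
    proof -
      have "c * (1 + E i) \<le> c * (1 + C)" using EC c_pos by simp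
      then show ?thesis using kin_W_le[OF ud(1)[of i]] ud(2)[of i] by (simp add: E_def)
    qed
    from wdom_compact[where a = u, OF ud(1) this]
    obtain r l where r: "strict_mono r" and l: "(u \<circ> r) \<longlonglongrightarrow> l" by blast
    have "(\<lambda>p. norm (u (r (Suc p)) - u (r p))) \<longlonglongrightarrow> norm (l - l)"
      using l LIMSEQ_Suc[OF l] by (intro tendsto_intros) (auto simp: comp_def)
    moreover have "norm (u (r (Suc p)) - u (r p)) = sqrt 2" for p
    proof -
      have "r (Suc p) \<noteq> r p" using r by (simp add: strict_mono_eq)
      then have "inner (u (r (Suc p))) (u (r p)) = 0"
        using ortho[of "r (Suc p)" "r p"] by (simp flip: Re_ip)
      then have "(norm (u (r (Suc p)) - u (r p)))\<^sup>2 = (norm (u (r (Suc p))))\<^sup>2 + (norm (u (r p)))\<^sup>2"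
        by (simp add: power2_norm_eq_inner inner_diff inner_commute)
      then show ?thesis using ud(2) by (simp add: real_sqrt_unique)
    qed
    ultimately show False by (simp add: LIMSEQ_const_iff)
  qed
  have "spectral W T A u E"
    unfolding spectral_def using mono ud ortho eig var fin by (auto simp: eig_def)
  then show ?thesis by blast
qed

text \<open>No eigenvector escapes the minimisation. The remainder \<open>w\<close> solves the same
  eigenvalue equation and is orthogonal to the \<open>u k\<close> with \<open>E k = \<mu>\<close> by
  projection, to the others by symmetry of the form. If it were nonzero, the variational clause
  would bound all levels by \<open>\<mu>\<close>, yet only finitely many lie there.\<close>

lemma spectral_eig_span:
  assumes s: "spectral W T A u E" and a: "eig \<mu> a"
  shows "a = (\<Sum>i\<in>{i. E i = \<mu>}. ip a (u i) *\<^sub>C u i)"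
proof -
  have fin: "finite {i. E i = \<mu>}"
    by (rule finite_subset[of _ "{i. E i \<le> \<mu>}"]) (use s in \<open>auto simp: spectral_def\<close>)
  have ortho: "\<And>i j. ip (u i) (u j) = (if i = j then 1 else 0)" and ud: "\<And>i. u i \<in> wdom W"
    and eigu: "\<And>i. eig (E i) (u i)" using s by (auto simp: spectral_def eig_def)
  define s where "s = (\<Sum>i\<in>{i. E i = \<mu>}. ip a (u i) *\<^sub>C u i)"
  define w where "w = a - s"
  have ad: "a \<in> wdom W" using a by (rule eig_wdom)
  have sd: "s \<in> wdom W" unfolding s_def by (intro wdom_sum wdom_scaleC ud)
  have wd: "w \<in> wdom W" unfolding w_def by (intro wdom_diff ad sd)
  have "eig \<mu> s"
    unfolding eig_def
  proof
    fix n
    have "coord (A s) n = (\<Sum>i\<in>{i. E i = \<mu>}. ip a (u i) * coord (A (u i)) n)"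
      by (simp add: s_def A_sum A_scaleC)
    then have "of_real (T n) * coord s n + coord (A s) n
        = (\<Sum>i\<in>{i. E i = \<mu>}. ip a (u i) * (of_real (T n) * coord (u i) n + coord (A (u i)) n))"
      by (simp add: s_def sum_distrib_left sum.distrib algebra_simps)
    also have "\<dots> = (\<Sum>i\<in>{i. E i = \<mu>}. ip a (u i) * (of_real \<mu> * coord (u i) n))"
      using eigu by (intro sum.cong) (auto simp: eig_def)
    also have "\<dots> = of_real \<mu> * coord s n"
      by (simp add: s_def sum_distrib_left algebra_simps)
    finally show "of_real (T n) * coord s n + coord (A s) n = of_real \<mu> * coord s n" .
  qed
  then have we: "eig \<mu> w"
    using a by (simp add: eig_def w_def A_diff algebra_simps)
  have su: "ip s (u k) = (if E k = \<mu> then ip a (u k) else 0)" for k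
  proof -
    have "ip s (u k) = (\<Sum>i\<in>{i. E i = \<mu>}. if i = k then ip a (u i) else 0)"
      unfolding s_def ip_simps by (intro sum.cong) (auto simp: ortho)
    then show ?thesis using fin by simp
  qed
  have wu: "ip w (u k) = 0" for k
  proof (cases "E k = \<mu>")
    case True
    then show ?thesis using su[of k] by (simp add: w_def ip_simps)
  next
    case False
    have "of_real \<mu> * ip w (u k) = fqf T A w (u k)" by (simp add: fqf_eig[OF we ud])
    also have "\<dots> = cnj (fqf T A (u k) w)" by (rule fqf_commute)
    also have "\<dots> = of_real (E k) * ip w (u k)" using ip_commute[of w "u k"] by (simp add: fqf_eig[OF eigu wd])
    finally show ?thesis using False by simp
  qed
  have "w = 0"
  proof (rule ccontr)
    assume "w \<noteq> 0"
    have "E i \<le> \<mu>" for i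
    proof -
      have "E i * (norm w)\<^sup>2 \<le> fq T A w" using assms(1) wd wu by (auto simp: spectral_def)
      also have "\<dots> = \<mu> * (norm w)\<^sup>2" by (rule fq_eig[OF we])
      finally show ?thesis using \<open>w \<noteq> 0\<close> by simp
    qed
    then have "{i. E i \<le> \<mu>} = UNIV" by auto
    moreover have "finite {i. E i \<le> \<mu>}" using assms(1) by (auto simp: spectral_def)
    ultimately show False by (metis infinite_UNIV_nat)
  qed
  then show ?thesis by (simp add: w_def s_def)
qed

text \<open>On a combination of eigenvectors the energy is the mean of the levels \<open>E i\<close>
  with weights \<open>|z i|^2\<close>.\<close>

lemma fq_span_le:
  assumes s: "spectral W T A u E" and z: "(\<Sum>i\<le>N. (cmod (z i))\<^sup>2) = 1"
  shows "fq T A (\<Sum>i\<le>N. z i *\<^sub>C u i) \<le> E N"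
proof -
  have ortho: "\<And>i j. ip (u i) (u j) = (if i = j then 1 else 0)" and ud: "\<And>i. u i \<in> wdom W"
    and eigu: "\<And>i. eig (E i) (u i)" and mono: "mono E" using s by (auto simp: spectral_def eig_def)
  define w where "w = (\<Sum>i\<le>N. z i *\<^sub>C u i)"
  have wd: "w \<in> wdom W" unfolding w_def by (intro wdom_sum wdom_scaleC ud)
  have uw: "ip (u i) w = cnj (z i)" if "i \<le> N" for i
  proof -
    have "ip (u i) w = (\<Sum>j\<le>N. if j = i then cnj (z j) else 0)"
      unfolding w_def ip_simps by (intro sum.cong) (auto simp: ortho)
    also have "\<dots> = cnj (z i)" by (subst sum.delta) (use that in auto)
    finally show ?thesis .
  qed
  have "of_real (fq T A w) = (\<Sum>i\<le>N. z i * fqf T A (u i) w)"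
    unfolding fqf_self[OF wd, symmetric] by (subst (1) w_def, subst fqf_sum_left) (auto simp: wdom_scaleC ud fqf_scaleC_left)
  also have "\<dots> = (\<Sum>i\<le>N. of_real (E i) * (z i * cnj (z i)))"
    by (intro sum.cong refl) (simp add: fqf_eig[OF eigu wd] uw)
  also have "\<dots> = of_real (\<Sum>i\<le>N. E i * (cmod (z i))\<^sup>2)"
    unfolding complex_norm_square[symmetric] by simp
  finally have "fq T A w = (\<Sum>i\<le>N. E i * (cmod (z i))\<^sup>2)" by (simp only: of_real_eq_iff)
  also have "\<dots> \<le> (\<Sum>i\<le>N. E N * (cmod (z i))\<^sup>2)"
    using monoD[OF mono] by (intro sum_mono mult_right_mono) auto
  also have "\<dots> = E N" using z by (simp flip: sum_distrib_left)
  finally show ?thesis by (simp add: w_def)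
qed

lemma spectral_kin_W_le:
  assumes "spectral W T A u E"
  shows "kin W (u i) \<le> c * (1 + E i)"
proof -
  have "u i \<in> wdom W" "eig (E i) (u i)" "ip (u i) (u i) = 1" using assms by (auto simp: spectral_def eig_def)
  moreover from this(3) have "norm (u i) = 1"
    unfolding ip_self using norm_ge_zero[of "u i"] by (simp add: power2_eq_1_iff flip: of_real_power)
  ultimately show ?thesis using kin_W_le[of "u i"] fq_eig[of "E i" "u i"] by simp
qed

end

section \<open>Convergence of eigenvalues along converging forms\<close>

context weight
begin

lemma wdom_compact_finite:
  fixes v :: "nat \<Rightarrow> nat \<Rightarrow> ell2"
  assumes "\<And>j p. j \<le> N \<Longrightarrow> v j p \<in> wdom W" "\<And>j p. j \<le> N \<Longrightarrow> kin W (v j p) \<le> C"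
  shows "\<exists>r l. strict_mono r \<and> (\<forall>j\<le>N. (\<lambda>p. v j (r p)) \<longlonglongrightarrow> l j)"
  using assms
proof (induction N)
  case 0
  then obtain r l where "strict_mono r" "(v 0 \<circ> r) \<longlonglongrightarrow> l" using wdom_compact[of "v 0" C] by auto
  then show ?case by (auto simp: comp_def intro!: exI[of _ r] exI[of _ "\<lambda>_. l"])
next
  case (Suc N)
  then obtain r l where r: "strict_mono r" "\<And>j. j \<le> N \<Longrightarrow> (\<lambda>p. v j (r p)) \<longlonglongrightarrow> l j" by (meson le_SucI)
  obtain r' l' where r': "strict_mono r'" "((\<lambda>p. v (Suc N) (r p)) \<circ> r') \<longlonglongrightarrow> l'"
    using wdom_compact[of "\<lambda>p. v (Suc N) (r p)" C] Suc.prems by auto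
  have "(\<lambda>p. v j ((r \<circ> r') p)) \<longlonglongrightarrow> (l(Suc N := l')) j" if "j \<le> Suc N" for j
  proof (cases "j = Suc N")
    case True
    then show ?thesis using r' by (simp add: comp_def)
  next
    case False
    then show ?thesis using LIMSEQ_subseq_LIMSEQ[OF r(2) r'(1), of j] that by (simp add: comp_def)
  qed
  then show ?case using strict_mono_o[OF r(1) r'(1)] by blast
qed

end

text \<open>Each inequality feeds a combination of the \<open>i + 1\<close> lowest eigenvectors of
  one problem into the variational clause of the other, which asks for orthogonality to
  \<open>i\<close> vectors. \<open>T_unif\<close> is one-sided and relative to \<open>W\<close>: it
  serves the upper bound, where a vector of controlled energy is inserted into the moving form,
  while the lower bound rests on pointwise convergence and Fatou.\<close>

theorem spectral_tendsto:
  assumes forms: "\<And>p. form W (T p) (B p) c K" and form': "form W T' A c K"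
    and weak: "\<And>x y. (\<lambda>p. ip (B p x) y) \<longlonglongrightarrow> ip (A x) y" and T: "\<And>n. (\<lambda>p. T p n) \<longlonglongrightarrow> T' n"
    and T_unif: "\<And>p n. T p n \<le> T' n + \<epsilon> p * W n" and eps: "\<epsilon> \<longlonglongrightarrow> 0"
    and sp: "\<And>p. spectral W (T p) (B p) (u p) (E p)" and sp': "spectral W T' A u' E'"
  shows "(\<lambda>p. E p i) \<longlonglongrightarrow> E' i"
proof (rule order_tendstoI)
  interpret form W T' A c K by fact
  have ortho: "ip (u p i) (u p j) = (if i = j then 1 else 0)" for p i j
    using sp[of p] by (simp add: spectral_def)
  have ortho': "ip (u' i) (u' j) = (if i = j then 1 else 0)" for i j
    using sp' by (simp add: spectral_def)
  have ud: "u p i \<in> wdom W" for p i using sp[of p] by (simp add: spectral_def)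
  have ud': "u' i \<in> wdom W" for i using sp' by (simp add: spectral_def)
  fix \<gamma> :: real
  {
    assume less: "E' i < \<gamma>"
    show "\<forall>\<^sub>F p in sequentially. E p i < \<gamma>"
    proof (rule ccontr)
      assume "\<not> ?thesis"
      from not_eventually_sequentiallyD[OF this]
      obtain f :: "nat \<Rightarrow> nat" where f': "strict_mono f" "\<forall>p. \<not> E (f p) i < \<gamma>" by (elim exE conjE)
      then have f: "strict_mono f" "\<And>p. \<gamma> \<le> E (f p) i" by (auto simp only: not_less)
      \<comment> \<open>The trial vector lies in the span of the first \<open>i + 1\<close> limit
        eigenvectors, so its limit energy is at most \<open>E' i\<close>, but it is orthogonal to
        the first \<open>i\<close> eigenvectors of the moving problem. It therefore varies with
        \<open>p\<close>, and compactness is called on here too.\<close>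
      have "\<forall>p. \<exists>w. w \<in> wdom W \<and> norm w = 1 \<and> (\<forall>j<i. ip w (u (f p) j) = 0) \<and> fq T' A w \<le> E' i"
      proof
        fix p
        have o: "\<forall>j\<le>i. \<forall>k\<le>i. ip (u' j) (u' k) = (if j = k then 1 else 0)"
          by (intro allI impI ortho')
        have fin: "finite (u (f p) ` {..<i})" "card (u (f p) ` {..<i}) \<le> i"
          using card_image_le[of "{..<i}" "u (f p)"] by simp_all
        obtain z where z: "norm (\<Sum>j\<le>i. z j *\<^sub>C u' j) = 1" "(\<Sum>j\<le>i. (cmod (z j))\<^sup>2) = 1"
          "\<forall>x\<in>u (f p) ` {..<i}. ip (\<Sum>j\<le>i. z j *\<^sub>C u' j) x = 0"
          by (rule unit_combination_orthogonal[OF o fin])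
        have "(\<Sum>j\<le>i. z j *\<^sub>C u' j) \<in> wdom W" by (intro wdom_sum wdom_scaleC ud')
        moreover have "\<forall>j<i. ip (\<Sum>j\<le>i. z j *\<^sub>C u' j) (u (f p) j) = 0"
          using z(3) by (simp only: ball_simps) (simp only: Ball_def lessThan_iff)
        ultimately show "\<exists>w. w \<in> wdom W \<and> norm w = 1 \<and> (\<forall>j<i. ip w (u (f p) j) = 0) \<and> fq T' A w \<le> E' i"
          using z(1) fq_span_le[OF sp' z(2)] by (intro exI conjI)
      qed
      from choice[OF this] obtain w where "\<forall>p. w p \<in> wdom W \<and> norm (w p) = 1 \<and>
        (\<forall>j<i. ip (w p) (u (f p) j) = 0) \<and> fq T' A (w p) \<le> E' i" by (elim exE)
      then have w: "\<And>p. w p \<in> wdom W" "\<And>p. norm (w p) = 1"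
        "\<And>p j. j < i \<Longrightarrow> ip (w p) (u (f p) j) = 0" "\<And>p. fq T' A (w p) \<le> E' i" by simp_all
      have kW: "kin W (w p) \<le> c * (1 + E' i)" for p
      proof -
        have "c * (1 + fq T' A (w p)) \<le> c * (1 + E' i)" using w(4)[of p] c_pos by simp
        then show ?thesis using kin_W_le[OF w(1)[of p]] w(2)[of p] by simp
      qed
      from wdom_compact[where a = w, OF w(1) kW]
      obtain r l where r: "strict_mono r" and l: "(\<lambda>p. w (r p)) \<longlonglongrightarrow> l" by (auto simp: comp_def)
      define g where "g = f \<circ> r"
      have g: "strict_mono g" unfolding g_def by (rule strict_mono_o) fact+
      \<comment> \<open>The operators converge only weakly, so \<open>P\<close> tends to zero
        because of the norm convergence of \<open>w (r p)\<close>, not uniformly over unit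
        vectors.\<close>
      define P where "P p = inner (B (g p) (w (r p))) (w (r p)) - inner (A (w (r p))) (w (r p))" for p
      have weak_g: "(\<lambda>p. ip (B (g p) x) y) \<longlonglongrightarrow> ip (A x) y" for x y
        using LIMSEQ_subseq_LIMSEQ[OF weak g] by (simp add: comp_def)
      have "P \<longlonglongrightarrow> inner (A l) l - inner (A l) l"
        unfolding P_def Re_ip[symmetric]
        using pot_tendsto[where T = "\<lambda>p. T (g p)" and B = "\<lambda>p. B (g p)" and W = W, OF forms weak_g l]
          pot_tendsto[where T = "\<lambda>p. T'" and B = "\<lambda>p. A" and W = W, OF form' tendsto_const l]
        by (intro tendsto_diff tendsto_Re)
      then have P0: "P \<longlonglongrightarrow> 0" by simp
      have eps_g: "(\<lambda>p. \<epsilon> (g p)) \<longlonglongrightarrow> 0" using LIMSEQ_subseq_LIMSEQ[OF eps g] by (simp add: comp_def)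
      \<comment> \<open>The moving energy of the trial vector is at least \<open>\<gamma>\<close>,
        and it exceeds the limit energy by no more than the kinetic error and
        \<open>P\<close>.\<close>
      have le: "\<gamma> \<le> E' i + \<bar>\<epsilon> (g p)\<bar> * (c * (1 + E' i)) + P p" for p
      proof -
        let ?w = "w (r p)"
        interpret p: form W "T (g p)" "B (g p)" c K by (rule forms)
        have "E (g p) i * (norm ?w)\<^sup>2 \<le> fq (T (g p)) (B (g p)) ?w"
          using sp[of "g p"] w(1,3) unfolding spectral_def g_def by simp
        then have "\<gamma> \<le> fq (T (g p)) (B (g p)) ?w"
          using f(2)[of "r p"] w(2) by (simp add: g_def)
        moreover have "kin (T (g p)) ?w \<le> kin T' ?w + \<bar>\<epsilon> (g p)\<bar> * kin W ?w"
        proof -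
          have s: "summable (\<lambda>n. T' n * (cmod (coord ?w n))\<^sup>2)" "summable (\<lambda>n. W n * (cmod (coord ?w n))\<^sup>2)"
            "summable (\<lambda>n. T (g p) n * (cmod (coord ?w n))\<^sup>2)"
            using wdom_T[OF w(1)] p.wdom_T[OF w(1)] w(1) by (auto simp: wdom_def)
          have 1: "(\<lambda>n. T' n * (cmod (coord ?w n))\<^sup>2 + \<bar>\<epsilon> (g p)\<bar> * (W n * (cmod (coord ?w n))\<^sup>2)) sums
            (kin T' ?w + \<bar>\<epsilon> (g p)\<bar> * kin W ?w)"
            unfolding kin_def by (intro sums_add sums_mult summable_sums s)
          have 2: "(\<lambda>n. T (g p) n * (cmod (coord ?w n))\<^sup>2) sums kin (T (g p)) ?w"
            unfolding kin_def by (intro summable_sums s)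
          have 3: "T (g p) n * (cmod (coord ?w n))\<^sup>2
              \<le> T' n * (cmod (coord ?w n))\<^sup>2 + \<bar>\<epsilon> (g p)\<bar> * (W n * (cmod (coord ?w n))\<^sup>2)" for n
          proof -
            have "\<epsilon> (g p) * W n \<le> \<bar>\<epsilon> (g p)\<bar> * W n" using W_nonneg by (intro mult_right_mono) auto
            then have "T (g p) n \<le> T' n + \<bar>\<epsilon> (g p)\<bar> * W n" using T_unif[of "g p" n] by linarith
            then show ?thesis
              using mult_right_mono[of "T (g p) n" "T' n + \<bar>\<epsilon> (g p)\<bar> * W n" "(cmod (coord ?w n))\<^sup>2"]
              by (simp add: algebra_simps)
          qed
          show ?thesis by (rule sums_le[OF 3 2 1])
        qed
        moreover have "\<bar>\<epsilon> (g p)\<bar> * kin W ?w \<le> \<bar>\<epsilon> (g p)\<bar> * (c * (1 + E' i))"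
          by (intro mult_left_mono kW) auto
        ultimately show ?thesis using w(4)[of "r p"] by (simp add: fq_def P_def)
      qed
      have "(\<lambda>p. E' i + \<bar>\<epsilon> (g p)\<bar> * (c * (1 + E' i)) + P p) \<longlonglongrightarrow> E' i + \<bar>0\<bar> * (c * (1 + E' i)) + 0"
        by (intro tendsto_intros eps_g P0)
      then have "\<gamma> \<le> E' i + \<bar>0\<bar> * (c * (1 + E' i)) + 0"
        by (rule LIMSEQ_le_const) (use le in auto)
      then show False using less by simp
    qed
  next
    assume less: "\<gamma> < E' i"
    show "\<forall>\<^sub>F p in sequentially. \<gamma> < E p i"
    proof (rule ccontr)
      assume "\<not> ?thesis"
      from not_eventually_sequentiallyD[OF this]
      obtain f :: "nat \<Rightarrow> nat" where f': "strict_mono f" "\<forall>p. \<not> \<gamma> < E (f p) i" by (elim exE conjE)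
      then have f: "strict_mono f" "\<And>p. E (f p) i \<le> \<gamma>" by (auto simp only: not_less)
      \<comment> \<open>A bound on the \<open>i\<close>-th level bounds all lower ones, so the first
        \<open>i + 1\<close> eigenvectors converge along a common subsequence.\<close>
      have "kin W (u (f p) j) \<le> c * (1 + \<gamma>)" if "j \<le> i" for j p
      proof -
        have "E (f p) j \<le> E (f p) i" using sp[of "f p"] that by (auto simp: spectral_def mono_def)
        then have "c * (1 + E (f p) j) \<le> c * (1 + \<gamma>)" using f(2)[of p] c_pos by simp
        then show ?thesis using form.spectral_kin_W_le[OF forms sp, of "f p" j] by linarith
      qed
      then obtain r l where r: "strict_mono r" and l: "\<And>j. j \<le> i \<Longrightarrow> (\<lambda>p. u (f (r p)) j) \<longlonglongrightarrow> l j"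
        using wdom_compact_finite[of i "\<lambda>j p. u (f p) j" "c * (1 + \<gamma>)"] ud by auto
      define g where "g = f \<circ> r"
      have g: "strict_mono g" unfolding g_def by (rule strict_mono_o) fact+
      have lg: "(\<lambda>p. u (g p) j) \<longlonglongrightarrow> l j" if "j \<le> i" for j using l[OF that] by (simp add: g_def)
      \<comment> \<open>Norm convergence keeps the limits orthonormal, so the dimension count still
        has \<open>i + 1\<close> independent vectors.\<close>
      have lo: "\<forall>j\<le>i. \<forall>k\<le>i. ip (l j) (l k) = (if j = k then 1 else 0)"
      proof (intro allI impI)
        fix j k assume that: "j \<le> i" "k \<le> i"
        have "(\<lambda>p. ip (u (g p) j) (u (g p) k)) \<longlonglongrightarrow> ip (l j) (l k)" by (intro tendsto_ip lg that)
        then show "ip (l j) (l k) = (if j = k then 1 else 0)" by (simp add: ortho LIMSEQ_const_iff)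
      qed
      have fin: "finite (u' ` {..<i})" "card (u' ` {..<i}) \<le> i"
        using card_image_le[of "{..<i}" "u'"] by simp_all
      obtain z where z: "norm (\<Sum>j\<le>i. z j *\<^sub>C l j) = 1" "(\<Sum>j\<le>i. (cmod (z j))\<^sup>2) = 1"
        "\<forall>x\<in>u' ` {..<i}. ip (\<Sum>j\<le>i. z j *\<^sub>C l j) x = 0"
        by (rule unit_combination_orthogonal[OF lo fin])
      define x where "x p = (\<Sum>j\<le>i. z j *\<^sub>C u (g p) j)" for p
      define y where "y = (\<Sum>j\<le>i. z j *\<^sub>C l j)"
      have xy: "x \<longlonglongrightarrow> y" unfolding x_def y_def by (intro tendsto_sum tendsto_scaleC tendsto_const lg) auto
      have xd: "x p \<in> wdom W" for p unfolding x_def by (intro wdom_sum wdom_scaleC ud)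
      have xE: "fq (T (g p)) (B (g p)) (x p) \<le> \<gamma>" for p
        using form.fq_span_le[OF forms sp z(2), of "g p"] f(2)[of "r p"] by (simp add: x_def g_def)
      have weak_g: "(\<lambda>p. ip (B (g p) x) y) \<longlonglongrightarrow> ip (A x) y" for x y
        using LIMSEQ_subseq_LIMSEQ[OF weak g] by (simp add: comp_def)
      have T_g: "(\<lambda>p. T (g p) n) \<longlonglongrightarrow> T' n" for n
        using LIMSEQ_subseq_LIMSEQ[OF T g] by (simp add: comp_def)
      have y: "y \<in> wdom W" "fq T' A y \<le> \<gamma>"
        using fq_lsc[where T = "\<lambda>p. T (g p)" and B = "\<lambda>p. B (g p)" and W = W and \<mu> = "\<lambda>_. \<gamma>",
            OF forms form' weak_g T_g xy xd xE tendsto_const] by auto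
      have "E' i * (norm y)\<^sup>2 \<le> fq T' A y"
        using sp' y(1) z(3) unfolding spectral_def y_def by auto
      then show False using y(2) z(1) less by (simp add: y_def)
    qed
  }
qed

text \<open>The operators share the bound \<open>K\<close>, so replacing \<open>x\<close> and
  \<open>y\<close> by truncations costs at most \<open>err N\<close> for all of them at once; on
  truncations only finitely many matrix entries enter.\<close>

lemma weak_from_entries:
  assumes forms: "\<And>p. form W (T p) (B p) c K" and form': "form W T' A c K"
    and entries: "\<And>n m. (\<lambda>p. ip (B p (delta n)) (delta m)) \<longlonglongrightarrow> ip (A (delta n)) (delta m)"
  shows "(\<lambda>p. ip (B p x) y) \<longlonglongrightarrow> ip (A x) y"
proof (rule LIMSEQ_I)
  define tr where "tr v N = (\<Sum>n<N. coord v n *\<^sub>C delta n)" for v N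
  define err where "err N = K * norm (x - tr x N) * norm y + K * norm (tr x N) * norm (y - tr y N)" for N
  have tr: "tr v \<longlonglongrightarrow> v" for v unfolding tr_def by (rule truncation_tendsto)
  have err_le: "norm (ip (D x) y - ip (D (tr x N)) (tr y N)) \<le> err N" if "form W S D c K" for D S N
  proof -
    interpret form W S D c K by fact
    have "ip (D x) y - ip (D (tr x N)) (tr y N) = ip (D (x - tr x N)) y + ip (D (tr x N)) (y - tr y N)"
      by (simp add: A_diff ip_simps)
    moreover have "norm (ip (D (x - tr x N)) y) \<le> K * norm (x - tr x N) * norm y"
      by (rule order_trans[OF norm_ip_le mult_right_mono[OF A_bound]]) simp
    moreover have "norm (ip (D (tr x N)) (y - tr y N)) \<le> K * norm (tr x N) * norm (y - tr y N)"
      by (rule order_trans[OF norm_ip_le mult_right_mono[OF A_bound]]) simp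
    ultimately show ?thesis
      unfolding err_def using norm_triangle_ineq[of "ip (D (x - tr x N)) y" "ip (D (tr x N)) (y - tr y N)"] by simp
  qed
  have "err \<longlonglongrightarrow> K * norm (x - x) * norm y + K * norm x * norm (y - y)"
    unfolding err_def by (intro tendsto_intros tr)
  then have err0: "err \<longlonglongrightarrow> 0" by simp
  fix e :: real assume e: "0 < e"
  have "eventually (\<lambda>N. err N < e / 3) sequentially"
    using e by (intro order_tendstoD(2)[OF err0]) simp
  then obtain N where N: "err N < e / 3" by (auto simp: eventually_sequentially)
  have expand: "ip (D (tr x N)) (tr y N) = (\<Sum>n<N. \<Sum>m<N. coord x n * cnj (coord y m) * ip (D (delta n)) (delta m))"
    if "form W S D c K" for D S
  proof -
    interpret form W S D c K by fact
    show ?thesis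
      unfolding tr_def A_sum A_scaleC ip_simps
      by (subst sum.swap) (simp add: sum_distrib_left mult_ac)
  qed
  have "(\<lambda>p. ip (B p (tr x N)) (tr y N)) \<longlonglongrightarrow> ip (A (tr x N)) (tr y N)"
    unfolding expand[OF forms] expand[OF form'] by (intro tendsto_intros entries)
  then obtain P where P: "\<And>p. p \<ge> P \<Longrightarrow> norm (ip (B p (tr x N)) (tr y N) - ip (A (tr x N)) (tr y N)) < e / 3"
    using LIMSEQ_D[of _ _ "e / 3"] e by (meson divide_pos_pos zero_less_numeral)
  have "norm (ip (B p x) y - ip (A x) y) < e" if "p \<ge> P" for p
  proof -
    have "norm (ip (B p x) y - ip (A x) y)
        \<le> norm (ip (B p x) y - ip (B p (tr x N)) (tr y N)) + norm (ip (B p (tr x N)) (tr y N) - ip (A (tr x N)) (tr y N))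
          + norm (ip (A x) y - ip (A (tr x N)) (tr y N))"
      by norm
    then show ?thesis using err_le[OF forms, of p N] err_le[OF form', of N] N P[OF that] by linarith
  qed
  then show "\<exists>P. \<forall>p\<ge>P. norm (ip (B p x) y - ip (A x) y) < e" by blast
qed

section \<open>Lattices and their Voronoi cells\<close>

lemma AE_lebesgue_translate:
  fixes y :: "'a :: euclidean_space"
  assumes "AE x in lebesgue. P x"
  shows "AE x in lebesgue. P (x + y)"
proof -
  obtain N where N: "N \<in> null_sets lebesgue" "{x. \<not> P x} \<subseteq> N"
    using assms by (auto simp: eventually_ae_filter)
  have "negligible ((+) (- y) ` N)"
    using N(1) by (intro negligible_translation) (simp add: negligible_iff_null_sets)
  moreover have "{x. \<not> P (x + y)} \<subseteq> (+) (- y) ` N"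
  proof
    fix x assume "x \<in> {x. \<not> P (x + y)}"
    then have "x + y \<in> N" using N(2) by auto
    then show "x \<in> (+) (- y) ` N" by (rule image_eqI[rotated]) simp
  qed
  ultimately show ?thesis
    by (auto simp: eventually_ae_filter negligible_iff_null_sets)
qed

text \<open>\<open>b\<close> is the dual basis of \<open>a\<close>, so the
  \<open>b i \<bullet> x\<close> are the lattice coordinates of \<open>x\<close>. Both are indexed
  by the same type, which makes the dual lattice another instance with the roles swapped.\<close>

locale lattice_basis =
  fixes a b :: "'d::finite \<Rightarrow> real ^ 'd" and \<Gamma> :: "(real ^ 'd) set"
  assumes dual: "b i \<bullet> a j = (if i = j then 1 else 0)"
    and expand: "x = (\<Sum>i\<in>UNIV. (b i \<bullet> x) *\<^sub>R a i)"
    and lattice_eq: "\<Gamma> = {(\<Sum>i\<in>UNIV. of_int (c i) *\<^sub>R a i) | c :: 'd \<Rightarrow> int. True}"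
begin

lemma coordinates: "b i \<bullet> (\<Sum>j\<in>UNIV. f j *\<^sub>R a j) = f i"
  by (simp add: inner_sum_right dual if_distrib[of "(*) _"] cong: if_cong)

lemma mem_iff: "x \<in> \<Gamma> \<longleftrightarrow> (\<forall>i. b i \<bullet> x \<in> \<int>)"
proof
  assume "x \<in> \<Gamma>"
  then show "\<forall>i. b i \<bullet> x \<in> \<int>" by (auto simp: lattice_eq coordinates)
next
  assume "\<forall>i. b i \<bullet> x \<in> \<int>"
  then have "\<forall>i. \<exists>n :: int. b i \<bullet> x = of_int n" by (auto elim: Ints_cases)
  then obtain c :: "'d \<Rightarrow> int" where c: "\<And>i. b i \<bullet> x = of_int (c i)" by metis
  have "x = (\<Sum>i\<in>UNIV. of_int (c i) *\<^sub>R a i)" using expand[of x] by (simp add: c)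
  then show "x \<in> \<Gamma>" by (auto simp: lattice_eq)
qed

lemma zero_mem: "0 \<in> \<Gamma>" and add_mem: "x \<in> \<Gamma> \<Longrightarrow> y \<in> \<Gamma> \<Longrightarrow> x + y \<in> \<Gamma>"
  and uminus_mem: "x \<in> \<Gamma> \<Longrightarrow> - x \<in> \<Gamma>" and diff_mem: "x \<in> \<Gamma> \<Longrightarrow> y \<in> \<Gamma> \<Longrightarrow> x - y \<in> \<Gamma>"
  by (auto simp: mem_iff inner_add_right inner_diff_right)

lemma dual_expand: "x = (\<Sum>i\<in>UNIV. (a i \<bullet> x) *\<^sub>R b i)"
proof (rule vector_eq_rdot[THEN iffD1], rule allI)
  fix y
  have "y \<bullet> x = (\<Sum>i\<in>UNIV. (b i \<bullet> y) *\<^sub>R a i) \<bullet> x" by (subst (1) expand) simp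
  then show "x \<bullet> y = (\<Sum>i\<in>UNIV. (a i \<bullet> x) *\<^sub>R b i) \<bullet> y"
    by (simp add: inner_sum_left inner_sum_right inner_commute mult.commute)
qed

lemma countable_lattice: "countable \<Gamma>"
proof -
  have "\<Gamma> = range (\<lambda>c :: int ^ 'd. \<Sum>i\<in>UNIV. of_int (c $ i) *\<^sub>R a i)"
  proof
    show "\<Gamma> \<subseteq> range (\<lambda>c :: int ^ 'd. \<Sum>i\<in>UNIV. of_int (c $ i) *\<^sub>R a i)"
    proof
      fix x assume "x \<in> \<Gamma>"
      then obtain c :: "'d \<Rightarrow> int" where "x = (\<Sum>i\<in>UNIV. of_int (c i) *\<^sub>R a i)" by (auto simp: lattice_eq)
      then show "x \<in> range (\<lambda>c :: int ^ 'd. \<Sum>i\<in>UNIV. of_int (c $ i) *\<^sub>R a i)"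
        by (intro image_eqI[of _ _ "\<chi> i. c i"]) auto
    qed
  qed (auto simp: lattice_eq)
  moreover have "countable (UNIV :: (int ^ 'd) set)"
  proof -
    have "x \<in> range vec_lambda" for x :: "int ^ 'd" by (rule image_eqI[of _ _ "vec_nth x"]) simp_all
    then have "(UNIV :: (int ^ 'd) set) = range vec_lambda" by auto
    moreover have "countable (range (vec_lambda :: ('d \<Rightarrow> int) \<Rightarrow> int ^ 'd))" by (rule countable_image) simp
    ultimately show ?thesis by simp
  qed
  ultimately show ?thesis by simp
qed

lemma finite_lattice_ball: "finite {X \<in> \<Gamma>. norm X \<le> R}"
proof -
  define N where "N = \<lceil>(\<Sum>i\<in>UNIV. norm (b i)) * \<bar>R\<bar>\<rceil>"
  have "{X \<in> \<Gamma>. norm X \<le> R} \<subseteq> (\<lambda>c. \<Sum>i\<in>UNIV. of_int (c i) *\<^sub>R a i) ` (UNIV \<rightarrow>\<^sub>E {-N..N})"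
  proof
    fix X assume X: "X \<in> {X \<in> \<Gamma>. norm X \<le> R}"
    then obtain c :: "'d \<Rightarrow> int" where c: "X = (\<Sum>i\<in>UNIV. of_int (c i) *\<^sub>R a i)" by (auto simp: lattice_eq)
    have "c i \<in> {-N..N}" for i
    proof -
      have "\<bar>of_int (c i)\<bar> = \<bar>b i \<bullet> X\<bar>" by (simp add: c coordinates)
      also have "\<dots> \<le> norm (b i) * norm X" by (rule Cauchy_Schwarz_ineq2)
      also have "\<dots> \<le> (\<Sum>i\<in>UNIV. norm (b i)) * \<bar>R\<bar>"
        using X by (intro mult_mono member_le_sum sum_nonneg) auto
      finally have "\<bar>real_of_int (c i)\<bar> \<le> of_int N" unfolding N_def by linarith
      then show ?thesis by auto
    qed
    then show "X \<in> (\<lambda>c. \<Sum>i\<in>UNIV. of_int (c i) *\<^sub>R a i) ` (UNIV \<rightarrow>\<^sub>E {-N..N})"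
      using c by (intro image_eqI[of _ _ c]) auto
  qed
  then show ?thesis by (rule finite_subset) (intro finite_imageI finite_PiE; simp)
qed

text \<open>Rounding the lattice coordinates down leaves coefficients in the unit interval.\<close>

lemma covering: "\<exists>X\<in>\<Gamma>. norm (x - X) \<le> (\<Sum>i\<in>UNIV. norm (a i))"
proof
  define X where "X = (\<Sum>i\<in>UNIV. of_int \<lfloor>b i \<bullet> x\<rfloor> *\<^sub>R a i)"
  show "X \<in> \<Gamma>" unfolding X_def mem_iff by (simp add: coordinates)
  have "x - X = (\<Sum>i\<in>UNIV. (b i \<bullet> x) *\<^sub>R a i) - X" using expand[of x] by simp
  also have "\<dots> = (\<Sum>i\<in>UNIV. (b i \<bullet> x - of_int \<lfloor>b i \<bullet> x\<rfloor>) *\<^sub>R a i)"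
    by (simp add: X_def sum_subtractf scaleR_diff_left)
  also have "norm \<dots> \<le> (\<Sum>i\<in>UNIV. norm (a i))"
  proof (rule sum_norm_le)
    fix i
    have "\<bar>b i \<bullet> x - of_int \<lfloor>b i \<bullet> x\<rfloor>\<bar> \<le> 1" by linarith
    then show "norm ((b i \<bullet> x - of_int \<lfloor>b i \<bullet> x\<rfloor>) *\<^sub>R a i) \<le> norm (a i)"
      by (simp add: mult_left_le_one_le)
  qed
  finally show "norm (x - X) \<le> (\<Sum>i\<in>UNIV. norm (a i))" .
qed

lemma nearest: "\<exists>X\<in>\<Gamma>. x + X \<in> voronoi_cell \<Gamma>"
proof -
  \<comment> \<open>Lattice points of norm above \<open>R\<close> are farther from \<open>x\<close>
    than the covering radius, so the minimum over all of \<open>\<Gamma>\<close> is found in a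
    finite set.\<close>
  define R where "R = (\<Sum>i\<in>UNIV. norm (a i)) + norm x"
  define S where "S = {X \<in> \<Gamma>. norm X \<le> R}"
  have fin: "finite S" unfolding S_def by (rule finite_lattice_ball)
  obtain X0 where X0: "X0 \<in> \<Gamma>" "norm (x - X0) \<le> (\<Sum>i\<in>UNIV. norm (a i))" using covering by blast
  have X0S: "X0 \<in> S"
    using X0 norm_triangle_ineq4[of x "x - X0"] by (simp add: S_def R_def)
  obtain X where X: "X \<in> S" "\<And>Y. Y \<in> S \<Longrightarrow> norm (x - X) \<le> norm (x - Y)"
    using arg_min_if_finite(1)[of S "\<lambda>X. norm (x - X)"] arg_min_least[of S _ "\<lambda>X. norm (x - X)"] fin X0S
    by blast
  have min: "norm (x - X) \<le> norm (x - Y)" if "Y \<in> \<Gamma>" for Y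
  proof (cases "Y \<in> S")
    case False
    then have "R < norm Y" using that by (simp add: S_def)
    moreover have "norm Y \<le> norm x + norm (x - Y)" using norm_triangle_ineq4[of x "x - Y"] by simp
    ultimately have "(\<Sum>i\<in>UNIV. norm (a i)) < norm (x - Y)" by (simp add: R_def)
    then show ?thesis using X(2)[OF X0S] X0(2) by linarith
  qed (use X in blast)
  have "X \<in> \<Gamma>" using X by (simp add: S_def)
  moreover have "x - X \<in> voronoi_cell \<Gamma>"
    unfolding voronoi_cell_def
  proof (intro CollectI ballI)
    fix Y assume "Y \<in> \<Gamma>"
    then have "norm (x - X) \<le> norm (x - (X + Y))" using \<open>X \<in> \<Gamma>\<close> by (intro min add_mem)
    then show "dist (x - X) 0 \<le> dist (x - X) Y" by (simp add: dist_norm algebra_simps)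
  qed
  ultimately show ?thesis using uminus_mem[of X] by (intro bexI[of _ "- X"]) auto
qed

lemma voronoi_bounded: "x \<in> voronoi_cell \<Gamma> \<Longrightarrow> norm x \<le> (\<Sum>i\<in>UNIV. norm (a i))"
proof -
  assume x: "x \<in> voronoi_cell \<Gamma>"
  obtain X where "X \<in> \<Gamma>" "norm (x - X) \<le> (\<Sum>i\<in>UNIV. norm (a i))" using covering by blast
  moreover have "norm x \<le> norm (x - X)" using x \<open>X \<in> \<Gamma>\<close> by (auto simp: voronoi_cell_def dist_norm)
  ultimately show ?thesis by linarith
qed

lemma compact_voronoi: "compact (voronoi_cell \<Gamma>)"
proof -
  have "voronoi_cell \<Gamma> = (\<Inter>y\<in>\<Gamma>. {x. dist x 0 \<le> dist x y})" by (auto simp: voronoi_cell_def)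
  moreover have "closed (\<Inter>y\<in>\<Gamma>. {x. dist x 0 \<le> dist x y})"
    by (intro closed_INT ballI closed_Collect_le continuous_intros)
  moreover have "bounded (voronoi_cell \<Gamma>)" using voronoi_bounded by (auto simp: bounded_iff)
  ultimately show ?thesis by (simp add: compact_eq_bounded_closed)
qed

lemma voronoi_borel [measurable]: "voronoi_cell \<Gamma> \<in> sets borel"
  using compact_voronoi by (simp add: borel_closed compact_imp_closed)

text \<open>If a point and its translate by \<open>Z\<close> both lie in the cell, they are equally
  far from the origin; for nonzero \<open>Z\<close> this confines the point to a hyperplane, a null
  set. Countability of the lattice collects the exceptional sets.\<close>

lemma AE_unique_translate:
  "AE x in lebesgue. \<forall>X\<in>\<Gamma>. \<forall>Y\<in>\<Gamma>. x + X \<in> voronoi_cell \<Gamma> \<longrightarrow> x + Y \<in> voronoi_cell \<Gamma> \<longrightarrow> X = Y"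
proof -
  have 1: "AE x in lebesgue. x \<in> voronoi_cell \<Gamma> \<longrightarrow> x + Z \<in> voronoi_cell \<Gamma> \<longrightarrow> Z = 0" if Z: "Z \<in> \<Gamma>" for Z
  proof (cases "Z = 0")
    case False
    have "negligible {x. (2 *\<^sub>R Z) \<bullet> x = - (Z \<bullet> Z)}" using False by (intro negligible_hyperplane) simp
    moreover have "{x. \<not> (x \<in> voronoi_cell \<Gamma> \<longrightarrow> x + Z \<in> voronoi_cell \<Gamma> \<longrightarrow> Z = 0)} \<subseteq> {x. (2 *\<^sub>R Z) \<bullet> x = - (Z \<bullet> Z)}"
    proof
      fix x assume "x \<in> {x. \<not> (x \<in> voronoi_cell \<Gamma> \<longrightarrow> x + Z \<in> voronoi_cell \<Gamma> \<longrightarrow> Z = 0)}"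
      then have x: "x \<in> voronoi_cell \<Gamma>" "x + Z \<in> voronoi_cell \<Gamma>" by auto
      have "norm x \<le> norm (x + Z)"
        using x(1) uminus_mem[OF Z] by (auto simp: voronoi_cell_def dist_norm)
      moreover have "norm (x + Z) \<le> norm x"
        using x(2) Z by (force simp: voronoi_cell_def dist_norm)
      ultimately have "(norm (x + Z))\<^sup>2 = (norm x)\<^sup>2" by simp
      then show "x \<in> {x. (2 *\<^sub>R Z) \<bullet> x = - (Z \<bullet> Z)}"
        by (simp add: power2_norm_eq_inner inner_add inner_commute)
    qed
    ultimately show ?thesis
      by (auto simp: eventually_ae_filter negligible_iff_null_sets)
  qed simp
  have "AE x in lebesgue. \<forall>X\<in>\<Gamma>. \<forall>Z\<in>\<Gamma>. x + X \<in> voronoi_cell \<Gamma> \<longrightarrow> x + X + Z \<in> voronoi_cell \<Gamma> \<longrightarrow> Z = 0"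
    using AE_lebesgue_translate[OF 1] by (intro AE_ball_countable[THEN iffD2] countable_lattice ballI)
  then show ?thesis
  proof eventually_elim
    case (elim x)
    show ?case
    proof (intro ballI impI)
      fix X Y assume "X \<in> \<Gamma>" "Y \<in> \<Gamma>" "x + X \<in> voronoi_cell \<Gamma>" "x + Y \<in> voronoi_cell \<Gamma>"
      then have "Y - X = 0" using elim[rule_format, of X "Y - X"] diff_mem by simp
      then show "X = Y" by simp
    qed
  qed
qed

text \<open>Every point has a lattice translate in the cell, and the second hypothesis carries
  \<open>P\<close> back from there. The exceptional sets of all translates form a countable union of
  null sets.\<close>

lemma AE_from_cell:
  assumes "AE x in lebesgue. x \<in> voronoi_cell \<Gamma> \<longrightarrow> P x"
    and "AE x in lebesgue. \<forall>X\<in>\<Gamma>. P (x + X) \<longrightarrow> P x"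
  shows "AE x in lebesgue. P x"
proof -
  have "AE x in lebesgue. \<forall>X\<in>\<Gamma>. x + X \<in> voronoi_cell \<Gamma> \<longrightarrow> P (x + X)"
    using AE_lebesgue_translate[OF assms(1)]
    by (intro AE_ball_countable[THEN iffD2] countable_lattice ballI)
  with assms(2) show ?thesis
  proof eventually_elim
    case (elim x)
    then show ?case using nearest[of x] by blast
  qed
qed

lemma AE_unique_cell:
  "AE x in lebesgue. x \<in> voronoi_cell \<Gamma> \<longrightarrow> (\<forall>X\<in>\<Gamma>. x + X \<in> voronoi_cell \<Gamma> \<longrightarrow> X = 0)"
  using AE_unique_translate
proof eventually_elim
  case (elim x)
  then show ?case using zero_mem by (metis add.right_neutral)
qed

text \<open>If the cell were a null set, \<open>AE_from_cell\<close> would prove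
  \<open>False\<close> almost everywhere.\<close>

lemma measure_voronoi_pos: "0 < measure lebesgue (voronoi_cell \<Gamma>)"
proof (rule ccontr)
  assume "\<not> ?thesis"
  then have "measure lebesgue (voronoi_cell \<Gamma>) = 0" using measure_nonneg[of lebesgue "voronoi_cell \<Gamma>"] by linarith
  moreover have "voronoi_cell \<Gamma> \<in> lmeasurable" by (rule lmeasurable_compact[OF compact_voronoi])
  ultimately have "voronoi_cell \<Gamma> \<in> null_sets lebesgue"
    by (simp add: negligible_iff_measure0 flip: negligible_iff_null_sets)
  then have "AE x in lebesgue. x \<in> voronoi_cell \<Gamma> \<longrightarrow> False"
    using AE_not_in by auto
  then have "AE x in (lebesgue :: (real ^ 'd) measure). False" by (rule AE_from_cell) simp
  then have "(UNIV :: (real ^ 'd) set) \<in> null_sets lebesgue" using AE_iff_null_sets[of "UNIV :: (real ^ 'd) set" lebesgue] by simp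
  then have "negligible (UNIV :: (real ^ 'd) set)" by (simp add: negligible_iff_null_sets)
  then show False by simp
qed

lemma voronoi_integral_translate:
  fixes f :: "real ^ 'd \<Rightarrow> complex"
  assumes cont: "continuous_on UNIV f" and per: "\<And>X x. X \<in> \<Gamma> \<Longrightarrow> f (x + X) = f x"
  shows "(LINT x:voronoi_cell \<Gamma>|lebesgue. f (x + y)) = (LINT x:voronoi_cell \<Gamma>|lebesgue. f x)"
proof -
  let ?F = "voronoi_cell \<Gamma>"
  \<comment> \<open>The translated cell meets only the finitely many lattice translates of \<open>?F\<close> indexed by \<open>S\<close>;
    moving each piece back to \<open>?F\<close> costs nothing by periodicity.\<close>
  define R where "R = (\<Sum>i\<in>UNIV. norm (a i))"
  define S where "S = {X \<in> \<Gamma>. norm X \<le> 2 * R + norm y}"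
  have fin: "finite S" unfolding S_def by (rule finite_lattice_ball)
  have inS: "X \<in> S" if "x \<in> ?F" "x + y - X \<in> ?F" "X \<in> \<Gamma>" for x X
  proof -
    have "norm X = norm (x + y - (x + y - X))" by simp
    also have "\<dots> \<le> norm x + norm y + norm (x + y - X)"
      by (rule order_trans[OF norm_triangle_ineq4 add_mono[OF norm_triangle_ineq order_refl]])
    finally show ?thesis
      using voronoi_bounded[OF that(1)] voronoi_bounded[OF that(2)] that(3) by (simp add: S_def R_def)
  qed
  have [measurable]: "f \<in> borel_measurable borel" using cont by (rule borel_measurable_continuous_onI)
  define G where "G X x = indicator ?F x *\<^sub>R indicator ?F (x + y - X) *\<^sub>R f (x + y - X)" for X x
  have [measurable]: "(\<lambda>x. x + y - X) \<in> borel_measurable borel" for X :: "real ^ 'd" by simp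
  have G_meas [measurable]: "G X \<in> borel_measurable borel" for X
    unfolding G_def by measurable
  have "bounded (f ` ?F)"
    using cont by (intro compact_imp_bounded compact_continuous_image compact_voronoi continuous_on_subset[OF cont]) auto
  then obtain M where M: "\<And>x. x \<in> ?F \<Longrightarrow> norm (f x) \<le> M" by (auto simp: bounded_iff)
  have F_int: "integrable lborel (indicator ?F :: real ^ 'd \<Rightarrow> real)"
    using lmeasurable_compact[OF compact_voronoi] by (simp add: fmeasurable_def)
  have G_int: "integrable lborel (G X)" for X
  proof (rule Bochner_Integration.integrable_bound[of _ "\<lambda>x. \<bar>M\<bar> * indicator ?F x"])
    show "AE x in lborel. norm (G X x) \<le> norm (\<bar>M\<bar> * indicator ?F x :: real)"
    proof (rule AE_I2)
      fix x
      show "norm (G X x) \<le> norm (\<bar>M\<bar> * indicator ?F x :: real)"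
        using M[of "x + y - X"] by (auto simp: G_def indicator_def)
    qed
  qed (use F_int in auto)
  have "(LINT x:?F|lebesgue. f (x + y)) = (\<integral>x. indicator ?F x *\<^sub>R f (x + y) \<partial>lborel)"
    unfolding set_lebesgue_integral_def by (rule integral_completion) measurable
  also have "\<dots> = (\<integral>x. (\<Sum>X\<in>S. G X x) \<partial>lborel)"
  proof (rule integral_cong_AE)
    have "AE x in lebesgue. indicator ?F x *\<^sub>R f (x + y) = (\<Sum>X\<in>S. G X x)"
      using AE_lebesgue_translate[OF AE_unique_translate, of y]
    proof eventually_elim
      case (elim x)
      show ?case
      proof (cases "x \<in> ?F")
        case True
        obtain Z where Z: "Z \<in> \<Gamma>" "x + y + Z \<in> ?F" using nearest[of "x + y"] by blast
        define X where "X = - Z"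
        have X: "X \<in> \<Gamma>" "x + y - X \<in> ?F" using Z uminus_mem by (auto simp: X_def)
        have XS: "X \<in> S" by (rule inS) fact+
        have "G Y x = (if Y = X then f (x + y) else 0)" if "Y \<in> S" for Y
        proof (cases "Y = X")
          case True
          then show ?thesis using X \<open>x \<in> ?F\<close> per[OF uminus_mem[OF X(1)], of "x + y"] by (simp add: G_def)
        next
          case False
          have "x + y - Y \<notin> ?F"
          proof
            assume "x + y - Y \<in> ?F"
            then have "- Y = - X"
              using elim[rule_format, of "- Y" "- X"] X that uminus_mem by (simp add: S_def)
            then show False using False by simp
          qed
          then show ?thesis using False by (simp add: G_def)
        qed
        then have "(\<Sum>Y\<in>S. G Y x) = (\<Sum>Y\<in>S. if Y = X then f (x + y) else 0)" by (intro sum.cong) auto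
        then show ?thesis using True XS fin by simp
      qed (simp add: G_def)
    qed
    then show "AE x in lborel. indicator ?F x *\<^sub>R f (x + y) = (\<Sum>X\<in>S. G X x)"
      by (subst (asm) AE_completion_iff) simp_all
  qed measurable
  also have "\<dots> = (\<Sum>X\<in>S. \<integral>x. G X x \<partial>lborel)" by (rule Bochner_Integration.integral_sum[OF G_int])
  \<comment> \<open>Shifting by \<open>X - y\<close> exchanges the two indicators: the term of
    \<open>X\<close> now asks whether \<open>x + X - y\<close> lies in the cell, which for almost
    every \<open>x\<close> in the cell holds for exactly one \<open>X\<close> in
    \<open>S\<close>.\<close>
  also have "\<dots> = (\<Sum>X\<in>S. \<integral>x. G X (x + (X - y)) \<partial>lborel)"
  proof (rule sum.cong[OF refl])
    fix X
    have "(\<integral>x. G X x \<partial>lborel) = (\<integral>x. G X x \<partial>(distr lborel borel ((+) (X - y))))"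
      by (simp add: lborel_distr_plus)
    also have "\<dots> = (\<integral>x. G X ((X - y) + x) \<partial>lborel)" by (rule integral_distr) measurable
    finally show "(\<integral>x. G X x \<partial>lborel) = (\<integral>x. G X (x + (X - y)) \<partial>lborel)" by (simp add: add.commute)
  qed
  also have "\<dots> = (\<integral>x. (\<Sum>X\<in>S. G X (x + (X - y))) \<partial>lborel)"
  proof (rule Bochner_Integration.integral_sum[symmetric])
    fix X
    have "integrable (distr lborel borel ((+) (X - y))) (G X)" using G_int by (simp add: lborel_distr_plus)
    then have "integrable lborel (\<lambda>x. G X ((X - y) + x))" by (subst (asm) integrable_distr_eq) auto
    then show "integrable lborel (\<lambda>x. G X (x + (X - y)))" by (simp add: add.commute)
  qed
  also have "\<dots> = (\<integral>x. indicator ?F x *\<^sub>R f x \<partial>lborel)"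
  proof (rule integral_cong_AE)
    have "AE x in lebesgue. (\<Sum>X\<in>S. G X (x + (X - y))) = indicator ?F x *\<^sub>R f x"
      using AE_lebesgue_translate[OF AE_unique_translate, of "- y"]
    proof eventually_elim
      case (elim x)
      show ?case
      proof (cases "x \<in> ?F")
        case True
        obtain X where X: "X \<in> \<Gamma>" "x + (X - y) \<in> ?F" using nearest[of "x - y"] by (auto simp: algebra_simps)
        have XS: "X \<in> S" by (rule inS[of "x + (X - y)"]) (use X True in auto)
        have "G Y (x + (Y - y)) = (if Y = X then f x else 0)" if "Y \<in> S" for Y
        proof (cases "Y = X")
          case True
          then show ?thesis using X \<open>x \<in> ?F\<close> by (simp add: G_def)
        next
          case False
          have "x + (Y - y) \<notin> ?F"
          proof
            assume "x + (Y - y) \<in> ?F"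
            then have "Y = X"
              using elim[rule_format, of Y X] X that by (simp add: S_def algebra_simps)
            then show False using False by simp
          qed
          then show ?thesis using False by (simp add: G_def)
        qed
        then have "(\<Sum>Y\<in>S. G Y (x + (Y - y))) = (\<Sum>Y\<in>S. if Y = X then f x else 0)" by (intro sum.cong) auto
        then show ?thesis using True XS fin by simp
      qed (simp add: G_def)
    qed
    then show "AE x in lborel. (\<Sum>X\<in>S. G X (x + (X - y))) = indicator ?F x *\<^sub>R f x"
      by (subst (asm) AE_completion_iff) simp_all
  qed measurable
  also have "\<dots> = (LINT x:?F|lebesgue. f x)"
    unfolding set_lebesgue_integral_def by (rule integral_completion[symmetric]) measurable
  finally show ?thesis .
qed

text \<open>The bases swap roles, the factor \<open>2 * pi\<close> being the normalisation in
  \<open>dual_lattice\<close>. Everything proved for lattices thereby holds for the reciprocal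
  one.\<close>

lemma dual_lattice_basis: "lattice_basis (\<lambda>i. (2 * pi) *\<^sub>R b i) (\<lambda>i. (1 / (2 * pi)) *\<^sub>R a i) (dual_lattice \<Gamma>)"
proof
  show "((1 / (2 * pi)) *\<^sub>R a i) \<bullet> ((2 * pi) *\<^sub>R b j) = (if i = j then 1 else 0)" for i j
    using dual[of j i] by (auto simp: inner_commute)
  show "x = (\<Sum>i\<in>UNIV. (((1 / (2 * pi)) *\<^sub>R a i) \<bullet> x) *\<^sub>R ((2 * pi) *\<^sub>R b i))" for x
    using dual_expand[of x] by simp
  show "dual_lattice \<Gamma> = {\<Sum>i\<in>UNIV. of_int (c i) *\<^sub>R ((2 * pi) *\<^sub>R b i) | c :: 'd \<Rightarrow> int. True}" (is "_ = ?D")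
  proof
    show "dual_lattice \<Gamma> \<subseteq> ?D"
    proof
      fix \<xi> assume \<xi>: "\<xi> \<in> dual_lattice \<Gamma>"
      have "a i \<in> \<Gamma>" for i by (simp add: mem_iff dual)
      then have "\<forall>i. \<exists>n :: int. \<xi> \<bullet> a i = 2 * pi * of_int n" using \<xi> by (auto simp: dual_lattice_def)
      then obtain c :: "'d \<Rightarrow> int" where c: "\<And>i. \<xi> \<bullet> a i = 2 * pi * of_int (c i)" by metis
      have "\<xi> = (\<Sum>i\<in>UNIV. of_int (c i) *\<^sub>R ((2 * pi) *\<^sub>R b i))"
        using dual_expand[of \<xi>] by (simp add: inner_commute c mult.commute)
      then show "\<xi> \<in> ?D" by blast
    qed
    show "?D \<subseteq> dual_lattice \<Gamma>"
    proof
      fix \<xi> assume "\<xi> \<in> ?D"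
      then obtain c :: "'d \<Rightarrow> int" where c: "\<xi> = (\<Sum>i\<in>UNIV. of_int (c i) *\<^sub>R ((2 * pi) *\<^sub>R b i))" by blast
      show "\<xi> \<in> dual_lattice \<Gamma>"
        unfolding dual_lattice_def
      proof (intro CollectI ballI)
        fix X assume "X \<in> \<Gamma>"
        then obtain e :: "'d \<Rightarrow> int" where e: "X = (\<Sum>i\<in>UNIV. of_int (e i) *\<^sub>R a i)" by (auto simp: lattice_eq)
        have "\<xi> \<bullet> X = (\<Sum>i\<in>UNIV. of_int (c i) * (2 * pi) * (b i \<bullet> X))" by (simp add: c inner_sum_left mult_ac)
        also have "\<dots> = 2 * pi * of_int (\<Sum>i\<in>UNIV. c i * e i)"
          by (simp add: e coordinates sum_distrib_left mult_ac)
        finally show "\<exists>n :: int. \<xi> \<bullet> X = 2 * pi * of_int n" by blast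
      qed
    qed
  qed
qed

end

lemma bravais_lattice_basis:
  fixes \<Gamma> :: "(real ^ 'd) set"
  assumes "bravais_lattice \<Gamma>"
  shows "\<exists>a b. lattice_basis a b \<Gamma>"
proof -
  obtain B where B: "independent B" "span B = UNIV"
    and \<Gamma>: "\<Gamma> = {(\<Sum>b\<in>B. of_int (c b) *\<^sub>R b) | c :: real ^ 'd \<Rightarrow> int. True}"
    using assms by (auto simp: bravais_lattice_def)
  have finB: "finite B" using B(1) by (rule independent_imp_finite)
  have "dim (UNIV :: (real ^ 'd) set) = card B" using B by (intro dim_eq_card) auto
  then have "card B = CARD('d)" by simp
  then obtain a where a: "bij_betw a (UNIV :: 'd set) B"
    using finB finite_same_card_bij[of "UNIV :: 'd set" B] by auto
  then have aB: "a i \<in> B" and ainj: "a i = a j \<longleftrightarrow> i = j" for i j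
    by (auto simp: bij_betw_def inj_eq)
  \<comment> \<open>\<open>b i\<close> is the Riesz vector of the functional that reads off the
    coefficient of \<open>a i\<close>.\<close>
  define b where "b i = (\<Sum>e\<in>Basis. representation B e (a i) *\<^sub>R e)" for i
  have lin: "representation B x v = (\<Sum>e\<in>Basis. (x \<bullet> e) * representation B e v)" for x v
  proof -
    have "representation B x v = representation B (\<Sum>e\<in>Basis. (x \<bullet> e) *\<^sub>R e) v" by (simp add: euclidean_representation)
    also have "\<dots> = (\<Sum>e\<in>Basis. representation B ((x \<bullet> e) *\<^sub>R e) v)"
      using B by (subst representation_sum) auto
    also have "\<dots> = (\<Sum>e\<in>Basis. (x \<bullet> e) * representation B e v)"
      using B by (intro sum.cong refl) (simp add: representation_scale)
    finally show ?thesis .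
  qed
  have bx: "b i \<bullet> x = representation B x (a i)" for i x
    unfolding lin[of x] b_def by (simp add: inner_sum_left inner_sum_right inner_commute mult.commute)
  have "lattice_basis a b \<Gamma>"
  proof
    show "b i \<bullet> a j = (if i = j then 1 else 0)" for i j
      unfolding bx using representation_basis[OF B(1) aB] ainj by auto
    show "x = (\<Sum>i\<in>UNIV. (b i \<bullet> x) *\<^sub>R a i)" for x
    proof -
      have "(\<Sum>i\<in>UNIV. (b i \<bullet> x) *\<^sub>R a i) = (\<Sum>v\<in>B. representation B x v *\<^sub>R v)"
        unfolding bx by (rule sum.reindex_bij_betw[OF a])
      also have "\<dots> = x" using B finB by (intro sum_representation_eq) auto
      finally show ?thesis ..
    qed
    show "\<Gamma> = {\<Sum>i\<in>UNIV. of_int (c i) *\<^sub>R a i | c :: 'd \<Rightarrow> int. True}"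
    proof (unfold \<Gamma>, intro set_eqI iffI)
      fix x assume "x \<in> {(\<Sum>b\<in>B. of_int (c b) *\<^sub>R b) | c :: real ^ 'd \<Rightarrow> int. True}"
      then obtain c :: "real ^ 'd \<Rightarrow> int" where "x = (\<Sum>b\<in>B. of_int (c b) *\<^sub>R b)" by blast
      also have "\<dots> = (\<Sum>i\<in>UNIV. of_int (c (a i)) *\<^sub>R a i)" by (rule sum.reindex_bij_betw[OF a, symmetric])
      finally show "x \<in> {\<Sum>i\<in>UNIV. of_int (c i) *\<^sub>R a i | c :: 'd \<Rightarrow> int. True}" by (auto intro!: exI[of _ "\<lambda>i. c (a i)"])
    next
      fix x assume "x \<in> {\<Sum>i\<in>UNIV. of_int (c i) *\<^sub>R a i | c :: 'd \<Rightarrow> int. True}"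
      then obtain c :: "'d \<Rightarrow> int" where "x = (\<Sum>i\<in>UNIV. of_int (c i) *\<^sub>R a i)" by blast
      also have "\<dots> = (\<Sum>i\<in>UNIV. of_int (c (inv a (a i))) *\<^sub>R a i)" using a by (simp add: bij_betw_def)
      also have "\<dots> = (\<Sum>v\<in>B. of_int (c (inv a v)) *\<^sub>R v)" by (rule sum.reindex_bij_betw[OF a])
      finally show "x \<in> {(\<Sum>b\<in>B. of_int (c b) *\<^sub>R b) | c :: real ^ 'd \<Rightarrow> int. True}"
        by (auto intro!: exI[of _ "\<lambda>v. c (inv a v)"])
    qed
  qed
  then show ?thesis by blast
qed

section \<open>Orthonormal systems in \<open>L\<^sup>2\<close>\<close>

definition l2 :: "'a measure \<Rightarrow> ('a \<Rightarrow> complex) set" where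
  "l2 M = {u \<in> borel_measurable M. integrable M (\<lambda>x. (cmod (u x))\<^sup>2)}"

definition sqn :: "'a measure \<Rightarrow> ('a \<Rightarrow> complex) \<Rightarrow> real" where
  "sqn M u = (\<integral>x. (cmod (u x))\<^sup>2 \<partial>M)"

definition l2ip :: "'a measure \<Rightarrow> ('a \<Rightarrow> complex) \<Rightarrow> ('a \<Rightarrow> complex) \<Rightarrow> complex" where
  "l2ip M u v = (\<integral>x. u x * cnj (v x) \<partial>M)"

lemma l2_measurable [measurable_dest]: "u \<in> l2 M \<Longrightarrow> u \<in> borel_measurable M"
  by (simp add: l2_def)

lemma borel_measurable_cnj [measurable]:
  "f \<in> borel_measurable M \<Longrightarrow> (\<lambda>x. cnj (f x)) \<in> borel_measurable M"
  by (rule measurable_compose[of f M borel]) (auto intro!: borel_measurable_continuous_onI continuous_intros)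

lemma cmod_mult_cnj_le: "2 * cmod (a * cnj b) \<le> (cmod a)\<^sup>2 + (cmod b)\<^sup>2"
  using sum_squares_bound[of "cmod a" "cmod b"] by (simp add: norm_mult)

lemma cmod_mult_cnj_le': "cmod (a * cnj b) \<le> (cmod a)\<^sup>2 + (cmod b)\<^sup>2"
  using cmod_mult_cnj_le[of a b] norm_ge_zero[of "a * cnj b"] by linarith

lemma l2_integrable_mult:
  assumes "u \<in> l2 M" "v \<in> l2 M"
  shows "integrable M (\<lambda>x. u x * cnj (v x))"
proof (rule Bochner_Integration.integrable_bound)
  show "integrable M (\<lambda>x. (cmod (u x))\<^sup>2 + (cmod (v x))\<^sup>2)" using assms by (simp add: l2_def)
  show "(\<lambda>x. u x * cnj (v x)) \<in> borel_measurable M" using assms by measurable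
  show "AE x in M. norm (u x * cnj (v x)) \<le> norm ((cmod (u x))\<^sup>2 + (cmod (v x))\<^sup>2)"
    using cmod_mult_cnj_le' by (intro AE_I2) (metis abs_ge_self order_trans real_norm_def)
qed

lemma l2_add:
  assumes "u \<in> l2 M" "v \<in> l2 M"
  shows "(\<lambda>x. u x + v x) \<in> l2 M"
proof -
  have "integrable M (\<lambda>x. (cmod (u x + v x))\<^sup>2)"
  proof (rule Bochner_Integration.integrable_bound)
    show "integrable M (\<lambda>x. 2 * (cmod (u x))\<^sup>2 + 2 * (cmod (v x))\<^sup>2)" using assms by (simp add: l2_def)
    show "(\<lambda>x. (cmod (u x + v x))\<^sup>2) \<in> borel_measurable M" using assms by measurable
    show "AE x in M. norm ((cmod (u x + v x))\<^sup>2) \<le> norm (2 * (cmod (u x))\<^sup>2 + 2 * (cmod (v x))\<^sup>2)"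
      by (intro AE_I2) (simp add: cmod_add_square_le)
  qed
  moreover have "(\<lambda>x. u x + v x) \<in> borel_measurable M" using assms by measurable
  ultimately show ?thesis by (simp add: l2_def)
qed

lemma l2_bounded_mult:
  assumes "u \<in> l2 M" "g \<in> borel_measurable M" "AE x in M. cmod (g x) \<le> C"
  shows "(\<lambda>x. g x * u x) \<in> l2 M"
proof -
  have "integrable M (\<lambda>x. (cmod (g x * u x))\<^sup>2)"
  proof (rule Bochner_Integration.integrable_bound)
    show "integrable M (\<lambda>x. C\<^sup>2 * (cmod (u x))\<^sup>2)" using assms by (simp add: l2_def)
    show "(\<lambda>x. (cmod (g x * u x))\<^sup>2) \<in> borel_measurable M" using assms by measurable
    show "AE x in M. norm ((cmod (g x * u x))\<^sup>2) \<le> norm (C\<^sup>2 * (cmod (u x))\<^sup>2)"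
      using assms(3)
    proof eventually_elim
      case (elim x)
      then have "(cmod (g x))\<^sup>2 \<le> C\<^sup>2" by (intro power_mono) auto
      then show ?case by (simp add: norm_mult power_mult_distrib mult_right_mono)
    qed
  qed
  moreover have "(\<lambda>x. g x * u x) \<in> borel_measurable M" using assms by measurable
  ultimately show ?thesis by (simp add: l2_def)
qed

lemma l2_scale: "u \<in> l2 M \<Longrightarrow> (\<lambda>x. c * u x) \<in> l2 M"
  by (rule l2_bounded_mult[of u M "\<lambda>_. c" "cmod c"]) auto

lemma l2_diff: "u \<in> l2 M \<Longrightarrow> v \<in> l2 M \<Longrightarrow> (\<lambda>x. u x - v x) \<in> l2 M"
  using l2_add[of u M "\<lambda>x. -1 * v x"] l2_scale[of v M "-1"] by simp

lemma l2_zero: "(\<lambda>x. 0) \<in> l2 M"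
  by (simp add: l2_def)

lemma l2_sum: "(\<And>i. i \<in> I \<Longrightarrow> f i \<in> l2 M) \<Longrightarrow> (\<lambda>x. \<Sum>i\<in>I. f i x) \<in> l2 M"
  by (induction I rule: infinite_finite_induct) (auto simp: l2_zero l2_add)

lemma l2_cnj: "u \<in> l2 M \<Longrightarrow> (\<lambda>x. cnj (u x)) \<in> l2 M"
  by (simp add: l2_def borel_measurable_cnj)

lemma sqn_nonneg: "0 \<le> sqn M u"
  by (simp add: sqn_def)

lemma l2ip_self: "u \<in> l2 M \<Longrightarrow> l2ip M u u = of_real (sqn M u)"
  by (simp only: l2ip_def sqn_def complex_norm_square[symmetric] integral_complex_of_real)

lemma l2ip_commute: "l2ip M v u = cnj (l2ip M u v)"
  unfolding l2ip_def Bochner_Integration.integral_cnj[symmetric] by (simp add: mult.commute)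

lemma l2ip_diff_left: "u \<in> l2 M \<Longrightarrow> v \<in> l2 M \<Longrightarrow> w \<in> l2 M \<Longrightarrow> l2ip M (\<lambda>x. u x - v x) w = l2ip M u w - l2ip M v w"
  unfolding l2ip_def by (simp add: left_diff_distrib l2_integrable_mult)

lemma l2ip_add_left: "u \<in> l2 M \<Longrightarrow> v \<in> l2 M \<Longrightarrow> w \<in> l2 M \<Longrightarrow> l2ip M (\<lambda>x. u x + v x) w = l2ip M u w + l2ip M v w"
  unfolding l2ip_def by (simp add: distrib_right l2_integrable_mult)

lemma l2ip_scale_left: "l2ip M (\<lambda>x. c * u x) w = c * l2ip M u w"
  unfolding l2ip_def by (simp add: mult.assoc)

lemma l2ip_sum_left:
  "(\<And>i. i \<in> I \<Longrightarrow> f i \<in> l2 M) \<Longrightarrow> w \<in> l2 M \<Longrightarrow> l2ip M (\<lambda>x. \<Sum>i\<in>I. f i x) w = (\<Sum>i\<in>I. l2ip M (f i) w)"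
  unfolding l2ip_def by (simp add: sum_distrib_right l2_integrable_mult)

lemma sqn_diff:
  assumes "u \<in> l2 M" "v \<in> l2 M"
  shows "sqn M (\<lambda>x. u x - v x) = sqn M u - 2 * Re (l2ip M u v) + sqn M v"
proof -
  let ?d = "\<lambda>x. u x - v x"
  have d: "?d \<in> l2 M" using assms by (rule l2_diff)
  have "of_real (sqn M ?d) = l2ip M u ?d - l2ip M v ?d"
    unfolding l2ip_self[OF d, symmetric] by (rule l2ip_diff_left[OF assms d])
  also have "\<dots> = cnj (l2ip M ?d u) - cnj (l2ip M ?d v)"
    unfolding l2ip_commute[of M u ?d] l2ip_commute[of M v ?d] ..
  also have "\<dots> = cnj (of_real (sqn M u) - l2ip M v u) - cnj (l2ip M u v - of_real (sqn M v))"
    using assms by (simp add: l2ip_diff_left l2ip_self)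
  finally have "Re (of_real (sqn M ?d)) = Re (cnj (of_real (sqn M u) - l2ip M v u) - cnj (l2ip M u v - of_real (sqn M v)))"
    by simp
  then show ?thesis by (simp add: l2ip_commute[of M v u])
qed

text \<open>Young's inequality under the integral. The free parameter \<open>t\<close> stands in for
  the product of the norms: a large \<open>t\<close> makes the second term small, and convergence
  then takes care of the first.\<close>

lemma l2_Cauchy_Schwarz_scaled:
  assumes "u \<in> l2 M" "v \<in> l2 M" "0 < t"
  shows "2 * cmod (l2ip M u v) \<le> t * sqn M u + sqn M v / t"
proof -
  have "2 * cmod (l2ip M u v) = cmod (\<integral>x. 2 * (u x * cnj (v x)) \<partial>M)"
    by (simp add: l2ip_def norm_mult)
  also have "\<dots> \<le> (\<integral>x. cmod (2 * (u x * cnj (v x))) \<partial>M)" by (rule integral_norm_bound)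
  also have "\<dots> \<le> (\<integral>x. t * (cmod (u x))\<^sup>2 + (cmod (v x))\<^sup>2 / t \<partial>M)"
  proof (rule integral_mono)
    show "integrable M (\<lambda>x. cmod (2 * (u x * cnj (v x))))"
      by (intro integrable_norm integrable_mult_right l2_integrable_mult assms)
    show "integrable M (\<lambda>x. t * (cmod (u x))\<^sup>2 + (cmod (v x))\<^sup>2 / t)" using assms by (simp add: l2_def)
    fix x
    have "2 * (sqrt t * cmod (u x)) * (cmod (v x) / sqrt t) \<le> (sqrt t * cmod (u x))\<^sup>2 + (cmod (v x) / sqrt t)\<^sup>2"
      by (rule sum_squares_bound)
    then show "cmod (2 * (u x * cnj (v x))) \<le> t * (cmod (u x))\<^sup>2 + (cmod (v x))\<^sup>2 / t"
      using assms(3) by (simp add: norm_mult power_mult_distrib power_divide)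
  qed
  also have "\<dots> = t * sqn M u + sqn M v / t"
    using assms unfolding sqn_def l2_def by simp
  finally show ?thesis .
qed

lemma l2ip_tendsto:
  assumes u: "\<And>k. u k \<in> l2 M" "w \<in> l2 M" and v: "v \<in> l2 M"
    and lim: "(\<lambda>k. sqn M (\<lambda>x. w x - u k x)) \<longlonglongrightarrow> 0"
  shows "(\<lambda>k. l2ip M (u k) v) \<longlonglongrightarrow> l2ip M w v"
proof (rule LIMSEQ_I)
  fix e :: real assume e: "0 < e"
  \<comment> \<open>Large enough for the term with \<open>v\<close> to stay below \<open>e\<close>;
    the other term is handled by taking \<open>k\<close> large.\<close>
  define t where "t = sqn M v / e + 1"
  have t: "0 < t" using e sqn_nonneg[of M v] by (simp add: t_def add_nonneg_pos)
  have "sqn M v < t * e" using e by (simp add: t_def field_simps)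
  then have vt: "sqn M v / t < e" using t by (simp add: field_simps)
  have "eventually (\<lambda>k. sqn M (\<lambda>x. w x - u k x) < e / t) sequentially"
    using e t by (intro order_tendstoD(2)[OF lim]) simp
  then obtain N where N: "\<And>k. k \<ge> N \<Longrightarrow> sqn M (\<lambda>x. w x - u k x) < e / t" by (auto simp: eventually_sequentially)
  have "norm (l2ip M (u k) v - l2ip M w v) < e" if "k \<ge> N" for k
  proof -
    have "2 * cmod (l2ip M (\<lambda>x. w x - u k x) v) \<le> t * sqn M (\<lambda>x. w x - u k x) + sqn M v / t"
      by (intro l2_Cauchy_Schwarz_scaled l2_diff u v t)
    moreover have "t * sqn M (\<lambda>x. w x - u k x) < e" using N[OF that] t by (simp add: field_simps)
    ultimately have "cmod (l2ip M w v - l2ip M (u k) v) < e"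
      using vt u v by (simp only: l2ip_diff_left)
    then show ?thesis by (simp add: norm_minus_commute)
  qed
  then show "\<exists>N. \<forall>k\<ge>N. norm (l2ip M (u k) v - l2ip M w v) < e" by blast
qed

text \<open>The decay \<open>4 ^ -k\<close> leaves room for weights \<open>2 ^ k\<close>: the
  weighted squares still have a summable sequence of integrals, so their sum is finite almost
  everywhere, and it controls the sum of the first powers.\<close>

lemma AE_summable_of_sqn:
  assumes d: "\<And>k. d k \<in> l2 M" and bound: "\<And>k. sqn M (d k) \<le> (1/4) ^ k"
  shows "AE x in M. summable (\<lambda>k. cmod (d k x))"
proof -
  have [measurable]: "d k \<in> borel_measurable M" for k using d by (rule l2_measurable)
  have "(\<integral>\<^sup>+x. (\<Sum>k. ennreal (2 ^ k * (cmod (d k x))\<^sup>2)) \<partial>M) = (\<Sum>k. \<integral>\<^sup>+x. ennreal (2 ^ k * (cmod (d k x))\<^sup>2) \<partial>M)"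
    by (rule nn_integral_suminf) measurable
  also have "\<dots> \<le> (\<Sum>k. ennreal ((1/2) ^ k))"
  proof (rule suminf_le)
    fix k
    have "(\<integral>\<^sup>+x. ennreal (2 ^ k * (cmod (d k x))\<^sup>2) \<partial>M) = ennreal (2 ^ k * sqn M (d k))"
      unfolding sqn_def using d[of k]
      by (subst nn_integral_eq_integral) (auto simp: l2_def)
    also have "\<dots> \<le> ennreal ((1/2) ^ k)"
    proof (rule ennreal_leI)
      have "2 ^ k * sqn M (d k) \<le> 2 ^ k * (1/4) ^ k" using bound by (intro mult_left_mono) auto
      also have "\<dots> = (1/2) ^ k" by (simp flip: power_mult_distrib)
      finally show "2 ^ k * sqn M (d k) \<le> (1/2) ^ k" .
    qed
    finally show "(\<integral>\<^sup>+x. ennreal (2 ^ k * (cmod (d k x))\<^sup>2) \<partial>M) \<le> ennreal ((1/2) ^ k)" .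
  qed auto
  also have "\<dots> = ennreal (\<Sum>k. (1/2) ^ k)"
    by (rule suminf_ennreal2) (auto intro: summable_geometric)
  finally have "(\<integral>\<^sup>+x. (\<Sum>k. ennreal (2 ^ k * (cmod (d k x))\<^sup>2)) \<partial>M) \<noteq> \<infinity>"
    by (auto simp: top_unique)
  then have "AE x in M. (\<Sum>k. ennreal (2 ^ k * (cmod (d k x))\<^sup>2)) \<noteq> \<infinity>"
    by (intro nn_integral_noteq_infinite) auto
  then show ?thesis
  proof eventually_elim
    case (elim x)
    have s: "summable (\<lambda>k. 2 ^ k * (cmod (d k x))\<^sup>2)"
      by (rule summable_suminf_not_top) (use elim in auto)
    show ?case
    proof (rule summable_comparison_test'[OF summable_add[OF s summable_geometric[of "1/2 :: real"]], of 0])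
      fix k
      let ?P = "2 ^ k :: real" and ?y = "cmod (d k x)"
      \<comment> \<open>Young's inequality for \<open>2 ^ k * y\<close> and 1 yields
        \<open>y \<le> 2 ^ k * y^2 + 2 ^ -k\<close>, passing from squares to first powers.\<close>
      have "?y \<le> (2 * (?P * ?y) * 1) / ?P" by simp
      also have "\<dots> \<le> ((?P * ?y)\<^sup>2 + 1\<^sup>2) / ?P" by (intro divide_right_mono sum_squares_bound) simp
      also have "\<dots> = ?P * ?y\<^sup>2 + (1/2) ^ k" by (simp add: field_simps power2_eq_square power_one_over)
      finally show "norm ?y \<le> ?P * ?y\<^sup>2 + (1/2) ^ k" by simp
    qed auto
  qed
qed

definition psum :: "(nat \<Rightarrow> 'a \<Rightarrow> complex) \<Rightarrow> ell2 \<Rightarrow> nat \<Rightarrow> 'a \<Rightarrow> complex" where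
  "psum e a N x = (\<Sum>n<N. coord a n * e n x)"

section \<open>Riesz-Fischer and Parseval for an abstract orthonormal basis\<close>

locale ortho_l2 =
  fixes M :: "'a measure" and e :: "nat \<Rightarrow> 'a \<Rightarrow> complex"
  assumes e_l2: "e n \<in> l2 M"
    and e_ortho: "l2ip M (e n) (e m) = (if n = m then 1 else 0)"
    and e_complete: "u \<in> l2 M \<Longrightarrow> (\<And>n. l2ip M u (e n) = 0) \<Longrightarrow> AE x in M. u x = 0"
begin

lemma psum_l2: "psum e a N \<in> l2 M"
  unfolding psum_def[abs_def] by (intro l2_sum l2_scale e_l2)

lemma l2ip_psum_left: "w \<in> l2 M \<Longrightarrow> l2ip M (psum e a N) w = (\<Sum>n<N. coord a n * l2ip M (e n) w)"
  unfolding psum_def[abs_def] by (subst l2ip_sum_left) (auto simp: l2_scale e_l2 l2ip_scale_left)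

lemma l2ip_psum_e: "l2ip M (psum e a N) (e m) = (if m < N then coord a m else 0)"
  by (simp add: l2ip_psum_left e_l2 e_ortho if_distrib[of "(*) _"] cong: if_cong)

lemma sqn_psum_diff:
  assumes "K \<le> N"
  shows "sqn M (\<lambda>x. psum e a N x - psum e a K x) = (\<Sum>n\<in>{K..<N}. (cmod (coord a n))\<^sup>2)"
proof -
  have 1: "of_real (sqn M (psum e a N)) = (\<Sum>n<N. coord a n * cnj (coord a n))" for N
    unfolding l2ip_self[OF psum_l2, symmetric] l2ip_psum_left[OF psum_l2]
    by (intro sum.cong refl) (simp add: l2ip_commute[of M "e _"] l2ip_psum_e)
  have 2: "sqn M (psum e a N) = (\<Sum>n<N. (cmod (coord a n))\<^sup>2)" for N
    using 1[of N] unfolding complex_norm_square[symmetric] of_real_sum[symmetric] of_real_eq_iff .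
  have "l2ip M (psum e a N) (psum e a K) = cnj (\<Sum>n<K. coord a n * l2ip M (e n) (psum e a N))"
    by (subst l2ip_commute, subst l2ip_psum_left[OF psum_l2]) (rule refl)
  also have "\<dots> = (\<Sum>n<K. of_real ((cmod (coord a n))\<^sup>2))"
    using assms unfolding cnj_sum complex_norm_square
    by (intro sum.cong refl) (simp add: l2ip_commute[of M "e _"] l2ip_psum_e)
  finally have 3: "Re (l2ip M (psum e a N) (psum e a K)) = (\<Sum>n<K. (cmod (coord a n))\<^sup>2)"
    unfolding of_real_sum[symmetric] by simp
  have "sqn M (\<lambda>x. psum e a N x - psum e a K x) = (\<Sum>n<N. (cmod (coord a n))\<^sup>2) - (\<Sum>n<K. (cmod (coord a n))\<^sup>2)"
    unfolding sqn_diff[OF psum_l2 psum_l2] 2 3 by simp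
  also have "\<dots> = (\<Sum>n\<in>{K..<N}. (cmod (coord a n))\<^sup>2)"
    using sum_diff_nat_ivl[of 0 K N "\<lambda>n. (cmod (coord a n))\<^sup>2"] assms by (simp add: lessThan_atLeast0)
  finally show ?thesis .
qed

text \<open>Partial sums are Cauchy in mean square; along a subsequence with squared increments at
  most \<open>4 ^ -k\<close> they converge almost everywhere, and Fatou bounds the distance to the
  limit by the tail. The subsequence and the pointwise \<open>lim\<close> appear in the statement so
  that \<open>fn\<close> can be defined by that very formula.\<close>

lemma Riesz_Fischer:
  "\<exists>r. strict_mono r \<and> (\<lambda>x. lim (\<lambda>k. psum e a (r k) x)) \<in> l2 M \<and>
     (\<lambda>k. sqn M (\<lambda>x. lim (\<lambda>k. psum e a (r k) x) - psum e a (r k) x)) \<longlonglongrightarrow> 0"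
proof -
  define tail where "tail N = (norm a)\<^sup>2 - (\<Sum>n<N. (cmod (coord a n))\<^sup>2)" for N
  have "tail \<longlonglongrightarrow> (norm a)\<^sup>2 - (norm a)\<^sup>2"
    unfolding tail_def norm_square_ell2 by (intro tendsto_diff tendsto_const summable_LIMSEQ summable_coord)
  then have tail0: "tail \<longlonglongrightarrow> 0" by simp
  have seg: "sqn M (\<lambda>x. psum e a N x - psum e a K x) \<le> tail K" if "K \<le> N" for K N
  proof -
    have "sqn M (\<lambda>x. psum e a N x - psum e a K x) = (\<Sum>n<N. (cmod (coord a n))\<^sup>2) - (\<Sum>n<K. (cmod (coord a n))\<^sup>2)"
      unfolding sqn_psum_diff[OF that]
      using sum_diff_nat_ivl[of 0 K N "\<lambda>n. (cmod (coord a n))\<^sup>2"] that by (simp add: lessThan_atLeast0)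
    moreover have "(\<Sum>n<N. (cmod (coord a n))\<^sup>2) \<le> (norm a)\<^sup>2"
      unfolding norm_square_ell2 by (rule sum_le_suminf[OF summable_coord]) auto
    ultimately show ?thesis by (simp add: tail_def)
  qed
  have "\<forall>k. \<exists>N. \<forall>n\<ge>N. tail n < (1/4) ^ k"
    using order_tendstoD(2)[OF tail0] unfolding eventually_sequentially by (meson zero_less_divide_1_iff zero_less_numeral zero_less_power)
  from choice[OF this] obtain h where h: "\<forall>k. \<forall>n\<ge>h k. tail n < (1/4) ^ k" by (elim exE)
  define r where "r = rec_nat (h 0) (\<lambda>k x. max (h (Suc k)) (Suc x))"
  have r: "strict_mono r" by (rule strict_monoI_Suc) (simp add: r_def)
  have hr: "h k \<le> r k" for k by (cases k) (auto simp: r_def)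
  have tr: "tail (r k) \<le> (1/4) ^ k" for k using h hr[of k] by (auto intro: less_imp_le)
  define S where "S k = psum e a (r k)" for k
  have Sl: "S k \<in> l2 M" for k unfolding S_def by (rule psum_l2)
  have [measurable]: "S k \<in> borel_measurable M" for k using Sl by (rule l2_measurable)
  define u where "u x = lim (\<lambda>k. S k x)" for x
  have [measurable]: "u \<in> borel_measurable M" unfolding u_def by measurable
  have rmono: "r k \<le> r j" if "k \<le> j" for k j using r that by (simp add: strict_mono_less_eq)
  have "AE x in M. summable (\<lambda>k. cmod (S (Suc k) x - S k x))"
  proof (rule AE_summable_of_sqn)
    fix k
    show "(\<lambda>x. S (Suc k) x - S k x) \<in> l2 M" by (intro l2_diff Sl)
    have "sqn M (\<lambda>x. S (Suc k) x - S k x) \<le> tail (r k)"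
      unfolding S_def by (intro seg rmono) simp
    then show "sqn M (\<lambda>x. S (Suc k) x - S k x) \<le> (1/4) ^ k" using tr[of k] by linarith
  qed
  then have conv: "AE x in M. (\<lambda>k. S k x) \<longlonglongrightarrow> u x"
  proof eventually_elim
    case (elim x)
    have "convergent (\<lambda>k. \<Sum>j<k. (S (Suc j) x - S j x))"
      using summable_norm_cancel[OF elim] by (simp add: summable_iff_convergent)
    then have "convergent (\<lambda>k. S k x - S 0 x)" by (simp add: sum_lessThan_telescope[of "\<lambda>j. S j x"])
    then have "convergent (\<lambda>k. (S k x - S 0 x) + S 0 x)" by (intro convergent_add convergent_const)
    then show ?case unfolding u_def by (simp add: convergent_LIMSEQ_iff)
  qed
  have nn: "(\<integral>\<^sup>+x. ennreal ((cmod (u x - S k x))\<^sup>2) \<partial>M) \<le> ennreal (tail (r k))" for k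
  proof -
    have "(\<integral>\<^sup>+x. ennreal ((cmod (u x - S k x))\<^sup>2) \<partial>M) = (\<integral>\<^sup>+x. liminf (\<lambda>j. ennreal ((cmod (S j x - S k x))\<^sup>2)) \<partial>M)"
    proof (rule nn_integral_cong_AE)
      show "AE x in M. ennreal ((cmod (u x - S k x))\<^sup>2) = liminf (\<lambda>j. ennreal ((cmod (S j x - S k x))\<^sup>2))"
        using conv
      proof eventually_elim
        case (elim x)
        have "(\<lambda>j. ennreal ((cmod (S j x - S k x))\<^sup>2)) \<longlonglongrightarrow> ennreal ((cmod (u x - S k x))\<^sup>2)"
          by (intro tendsto_ennrealI tendsto_intros elim)
        then show ?case by (rule lim_imp_Liminf[symmetric, rotated]) simp
      qed
    qed
    also have "\<dots> \<le> liminf (\<lambda>j. \<integral>\<^sup>+x. ennreal ((cmod (S j x - S k x))\<^sup>2) \<partial>M)"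
      by (rule nn_integral_liminf) measurable
    also have "\<dots> \<le> ennreal (tail (r k))"
    proof (rule Liminf_le)
      show "\<forall>\<^sub>F j in sequentially. (\<integral>\<^sup>+x. ennreal ((cmod (S j x - S k x))\<^sup>2) \<partial>M) \<le> ennreal (tail (r k))"
        using eventually_ge_at_top[of k]
      proof eventually_elim
        case (elim j)
        have "(\<integral>\<^sup>+x. ennreal ((cmod (S j x - S k x))\<^sup>2) \<partial>M) = ennreal (sqn M (\<lambda>x. S j x - S k x))"
          unfolding sqn_def using l2_diff[OF Sl Sl, of j k] by (intro nn_integral_eq_integral) (auto simp: l2_def)
        also have "\<dots> \<le> ennreal (tail (r k))"
          unfolding S_def by (intro ennreal_leI seg rmono elim)
        finally show ?case .
      qed
    qed simp
    finally show ?thesis .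
  qed
  have dl: "(\<lambda>x. u x - S k x) \<in> l2 M" for k
  proof -
    have "integrable M (\<lambda>x. (cmod (u x - S k x))\<^sup>2)"
      using nn[of k] by (intro integrableI_bounded) (auto intro: le_less_trans[OF _ ennreal_less_top])
    then show ?thesis by (simp add: l2_def)
  qed
  have ul: "u \<in> l2 M" using l2_add[OF dl Sl, of 0 0] by simp
  have le: "sqn M (\<lambda>x. u x - S k x) \<le> tail (r k)" for k
  proof -
    have "ennreal (sqn M (\<lambda>x. u x - S k x)) \<le> ennreal (tail (r k))"
      using nn[of k] dl[of k] unfolding sqn_def by (subst nn_integral_eq_integral[symmetric]) (auto simp: l2_def)
    moreover have "0 \<le> tail (r k)" using order_trans[OF sqn_nonneg seg[OF order_refl]] .
    ultimately show ?thesis by (simp add: ennreal_le_iff)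
  qed
  have t0: "(\<lambda>k. tail (r k)) \<longlonglongrightarrow> 0" using LIMSEQ_subseq_LIMSEQ[OF tail0 r] by (simp add: comp_def)
  have "(\<lambda>k. sqn M (\<lambda>x. u x - S k x)) \<longlonglongrightarrow> 0"
    by (rule tendsto_sandwich[OF always_eventually always_eventually tendsto_const t0])
      (intro allI sqn_nonneg, intro allI le)
  then show ?thesis using r ul unfolding u_def S_def by (intro exI[of _ r] conjI)
qed

text \<open>Taking the pointwise limit over the whole type, not just over \<open>space M\<close>, lets symmetries of
  the functions \<open>e n\<close> such as periodicity pass to \<open>fn a\<close>.\<close>
definition fn :: "ell2 \<Rightarrow> 'a \<Rightarrow> complex" where
  "fn a = (let r = SOME r. strict_mono r \<and> (\<lambda>x. lim (\<lambda>k. psum e a (r k) x)) \<in> l2 M \<and>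
     (\<lambda>k. sqn M (\<lambda>x. lim (\<lambda>k. psum e a (r k) x) - psum e a (r k) x)) \<longlonglongrightarrow> 0
   in (\<lambda>x. lim (\<lambda>k. psum e a (r k) x)))"

lemma fn_props:
  obtains r where "strict_mono r" "fn a = (\<lambda>x. lim (\<lambda>k. psum e a (r k) x))" "fn a \<in> l2 M"
    "(\<lambda>k. sqn M (\<lambda>x. fn a x - psum e a (r k) x)) \<longlonglongrightarrow> 0"
  using someI_ex[OF Riesz_Fischer[of a]] unfolding fn_def Let_def by blast

lemma fn_l2: "fn a \<in> l2 M"
  by (rule fn_props)

lemma fn_coef: "l2ip M (fn a) (e n) = coord a n"
proof -
  obtain r where r: "strict_mono r" "(\<lambda>k. sqn M (\<lambda>x. fn a x - psum e a (r k) x)) \<longlonglongrightarrow> 0"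
    by (rule fn_props)
  have "(\<lambda>k. l2ip M (psum e a (r k)) (e n)) \<longlonglongrightarrow> l2ip M (fn a) (e n)"
    by (rule l2ip_tendsto[OF psum_l2 fn_l2 e_l2 r(2)])
  moreover have "(\<lambda>k. l2ip M (psum e a (r k)) (e n)) \<longlonglongrightarrow> coord a n"
  proof (rule tendsto_eventually)
    show "\<forall>\<^sub>F k in sequentially. l2ip M (psum e a (r k)) (e n) = coord a n"
      using eventually_gt_at_top[of n]
    proof eventually_elim
      case (elim k)
      then show ?case using seq_suble[OF r(1), of k] by (simp add: l2ip_psum_e)
    qed
  qed
  ultimately show ?thesis by (rule LIMSEQ_unique)
qed

definition vec :: "('a \<Rightarrow> complex) \<Rightarrow> ell2" where
  "vec u = Ell2 (\<lambda>n. l2ip M u (e n))"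

text \<open>The content is Bessel's inequality, which makes the coefficients square-summable so that
  \<open>Ell2\<close> returns them unchanged. It comes from the nonnegative squared distance of
  \<open>u\<close> to its partial sums.\<close>

lemma coord_vec: "u \<in> l2 M \<Longrightarrow> coord (vec u) n = l2ip M u (e n)"
proof -
  assume u: "u \<in> l2 M"
  have "summable (\<lambda>n. (cmod (l2ip M u (e n)))\<^sup>2)"
  proof (rule summableI_nonneg_bounded)
    fix N
    define t where "t = (\<Sum>n<N. l2ip M u (e n) *\<^sub>C delta n)"
    have ct: "coord t n = (if n < N then l2ip M u (e n) else 0)" for n
      unfolding t_def by (simp add: if_distrib[of "(*) _"] cong: if_cong)
    have 1: "l2ip M u (psum e t N) = of_real (\<Sum>n<N. (cmod (l2ip M u (e n)))\<^sup>2)"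
      unfolding l2ip_commute[of M u "psum e t N"] l2ip_psum_left[OF u] of_real_sum cnj_sum complex_norm_square
      by (intro sum.cong refl) (simp add: ct l2ip_commute[of M "e _" u])
    have 2: "sqn M (psum e t N) = (\<Sum>n<N. (cmod (l2ip M u (e n)))\<^sup>2)"
    proof -
      have "sqn M (\<lambda>x. psum e t N x - psum e t 0 x) = (\<Sum>n\<in>{0..<N}. (cmod (coord t n))\<^sup>2)"
        by (rule sqn_psum_diff) simp
      then show ?thesis by (simp add: psum_def[abs_def] ct lessThan_atLeast0)
    qed
    have "0 \<le> sqn M (\<lambda>x. u x - psum e t N x)" by (rule sqn_nonneg)
    then show "(\<Sum>n<N. (cmod (l2ip M u (e n)))\<^sup>2) \<le> sqn M u"
      unfolding sqn_diff[OF u psum_l2] 1 2 by simp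
  qed simp
  then show ?thesis by (simp add: vec_def coord_Ell2)
qed

lemma vec_fn: "vec (fn a) = a"
  by (rule ell2_eqI) (simp add: coord_vec fn_l2 fn_coef)

lemma vec_eq_iff:
  assumes "u \<in> l2 M" "v \<in> l2 M"
  shows "vec u = vec v \<longleftrightarrow> (AE x in M. u x = v x)"
proof
  assume eq: "vec u = vec v"
  have "AE x in M. u x - v x = 0"
  proof (rule e_complete)
    show "(\<lambda>x. u x - v x) \<in> l2 M" using assms by (rule l2_diff)
    show "l2ip M (\<lambda>x. u x - v x) (e n) = 0" for n
      using assms arg_cong[OF eq, of "\<lambda>a. coord a n"] by (simp add: l2ip_diff_left e_l2 coord_vec)
  qed
  then show "AE x in M. u x = v x" by simp
next
  assume ae: "AE x in M. u x = v x"
  show "vec u = vec v"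
  proof (rule ell2_eqI)
    fix n
    have [measurable]: "u \<in> borel_measurable M" "v \<in> borel_measurable M" "e n \<in> borel_measurable M"
      using assms e_l2 by (auto simp: l2_def)
    have "l2ip M u (e n) = l2ip M v (e n)"
      unfolding l2ip_def by (rule integral_cong_AE) (use ae in auto)
    then show "coord (vec u) n = coord (vec v) n" using assms by (simp add: coord_vec)
  qed
qed

lemma fn_vec: "u \<in> l2 M \<Longrightarrow> AE x in M. fn (vec u) x = u x"
  using vec_eq_iff[OF fn_l2, of u "vec u"] by (simp add: vec_fn)

text \<open>Along the subsequence on which the partial sums converge to \<open>fn (vec u)\<close>,
  both sides are limits of the same finite sums.\<close>

lemma parseval:
  assumes "u \<in> l2 M" "v \<in> l2 M"
  shows "l2ip M u v = ip (vec u) (vec v)"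
proof -
  have [measurable]: "u \<in> borel_measurable M" "v \<in> borel_measurable M" "fn (vec u) \<in> borel_measurable M"
    using assms fn_l2 by (auto simp: l2_def)
  obtain r where r: "strict_mono r" "(\<lambda>k. sqn M (\<lambda>x. fn (vec u) x - psum e (vec u) (r k) x)) \<longlonglongrightarrow> 0"
    by (rule fn_props)
  have "(\<lambda>k. l2ip M (psum e (vec u) (r k)) v) \<longlonglongrightarrow> l2ip M (fn (vec u)) v"
    by (rule l2ip_tendsto[OF psum_l2 fn_l2 assms(2) r(2)])
  moreover have "l2ip M (fn (vec u)) v = l2ip M u v"
    unfolding l2ip_def by (rule integral_cong_AE) (use fn_vec[OF assms(1)] in auto)
  moreover have "l2ip M (psum e (vec u) N) v = (\<Sum>n<N. coord (vec u) n * cnj (coord (vec v) n))" for N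
    using assms by (simp add: l2ip_psum_left coord_vec l2ip_commute[of M "e _" v])
  ultimately have "(\<lambda>k. \<Sum>n<r k. coord (vec u) n * cnj (coord (vec v) n)) \<longlonglongrightarrow> l2ip M u v" by simp
  moreover have "(\<lambda>k. \<Sum>n<r k. coord (vec u) n * cnj (coord (vec v) n)) \<longlonglongrightarrow> ip (vec u) (vec v)"
    using LIMSEQ_subseq_LIMSEQ[OF summable_LIMSEQ[OF summable_ip] r(1)] by (simp add: comp_def ip_def)
  ultimately show ?thesis by (rule LIMSEQ_unique)
qed

lemma vec_add: "u \<in> l2 M \<Longrightarrow> v \<in> l2 M \<Longrightarrow> vec (\<lambda>x. u x + v x) = vec u + vec v"
  by (rule ell2_eqI) (simp add: coord_vec l2_add l2ip_add_left e_l2)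

lemma vec_scale: "u \<in> l2 M \<Longrightarrow> vec (\<lambda>x. c * u x) = c *\<^sub>C vec u"
  by (rule ell2_eqI) (simp add: coord_vec l2_scale l2ip_scale_left)

lemma vec_sum: "(\<And>i. i \<in> I \<Longrightarrow> f i \<in> l2 M) \<Longrightarrow> vec (\<lambda>x. \<Sum>i\<in>I. f i x) = (\<Sum>i\<in>I. vec (f i))"
  by (rule ell2_eqI) (simp add: coord_vec l2_sum l2ip_sum_left e_l2)

lemma vec_zero: "vec (\<lambda>x. 0) = 0"
  by (rule ell2_eqI) (simp add: coord_vec l2_zero l2ip_def)

end

section \<open>Fourier series on the torus\<close>

text \<open>Sublevel sets of \<open>frac\<close> are arcs of the circle, so their indicators are bounded limits of
  trigonometric polynomials.\<close>
lemma frac_le_iff_cos: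
  fixes t s :: real
  assumes "0 \<le> s" "s < 1"
  shows "frac t \<le> s \<longleftrightarrow> cos (pi * s) \<le> cos (2 * pi * t - pi * s)"
proof -
  have "cos (2 * pi * t - pi * s) = cos (2 * pi * frac t - pi * s)"
  proof -
    have "2 * pi * t - pi * s = (2 * pi * frac t - pi * s) + 2 * pi * of_int \<lfloor>t\<rfloor>"
      by (simp add: frac_def algebra_simps)
    then show ?thesis by (simp only: cos_add cos_int_2pin sin_int_2pin)
  qed
  moreover have "frac t \<le> s \<longleftrightarrow> cos (pi * s) \<le> cos (2 * pi * frac t - pi * s)"
  proof
    assume le: "frac t \<le> s"
    have "\<bar>2 * pi * frac t - pi * s\<bar> \<le> pi * s"
    proof -
      have "pi * frac t \<le> pi * s" using le by (rule mult_left_mono) simp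
      moreover have "0 \<le> pi * frac t" by (rule mult_nonneg_nonneg) simp_all
      ultimately show ?thesis by linarith
    qed
    moreover have "pi * s \<le> pi" using assms by simp
    ultimately have "cos (pi * s) \<le> cos \<bar>2 * pi * frac t - pi * s\<bar>"
      by (intro cos_monotone_0_pi_le) auto
    then show "cos (pi * s) \<le> cos (2 * pi * frac t - pi * s)" by simp
  next
    assume c: "cos (pi * s) \<le> cos (2 * pi * frac t - pi * s)"
    show "frac t \<le> s"
    proof (rule ccontr)
      assume "\<not> frac t \<le> s"
      then have gt: "pi * s < pi * frac t" by simp
      \<comment> \<open>Here \<open>\<phi>\<close> lies strictly between \<open>pi * s\<close> and
        \<open>2 * pi - pi * s\<close>, where the cosine is below
        \<open>cos (pi * s)\<close>.\<close>
      define \<phi> where "\<phi> = 2 * pi * frac t - pi * s"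
      have lt: "pi * frac t < pi" using frac_lt_1[of t] by simp
      have s0: "0 \<le> pi * s" using assms by simp
      have "cos \<phi> < cos (pi * s)"
      proof (cases "\<phi> \<le> pi")
        case True
        then show ?thesis using gt s0 by (intro cos_monotone_0_pi) (auto simp: \<phi>_def)
      next
        case False
        then have "cos (2 * pi - \<phi>) < cos (pi * s)"
          using lt s0 by (intro cos_monotone_0_pi) (auto simp: \<phi>_def)
        then show ?thesis by (simp add: cos_diff)
      qed
      then show False using c by (simp add: \<phi>_def)
    qed
  qed
  ultimately show ?thesis by simp
qed

definition cell :: "(real ^ 'd) set \<Rightarrow> (real ^ 'd) measure" where
  "cell \<Gamma> = restrict_space lebesgue (voronoi_cell \<Gamma>)"

section \<open>Exponentials on the torus and their completeness\<close>

context lattice_basis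
begin

interpretation recip: lattice_basis "\<lambda>i. (2 * pi) *\<^sub>R b i" "\<lambda>i. (1 / (2 * pi)) *\<^sub>R a i" "dual_lattice \<Gamma>"
  by (rule dual_lattice_basis)

abbreviation "F \<equiv> voronoi_cell \<Gamma>"

lemma lint_cell: "(LINT x:F|lebesgue. f x) = (\<integral>x. f x \<partial>cell \<Gamma>)" for f :: "real ^ 'd \<Rightarrow> 'b::{banach, second_countable_topology}"
  unfolding cell_def set_lebesgue_integral_def by (rule integral_restrict_space[symmetric]) simp

lemma AE_cell: "(AE x in cell \<Gamma>. P x) \<longleftrightarrow> (AE x in lebesgue. x \<in> F \<longrightarrow> P x)"
  unfolding cell_def by (rule AE_restrict_space_iff) simp

lemma measurable_cell: "f \<in> borel_measurable lebesgue \<Longrightarrow> f \<in> borel_measurable (cell \<Gamma>)"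
  unfolding cell_def by (rule measurable_restrict_space1)

lemma measurable_cell_borel: "f \<in> borel_measurable borel \<Longrightarrow> f \<in> borel_measurable (cell \<Gamma>)"
  by (intro measurable_cell measurable_completion) simp

lemma space_cell: "space (cell \<Gamma>) = F"
  by (simp add: cell_def space_restrict_space)

lemma measure_cell: "measure (cell \<Gamma>) F = measure lebesgue F"
  unfolding cell_def by (rule measure_restrict_space) auto

lemma finite_measure_cell: "finite_measure (cell \<Gamma>)"
proof
  have "emeasure lebesgue F < \<infinity>"
    using lmeasurable_compact[OF compact_voronoi] by (simp add: fmeasurable_def)
  then show "emeasure (cell \<Gamma>) (space (cell \<Gamma>)) \<noteq> \<infinity>"
    unfolding space_cell unfolding cell_def by (subst emeasure_restrict_space) auto
qed

lemma integrable_cell_bounded: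
  fixes f :: "real ^ 'd \<Rightarrow> 'b::{banach, second_countable_topology}"
  assumes "f \<in> borel_measurable (cell \<Gamma>)" "\<And>x. norm (f x) \<le> C"
  shows "integrable (cell \<Gamma>) f"
  by (rule finite_measure.integrable_const_bound[OF finite_measure_cell, of _ C]) (use assms in auto)

lemma l2_bounded:
  assumes "f \<in> borel_measurable (cell \<Gamma>)" "\<And>x. cmod (f x) \<le> C"
  shows "f \<in> l2 (cell \<Gamma>)"
proof -
  have [measurable]: "f \<in> borel_measurable (cell \<Gamma>)" by fact
  have "integrable (cell \<Gamma>) (\<lambda>x. (cmod (f x))\<^sup>2)"
  proof (rule integrable_cell_bounded)
    show "norm ((cmod (f x))\<^sup>2) \<le> C\<^sup>2" for x using assms(2)[of x] by (simp add: power_mono)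
  qed measurable
  then show ?thesis using assms(1) unfolding l2_def by blast
qed

lemma l2_integrable_cell: "u \<in> l2 (cell \<Gamma>) \<Longrightarrow> integrable (cell \<Gamma>) u"
proof -
  assume u: "u \<in> l2 (cell \<Gamma>)"
  have "(\<lambda>_. 1) \<in> l2 (cell \<Gamma>)" by (rule l2_bounded[of _ 1]) auto
  from l2_integrable_mult[OF u this] show ?thesis by simp
qed

definition vol :: real where "vol = measure lebesgue F"

lemma vol_pos: "0 < vol"
  unfolding vol_def by (rule measure_voronoi_pos)

definition freq :: "nat \<Rightarrow> real ^ 'd" where "freq = from_nat_into (dual_lattice \<Gamma>)"

lemma infinite_dual: "infinite (dual_lattice \<Gamma>)"
proof
  assume fin: "finite (dual_lattice \<Gamma>)"
  obtain i :: 'd where True by simp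
  have mem: "of_nat n *\<^sub>R ((2 * pi) *\<^sub>R b i) \<in> dual_lattice \<Gamma>" for n :: nat
    unfolding recip.mem_iff using dual by (simp add: inner_commute)
  have "inj (\<lambda>n :: nat. of_nat n *\<^sub>R ((2 * pi) *\<^sub>R b i))"
  proof (rule injI)
    fix n k :: nat assume eq: "of_nat n *\<^sub>R ((2 * pi) *\<^sub>R b i) = of_nat k *\<^sub>R ((2 * pi) *\<^sub>R b i)"
    have "b i \<noteq> 0" using dual[of i i] by auto
    then show "n = k" using eq by simp
  qed
  then have "infinite (range (\<lambda>n :: nat. of_nat n *\<^sub>R ((2 * pi) *\<^sub>R b i)))" by (rule range_inj_infinite)
  moreover have "range (\<lambda>n :: nat. of_nat n *\<^sub>R ((2 * pi) *\<^sub>R b i)) \<subseteq> dual_lattice \<Gamma>" using mem by blast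
  ultimately show False using fin finite_subset by blast
qed

lemma bij_freq: "bij_betw freq UNIV (dual_lattice \<Gamma>)"
  unfolding freq_def by (rule bij_betw_from_nat_into[OF recip.countable_lattice infinite_dual])

lemma freq_mem: "freq n \<in> dual_lattice \<Gamma>"
  using bij_freq by (auto simp: bij_betw_def)

lemma freq_eq_iff: "freq n = freq m \<longleftrightarrow> n = m"
  using bij_freq by (auto simp: bij_betw_def inj_eq)

lemma freq_surj: "\<xi> \<in> dual_lattice \<Gamma> \<Longrightarrow> \<exists>n. \<xi> = freq n"
  using bij_freq by (auto simp: bij_betw_def)

lemma finite_freq: "finite {n. norm (freq n) \<le> R}"
proof -
  have "finite {X \<in> dual_lattice \<Gamma>. norm X \<le> R}" by (rule recip.finite_lattice_ball)
  then have "finite (freq -` {X \<in> dual_lattice \<Gamma>. norm X \<le> R})"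
    using bij_freq by (intro finite_vimageI) (auto simp: bij_betw_def)
  moreover have "{n. norm (freq n) \<le> R} \<subseteq> freq -` {X \<in> dual_lattice \<Gamma>. norm X \<le> R}" using freq_mem by auto
  ultimately show ?thesis by (rule rev_finite_subset)
qed

lemma cis_periodic: "\<xi> \<in> dual_lattice \<Gamma> \<Longrightarrow> X \<in> \<Gamma> \<Longrightarrow> cis (\<xi> \<bullet> (x + X)) = cis (\<xi> \<bullet> x)"
proof -
  assume "\<xi> \<in> dual_lattice \<Gamma>" "X \<in> \<Gamma>"
  then obtain n :: int where n: "\<xi> \<bullet> X = 2 * pi * of_int n" by (auto simp: dual_lattice_def)
  have "cis (2 * pi * of_int n) = 1"
    by (rule complex_eqI) (simp_all only: cis.sel cos_int_2pin sin_int_2pin one_complex.sel)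
  then show ?thesis by (simp add: inner_add_right n cis_mult[symmetric])
qed

lemma continuous_cis: "continuous_on UNIV (\<lambda>x. cis (\<xi> \<bullet> x))"
  unfolding cis_conv_exp by (intro continuous_intros)

lemma cis_measurable [measurable]: "(\<lambda>x. cis (\<xi> \<bullet> x)) \<in> borel_measurable borel"
  by (rule borel_measurable_continuous_onI[OF continuous_cis])

lemma integral_cis:
  assumes "\<xi> \<in> dual_lattice \<Gamma>"
  shows "(\<integral>x. cis (\<xi> \<bullet> x) \<partial>cell \<Gamma>) = (if \<xi> = 0 then of_real vol else 0)"
proof (cases "\<xi> = 0")
  case True
  have "(\<integral>x. cis (\<xi> \<bullet> x) \<partial>cell \<Gamma>) = (\<integral>x. 1 \<partial>cell \<Gamma>)" using True by simp
  also have "\<dots> = of_real (measure (cell \<Gamma>) (space (cell \<Gamma>)))" by (simp add: scaleR_conv_of_real)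
  finally show ?thesis using True by (simp add: space_cell measure_cell vol_def)
next
  case False
  \<comment> \<open>Chosen so that \<open>\<xi> \<bullet> y = pi\<close>: translation by
    \<open>y\<close> flips the sign of the exponential but leaves its integral unchanged.\<close>
  define y where "y = (pi / (\<xi> \<bullet> \<xi>)) *\<^sub>R \<xi>"
  have "\<xi> \<bullet> y = pi" using False by (simp add: y_def)
  then have cy: "cis (\<xi> \<bullet> (x + y)) = - cis (\<xi> \<bullet> x)" for x
    by (simp add: inner_add_right cis_mult[symmetric])
  have "(LINT x:F|lebesgue. cis (\<xi> \<bullet> (x + y))) = (LINT x:F|lebesgue. cis (\<xi> \<bullet> x))"
    by (rule voronoi_integral_translate[OF continuous_cis]) (rule cis_periodic[OF assms])
  then have "- (\<integral>x. cis (\<xi> \<bullet> x) \<partial>cell \<Gamma>) = (\<integral>x. cis (\<xi> \<bullet> x) \<partial>cell \<Gamma>)"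
    unfolding lint_cell cy by simp
  then show ?thesis using False by simp
qed

definition wave :: "nat \<Rightarrow> real ^ 'd \<Rightarrow> complex" where
  "wave n x = of_real (1 / sqrt vol) * cis (freq n \<bullet> x)"

lemma wave_periodic: "X \<in> \<Gamma> \<Longrightarrow> wave n (x + X) = wave n x"
  unfolding wave_def by (simp add: cis_periodic freq_mem)

lemma wave_measurable [measurable]: "wave n \<in> borel_measurable borel"
  unfolding wave_def[abs_def] by measurable

lemma norm_wave: "cmod (wave n x) = 1 / sqrt vol"
  using vol_pos by (simp add: wave_def norm_divide)

lemma wave_l2: "wave n \<in> l2 (cell \<Gamma>)"
  by (rule l2_bounded[of _ "1 / sqrt vol"]) (auto intro: measurable_cell_borel simp: norm_wave)

lemma wave_mult_cnj: "wave n x * cnj (wave m x) = of_real (1 / vol) * cis ((freq n - freq m) \<bullet> x)"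
proof -
  define c where "c = complex_of_real (1 / sqrt vol)"
  have cc: "c * c = of_real (1 / vol)"
    using vol_pos by (simp add: c_def flip: of_real_mult)
  have "wave n x * cnj (wave m x) = (c * cis (freq n \<bullet> x)) * (c * cis (- (freq m \<bullet> x)))"
    by (simp only: wave_def c_def complex_cnj_mult complex_cnj_complex_of_real cis_cnj)
  also have "\<dots> = (c * c) * (cis (freq n \<bullet> x) * cis (- (freq m \<bullet> x)))" by (simp only: mult_ac)
  finally show ?thesis by (simp only: cc cis_mult inner_diff_left add_uminus_conv_diff)
qed

lemma wave_ortho: "l2ip (cell \<Gamma>) (wave n) (wave m) = (if n = m then 1 else 0)"
  unfolding l2ip_def wave_mult_cnj using vol_pos
  by (simp add: integral_cis recip.diff_mem freq_mem freq_eq_iff)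

text \<open>Completeness of the exponentials: if \<open>u\<close> is orthogonal to all of them, the weights \<open>h\<close> below
  include \<open>1\<close> and are closed under multiplication by \<open>cos (\<eta> \<bullet> x - \<theta>)\<close> and under bounded
  limits, hence exhaust the indicators of periodic Borel sets.\<close>
definition good :: "(real ^ 'd \<Rightarrow> complex) \<Rightarrow> (real ^ 'd \<Rightarrow> real) \<Rightarrow> bool" where
  "good u h \<longleftrightarrow> h \<in> borel_measurable borel \<and> (\<exists>C. \<forall>x. \<bar>h x\<bar> \<le> C) \<and>
     (\<forall>\<xi>\<in>dual_lattice \<Gamma>. (\<integral>x. u x * of_real (h x) * cis (\<xi> \<bullet> x) \<partial>cell \<Gamma>) = 0)"

context
  fixes u :: "real ^ 'd \<Rightarrow> complex"
  assumes u: "u \<in> l2 (cell \<Gamma>)"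
begin

lemma u_meas [measurable]: "u \<in> borel_measurable (cell \<Gamma>)"
  using u by (rule l2_measurable)

lemma good_integrable:
  assumes "h \<in> borel_measurable borel" "\<And>x. \<bar>h x\<bar> \<le> C"
  shows "integrable (cell \<Gamma>) (\<lambda>x. u x * of_real (h x) * cis (\<xi> \<bullet> x))"
proof (rule Bochner_Integration.integrable_bound)
  have [measurable]: "h \<in> borel_measurable (cell \<Gamma>)" "(\<lambda>x. cis (\<xi> \<bullet> x)) \<in> borel_measurable (cell \<Gamma>)"
    using assms(1) by (auto intro: measurable_cell_borel)
  show "(\<lambda>x. u x * of_real (h x) * cis (\<xi> \<bullet> x)) \<in> borel_measurable (cell \<Gamma>)" by measurable
  show "integrable (cell \<Gamma>) (\<lambda>x. of_real C * u x)" using l2_integrable_cell[OF u] by simp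
  show "AE x in cell \<Gamma>. norm (u x * of_real (h x) * cis (\<xi> \<bullet> x)) \<le> norm (complex_of_real C * u x)"
  proof (rule AE_I2)
    fix x
    have "\<bar>h x\<bar> \<le> \<bar>C\<bar>" using assms(2)[of x] by linarith
    then show "norm (u x * of_real (h x) * cis (\<xi> \<bullet> x)) \<le> norm (complex_of_real C * u x)"
      by (simp add: norm_mult mult.commute mult_right_mono)
  qed
qed

lemma good_add: "good u h \<Longrightarrow> good u g \<Longrightarrow> good u (\<lambda>x. h x + g x)"
proof -
  assume hg: "good u h" "good u g"
  then obtain C D where C: "\<And>x. \<bar>h x\<bar> \<le> C" and D: "\<And>x. \<bar>g x\<bar> \<le> D" by (auto simp: good_def)
  have m: "h \<in> borel_measurable borel" "g \<in> borel_measurable borel" using hg by (auto simp: good_def)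
  have "(\<integral>x. u x * of_real (h x + g x) * cis (\<xi> \<bullet> x) \<partial>cell \<Gamma>) = 0" if "\<xi> \<in> dual_lattice \<Gamma>" for \<xi>
  proof -
    have "(\<integral>x. u x * of_real (h x + g x) * cis (\<xi> \<bullet> x) \<partial>cell \<Gamma>)
        = (\<integral>x. u x * of_real (h x) * cis (\<xi> \<bullet> x) + u x * of_real (g x) * cis (\<xi> \<bullet> x) \<partial>cell \<Gamma>)"
      by (simp add: algebra_simps)
    also have "\<dots> = (\<integral>x. u x * of_real (h x) * cis (\<xi> \<bullet> x) \<partial>cell \<Gamma>) + (\<integral>x. u x * of_real (g x) * cis (\<xi> \<bullet> x) \<partial>cell \<Gamma>)"
      by (rule Bochner_Integration.integral_add[OF good_integrable[OF m(1) C] good_integrable[OF m(2) D]])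
    finally show ?thesis using hg that by (simp add: good_def)
  qed
  moreover have "\<bar>h x + g x\<bar> \<le> C + D" for x using C[of x] D[of x] by linarith
  ultimately show ?thesis using m by (auto simp: good_def)
qed

lemma good_scale: "good u h \<Longrightarrow> good u (\<lambda>x. h x * c)"
proof -
  assume h: "good u h"
  then obtain C where C: "\<And>x. \<bar>h x\<bar> \<le> C" by (auto simp: good_def)
  have "(\<integral>x. u x * of_real (h x * c) * cis (\<xi> \<bullet> x) \<partial>cell \<Gamma>) = 0" if "\<xi> \<in> dual_lattice \<Gamma>" for \<xi>
  proof -
    have "(\<integral>x. u x * of_real (h x * c) * cis (\<xi> \<bullet> x) \<partial>cell \<Gamma>) = (\<integral>x. of_real c * (u x * of_real (h x) * cis (\<xi> \<bullet> x)) \<partial>cell \<Gamma>)"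
      by (simp add: mult_ac)
    then show ?thesis using h that by (simp add: good_def)
  qed
  moreover have "\<bar>h x * c\<bar> \<le> C * \<bar>c\<bar>" for x using C[of x] by (simp add: abs_mult mult_right_mono)
  moreover have "(\<lambda>x. h x * c) \<in> borel_measurable borel"
  proof -
    have [measurable]: "h \<in> borel_measurable borel" using h by (simp add: good_def)
    show ?thesis by measurable
  qed
  ultimately show ?thesis by (auto simp: good_def)
qed

text \<open>The cosine is a combination of two exponentials, and multiplying by these only shifts
  the test frequency by \<open>\<eta>\<close> or \<open>- \<eta>\<close> within the dual
  lattice.\<close>

lemma good_mult_cos:
  assumes "good u h" "\<eta> \<in> dual_lattice \<Gamma>"
  shows "good u (\<lambda>x. h x * cos (\<eta> \<bullet> x - \<theta>))"
proof -
  obtain C where C: "\<And>x. \<bar>h x\<bar> \<le> C" using assms by (auto simp: good_def)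
  have m [measurable]: "h \<in> borel_measurable borel" using assms by (simp add: good_def)
  have cos: "complex_of_real (cos (\<eta> \<bullet> x - \<theta>)) = (cis (- \<theta>) * cis (\<eta> \<bullet> x) + cis \<theta> * cis (- (\<eta> \<bullet> x))) / 2" for x
    by (rule complex_eqI) (simp_all add: cis_mult cos_diff sin_diff)
  have "(\<integral>x. u x * of_real (h x * cos (\<eta> \<bullet> x - \<theta>)) * cis (\<xi> \<bullet> x) \<partial>cell \<Gamma>) = 0" if \<xi>: "\<xi> \<in> dual_lattice \<Gamma>" for \<xi>
  proof -
    have "u x * of_real (h x * cos (\<eta> \<bullet> x - \<theta>)) * cis (\<xi> \<bullet> x)
        = (cis (- \<theta>) / 2) * (u x * of_real (h x) * cis ((\<xi> + \<eta>) \<bullet> x))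
        + (cis \<theta> / 2) * (u x * of_real (h x) * cis ((\<xi> - \<eta>) \<bullet> x))" for x
    proof -
      have e: "cis ((\<xi> + \<eta>) \<bullet> x) = cis (\<eta> \<bullet> x) * cis (\<xi> \<bullet> x)" "cis ((\<xi> - \<eta>) \<bullet> x) = cis (- (\<eta> \<bullet> x)) * cis (\<xi> \<bullet> x)"
        by (simp_all only: cis_mult inner_add_left inner_diff_left) (simp_all add: algebra_simps)
      show ?thesis unfolding of_real_mult cos e by (simp add: field_simps)
    qed
    then have "(\<integral>x. u x * of_real (h x * cos (\<eta> \<bullet> x - \<theta>)) * cis (\<xi> \<bullet> x) \<partial>cell \<Gamma>)
        = (cis (- \<theta>) / 2) * (\<integral>x. u x * of_real (h x) * cis ((\<xi> + \<eta>) \<bullet> x) \<partial>cell \<Gamma>)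
        + (cis \<theta> / 2) * (\<integral>x. u x * of_real (h x) * cis ((\<xi> - \<eta>) \<bullet> x) \<partial>cell \<Gamma>)"
      by (simp only: Bochner_Integration.integral_add integrable_mult_right good_integrable[OF m C]
          integral_mult_right_zero)
    then show ?thesis
      using assms \<xi> recip.add_mem[OF \<xi> assms(2)] recip.diff_mem[OF \<xi> assms(2)] by (simp add: good_def)
  qed
  moreover have "\<bar>h x * cos (\<eta> \<bullet> x - \<theta>)\<bar> \<le> C" for x
  proof -
    have "\<bar>h x\<bar> * \<bar>cos (\<eta> \<bullet> x - \<theta>)\<bar> \<le> C * 1"
      by (intro mult_mono C abs_cos_le_one order_trans[OF abs_ge_zero C]) simp
    then show ?thesis by (simp only: abs_mult mult_1_right)
  qed
  moreover have "(\<lambda>x. h x * cos (\<eta> \<bullet> x - \<theta>)) \<in> borel_measurable borel" by measurable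
  ultimately show ?thesis by (auto simp: good_def)
qed

text \<open>The weight \<open>h\<close> is generalised in the induction because a product is handled
  by applying one factor to the weight already multiplied by the other.\<close>

lemma good_mult_poly:
  assumes "real_polynomial_function g" "good u h" "\<eta> \<in> dual_lattice \<Gamma>"
  shows "good u (\<lambda>x. h x * g (cos (\<eta> \<bullet> x - \<theta>)))"
  using assms(1,2)
proof (induction g arbitrary: h)
  case (linear f)
  then obtain c where f: "f = (\<lambda>y. y * c)" by (auto simp: real_bounded_linear)
  show ?case
    unfolding f mult.assoc[symmetric] by (rule good_scale[OF good_mult_cos[OF linear.prems assms(3)]])
next
  case (const c)
  then show ?case by (rule good_scale)
next
  case (add f g)
  then show ?case using good_add[OF add.IH(1)[OF add.prems] add.IH(2)[OF add.prems]] by (simp add: distrib_left)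
next
  case (mult f g)
  then show ?case using mult.IH(2)[OF mult.IH(1)[OF mult.prems]] by (simp add: mult.assoc)
qed

lemma good_limit:
  assumes g: "\<And>k. good u (h k)" and C: "\<And>k x. \<bar>h k x\<bar> \<le> C" and lim: "\<And>x. (\<lambda>k. h k x) \<longlonglongrightarrow> h' x"
  shows "good u h'"
proof -
  have m: "h k \<in> borel_measurable borel" for k using g by (simp add: good_def)
  have m' [measurable]: "h' \<in> borel_measurable borel"
    by (rule borel_measurable_LIMSEQ_metric[OF m lim])
  have C': "\<bar>h' x\<bar> \<le> C" for x
    by (rule LIMSEQ_le_const2[OF tendsto_rabs[OF lim]]) (use C in auto)
  have "(\<integral>x. u x * of_real (h' x) * cis (\<xi> \<bullet> x) \<partial>cell \<Gamma>) = 0" if \<xi>: "\<xi> \<in> dual_lattice \<Gamma>" for \<xi>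
  proof -
    have "(\<lambda>k. \<integral>x. u x * of_real (h k x) * cis (\<xi> \<bullet> x) \<partial>cell \<Gamma>) \<longlonglongrightarrow> (\<integral>x. u x * of_real (h' x) * cis (\<xi> \<bullet> x) \<partial>cell \<Gamma>)"
    proof (rule integral_dominated_convergence[where w = "\<lambda>x. C * cmod (u x)"])
      show "(\<lambda>x. u x * of_real (h' x) * cis (\<xi> \<bullet> x)) \<in> borel_measurable (cell \<Gamma>)"
        "\<And>k. (\<lambda>x. u x * of_real (h k x) * cis (\<xi> \<bullet> x)) \<in> borel_measurable (cell \<Gamma>)"
        using good_integrable[OF m' C'] good_integrable[OF m C] by (auto intro: borel_measurable_integrable)
      show "integrable (cell \<Gamma>) (\<lambda>x. C * cmod (u x))" using l2_integrable_cell[OF u] by simp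
      show "AE x in cell \<Gamma>. (\<lambda>k. u x * of_real (h k x) * cis (\<xi> \<bullet> x)) \<longlonglongrightarrow> u x * of_real (h' x) * cis (\<xi> \<bullet> x)"
        by (intro AE_I2 tendsto_intros lim)
      show "AE x in cell \<Gamma>. norm (u x * of_real (h k x) * cis (\<xi> \<bullet> x)) \<le> C * cmod (u x)" for k
        using mult_left_mono[OF C norm_ge_zero] by (intro AE_I2) (simp add: norm_mult mult.commute[of C])
    qed
    then show ?thesis using g \<xi> by (simp add: good_def LIMSEQ_const_iff)
  qed
  then show ?thesis using m' C' by (auto simp: good_def)
qed

text \<open>The jump at \<open>r\<close> is the limit of steep continuous ramps, which Weierstrass
  replaces by polynomials, uniformly on the range of the cosine.\<close>

lemma good_arc:
  assumes h: "good u h" and \<eta>: "\<eta> \<in> dual_lattice \<Gamma>"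
  shows "good u (\<lambda>x. h x * indicator {r..} (cos (\<eta> \<bullet> x - \<theta>)))"
proof -
  obtain C where C: "\<And>x. \<bar>h x\<bar> \<le> C" using h by (auto simp: good_def)
  have C0: "0 \<le> C" using C[of undefined] by linarith
  \<comment> \<open>For \<open>k > 0\<close> this is 1 on \<open>{r..}\<close> and falls linearly to
    0 within distance \<open>1 / k\<close> below \<open>r\<close>.\<close>
  define f where "f k y = max 0 (1 - real k * max 0 (r - y))" for k :: nat and y :: real
  have "\<exists>g. real_polynomial_function g \<and> (\<forall>y\<in>{-1..1}. \<bar>f k y - g y\<bar> < 1 / real (Suc k))" for k
  proof -
    have "continuous_on {-1..1} (f k)" unfolding f_def by (intro continuous_intros)
    then show ?thesis
      using Stone_Weierstrass_real_polynomial_function[of "{-1..1}" "f k" "1 / real (Suc k)"] by (metis compact_Icc of_nat_0_less_iff zero_less_Suc zero_less_divide_1_iff)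
  qed
  then have "\<forall>k. \<exists>g. real_polynomial_function g \<and> (\<forall>y\<in>{-1..1}. \<bar>f k y - g y\<bar> < 1 / real (Suc k))" by blast
  from choice[OF this] obtain g where g: "\<And>k. real_polynomial_function (g k)"
    "\<And>k y. y \<in> {-1..1} \<Longrightarrow> \<bar>f k y - g k y\<bar> < 1 / real (Suc k)" by blast
  have f01: "0 \<le> f k y" "f k y \<le> 1" for k y by (auto simp: f_def)
  have flim: "(\<lambda>k. f k y) \<longlonglongrightarrow> indicator {r..} y" for y
  proof (cases "r \<le> y")
    case True
    then have "f k y = 1" for k by (simp add: f_def)
    then show ?thesis using True by simp
  next
    case False
    then have pos: "0 < r - y" by simp
    obtain N :: nat where N: "1 / (r - y) \<le> real N" using real_arch_simple by blast
    have "f k y = 0" if "k \<ge> N" for k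
    proof -
      have "1 / (r - y) \<le> real k" using N that by (meson of_nat_mono order_trans)
      then have "1 \<le> real k * (r - y)" using pos by (simp add: field_simps)
      then show ?thesis using pos by (simp add: f_def)
    qed
    then have "eventually (\<lambda>k. f k y = 0) sequentially" by (auto simp: eventually_sequentially)
    then show ?thesis using False by (simp add: tendsto_eventually)
  qed
  have cos1: "cos t \<in> {-1..1}" for t :: real by simp
  have glim: "(\<lambda>k. g k (cos t)) \<longlonglongrightarrow> indicator {r..} (cos t)" for t
  proof -
    have "(\<lambda>k. f k (cos t) - g k (cos t)) \<longlonglongrightarrow> 0"
    proof (rule Lim_null_comparison)
      show "\<forall>\<^sub>F k in sequentially. norm (f k (cos t) - g k (cos t)) \<le> inverse (real (Suc k))"
        using g(2)[OF cos1] by (intro always_eventually allI) (simp add: inverse_eq_divide less_imp_le)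
      show "(\<lambda>k. inverse (real (Suc k))) \<longlonglongrightarrow> 0" by (rule LIMSEQ_inverse_real_of_nat)
    qed
    from tendsto_diff[OF flim[of "cos t"] this] show ?thesis by simp
  qed
  show ?thesis
  proof (rule good_limit)
    show "good u (\<lambda>x. h x * g k (cos (\<eta> \<bullet> x - \<theta>)))" for k
      by (rule good_mult_poly[OF g(1) h \<eta>])
    \<comment> \<open>The ramp has values in the unit interval and the polynomial deviates from it
      by less than 1.\<close>
    show "\<bar>h x * g k (cos (\<eta> \<bullet> x - \<theta>))\<bar> \<le> C * 2" for k x
    proof -
      have "1 / real (Suc k) \<le> 1" by simp
      then have "\<bar>g k (cos (\<eta> \<bullet> x - \<theta>))\<bar> \<le> 2"
        using g(2)[OF cos1, of k "\<eta> \<bullet> x - \<theta>"] f01[of k "cos (\<eta> \<bullet> x - \<theta>)"] by linarith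
      then show ?thesis unfolding abs_mult using C C0 by (intro mult_mono) auto
    qed
    show "(\<lambda>k. h x * g k (cos (\<eta> \<bullet> x - \<theta>))) \<longlonglongrightarrow> h x * indicator {r..} (cos (\<eta> \<bullet> x - \<theta>))" for x
      by (intro tendsto_mult tendsto_const glim)
  qed
qed

lemma good_frac:
  assumes h: "good u h"
  shows "good u (\<lambda>x. h x * indicator {..s} (frac (b j \<bullet> x)))"
proof -
  consider "s < 0" | "1 \<le> s" | "0 \<le> s" "s < 1" by linarith
  then show ?thesis
  proof cases
    case 1
    then have "indicator {..s} (frac (b j \<bullet> x)) = (0 :: real)" for x
      using frac_ge_0[of "b j \<bullet> x"] by (auto simp: indicator_def simp del: frac_ge_0)
    then show ?thesis using good_scale[OF h, of 0] by simp
  next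
    case 2
    then have "indicator {..s} (frac (b j \<bullet> x)) = (1 :: real)" for x
      using frac_lt_1[of "b j \<bullet> x"] by (auto simp: indicator_def simp del: frac_lt_1)
    then show ?thesis using h by simp
  next
    case 3
    have \<eta>: "(2 * pi) *\<^sub>R b j \<in> dual_lattice \<Gamma>"
      unfolding recip.mem_iff using dual by (simp add: inner_commute)
    have "indicator {..s} (frac (b j \<bullet> x)) = (indicator {cos (pi * s)..} (cos (((2 * pi) *\<^sub>R b j) \<bullet> x - pi * s)) :: real)" for x
      using frac_le_iff_cos[OF 3, of "b j \<bullet> x"] by (simp add: indicator_def)
    then show ?thesis using good_arc[OF h \<eta>, of "cos (pi * s)" "pi * s"] by simp
  qed
qed

definition fracv :: "real ^ 'd \<Rightarrow> real ^ 'd" where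
  "fracv x = (\<chi> j. frac (b j \<bullet> x))"

lemma good_box:
  assumes "good u (\<lambda>_. 1)"
  shows "good u (\<lambda>x. indicator {..t} (fracv x))"
proof -
  have "good u (\<lambda>x. \<Prod>j\<in>J. indicator {..t $ j} (frac (b j \<bullet> x)))" if "finite J" for J
    using that
  proof induction
    case (insert j J)
    then show ?case using good_frac[OF insert.IH, of "t $ j" j] by (simp add: mult.commute)
  qed (use assms in simp)
  from this[of UNIV] have "good u (\<lambda>x. \<Prod>j\<in>UNIV. indicator {..t $ j} (frac (b j \<bullet> x)))" by simp
  moreover have "(\<Prod>j\<in>UNIV. indicator {..t $ j} (frac (b j \<bullet> x))) = (indicator {..t} (fracv x) :: real)" for x
  proof (cases "fracv x \<le> t")
    case True
    then have "frac (b j \<bullet> x) \<le> t $ j" for j by (simp add: less_eq_vec_def fracv_def)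
    then show ?thesis using True by simp
  next
    case False
    then obtain j where "\<not> frac (b j \<bullet> x) \<le> t $ j" by (auto simp: less_eq_vec_def fracv_def)
    then have "(\<Prod>j\<in>UNIV. indicator {..t $ j} (frac (b j \<bullet> x))) = (0 :: real)"
      by (intro prod_zero bexI[of _ j]) auto
    then show ?thesis using False by simp
  qed
  ultimately show ?thesis by simp
qed

lemma fracv_measurable [measurable]: "fracv \<in> borel_measurable borel"
proof -
  have "fracv = (\<lambda>x. \<Sum>j\<in>UNIV. frac (b j \<bullet> x) *\<^sub>R axis j 1)"
    by (rule ext) (simp add: fracv_def vec_eq_iff axis_def if_distrib[of "(*) _"] cong: if_cong)
  moreover have "(\<lambda>x. \<Sum>j\<in>UNIV. frac (b j \<bullet> x) *\<^sub>R (axis j 1 :: real ^ 'd)) \<in> borel_measurable borel"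
    unfolding frac_def by measurable
  ultimately show ?thesis by simp
qed

text \<open>A pi-lambda argument: the orthants \<open>{..t}\<close> generate the Borel sets and are
  closed under intersection, and vanishing of the integral is stable under complements and countable
  disjoint unions.\<close>

lemma fracv_set:
  assumes one: "good u (\<lambda>_. 1)" and A: "A \<in> sets borel"
  shows "(\<integral>x. u x * of_real (indicator A (fracv x)) \<partial>cell \<Gamma>) = 0"
proof -
  let ?P = "\<lambda>A. (\<integral>x. u x * of_real (indicator A (fracv x)) \<partial>cell \<Gamma>) = 0"
  have int: "integrable (cell \<Gamma>) (\<lambda>x. u x * of_real (indicator A (fracv x)))" if [measurable]: "A \<in> sets borel" for A
  proof -
    have "(\<lambda>x. indicator A (fracv x) :: real) \<in> borel_measurable borel" by measurable
    from good_integrable[OF this, of 1 0] show ?thesis by (simp add: indicator_def)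
  qed
  have boxes: "?P {..t}" for t
    using good_box[OF one, of t] recip.zero_mem unfolding good_def by (auto dest!: bspec[of _ _ 0])
  have one': "(\<integral>x. u x \<partial>cell \<Gamma>) = 0"
    using one recip.zero_mem unfolding good_def by (auto dest!: bspec[of _ _ 0])
  have b: "(sets borel :: (real ^ 'd) set set) = sigma_sets UNIV (range (\<lambda>t. {..t}))"
    by (subst borel_eq_atMost) simp
  have "Int_stable (range (\<lambda>t :: real ^ 'd. {..t}))"
  proof (rule Int_stableI)
    fix A B :: "(real ^ 'd) set" assume "A \<in> range (\<lambda>t. {..t})" "B \<in> range (\<lambda>t. {..t})"
    then obtain s t where "A = {..s}" "B = {..t}" by blast
    then have "A \<inter> B = {..inf s t}" by auto
    then show "A \<inter> B \<in> range (\<lambda>t. {..t})" by blast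
  qed
  moreover have "range (\<lambda>t :: real ^ 'd. {..t}) \<subseteq> Pow UNIV" by simp
  moreover have "A \<in> sigma_sets UNIV (range (\<lambda>t :: real ^ 'd. {..t}))" using A b by simp
  ultimately show "?P A"
  proof (induction rule: sigma_sets_induct_disjoint)
    case (basic A)
    then show ?case using boxes by auto
  next
    case empty
    then show ?case by simp
  next
    case (compl A)
    have [measurable]: "A \<in> sets borel" using compl(1) b by simp
    have "(\<integral>x. u x * of_real (indicator (UNIV - A) (fracv x)) \<partial>cell \<Gamma>) = (\<integral>x. u x - u x * of_real (indicator A (fracv x)) \<partial>cell \<Gamma>)"
      by (intro Bochner_Integration.integral_cong) (auto simp: indicator_def)
    also have "\<dots> = 0" using compl l2_integrable_cell[OF u] int one' by simp
    finally show ?case .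
  next
    case (union A)
    have Am: "A k \<in> sets borel" for k using union(2) b by auto
    have disj: "disjoint_family A" by fact
    have "(\<lambda>N. \<integral>x. (\<Sum>k<N. u x * of_real (indicator (A k) (fracv x))) \<partial>cell \<Gamma>) \<longlonglongrightarrow>
        (\<integral>x. u x * of_real (indicator (\<Union>k. A k) (fracv x)) \<partial>cell \<Gamma>)"
    proof (rule integral_dominated_convergence[where w = "\<lambda>x. cmod (u x)"])
      show "(\<lambda>x. u x * of_real (indicator (\<Union>k. A k) (fracv x))) \<in> borel_measurable (cell \<Gamma>)"
        using int[of "\<Union>k. A k"] Am by (intro borel_measurable_integrable) auto
      show "(\<lambda>x. \<Sum>k<N. u x * of_real (indicator (A k) (fracv x))) \<in> borel_measurable (cell \<Gamma>)" for N
        using int[OF Am] by (intro borel_measurable_integrable Bochner_Integration.integrable_sum)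
      show "integrable (cell \<Gamma>) (\<lambda>x. cmod (u x))" using l2_integrable_cell[OF u] by simp
      have s: "(\<lambda>k. indicator (A k) y :: real) sums indicator (\<Union>k. A k) y" for y
        by (rule indicator_sums[OF disj[unfolded disjoint_family_on_def, simplified, rule_format]])
      show "AE x in cell \<Gamma>. (\<lambda>N. \<Sum>k<N. u x * of_real (indicator (A k) (fracv x))) \<longlonglongrightarrow> u x * of_real (indicator (\<Union>k. A k) (fracv x))"
        unfolding sum_distrib_left[symmetric] of_real_sum[symmetric]
        using s by (intro AE_I2 tendsto_mult tendsto_const tendsto_of_real) (simp add: sums_def)
      show "AE x in cell \<Gamma>. norm (\<Sum>k<N. u x * of_real (indicator (A k) (fracv x))) \<le> cmod (u x)" for N
      proof (rule AE_I2)
        fix x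
        have "(\<Sum>k<N. indicator (A k) (fracv x)) \<le> (indicator (\<Union>k. A k) (fracv x) :: real)"
          using sum_le_suminf[OF sums_summable[OF s], of "{..<N}" "fracv x"] sums_unique[OF s, of "fracv x"] by simp
        also have "\<dots> \<le> 1" by (simp add: indicator_def)
        finally have "\<bar>\<Sum>k<N. indicator (A k) (fracv x) :: real\<bar> \<le> 1" by (simp add: sum_nonneg)
        then show "norm (\<Sum>k<N. u x * of_real (indicator (A k) (fracv x))) \<le> cmod (u x)"
          unfolding sum_distrib_left[symmetric] of_real_sum[symmetric] norm_mult norm_of_real
          by (simp add: mult_left_le)
      qed
    qed
    moreover have "(\<integral>x. (\<Sum>k<N. u x * of_real (indicator (A k) (fracv x))) \<partial>cell \<Gamma>) = 0" for N
      using union(3) by (subst Bochner_Integration.integral_sum[OF int[OF Am]]) simp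
    ultimately show ?case by (simp add: LIMSEQ_const_iff)
  qed
qed

lemma cell_set_integral:
  assumes one: "good u (\<lambda>_. 1)" and A: "A \<in> sets borel" "A \<subseteq> F"
  shows "(\<integral>x. u x * of_real (indicator A x) \<partial>cell \<Gamma>) = 0"
proof -
  \<comment> \<open>The periodic extension of \<open>A\<close>. Almost every point of the cell has
    no other translate in the cell, so \<open>P\<close> and \<open>A\<close> agree there up to a
    null set.\<close>
  define P where "P = (\<Union>X\<in>\<Gamma>. (\<lambda>x. x + X) -` A)"
  have [measurable]: "(\<lambda>x. x + X) \<in> borel_measurable borel" for X :: "real ^ 'd" by simp
  have "(\<lambda>x. x + X) -` A \<in> sets borel" for X
    using measurable_sets[of "\<lambda>x. x + X" borel borel A] A by simp
  then have P: "P \<in> sets borel"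
    unfolding P_def by (intro sets.countable_UN' countable_lattice) auto
  have Pinv: "x + X \<in> P \<longleftrightarrow> x \<in> P" if X: "X \<in> \<Gamma>" for x X
  proof
    assume "x + X \<in> P"
    then obtain Y where "Y \<in> \<Gamma>" "x + X + Y \<in> A" by (auto simp: P_def)
    then show "x \<in> P" using add_mem[OF X] by (auto simp: P_def add.assoc)
  next
    assume "x \<in> P"
    then obtain Y where "Y \<in> \<Gamma>" "x + Y \<in> A" by (auto simp: P_def)
    then show "x + X \<in> P" using diff_mem[OF _ X] by (auto simp: P_def intro!: bexI[of _ "Y - X"])
  qed
  \<comment> \<open>\<open>L\<close> rebuilds a point from its fractional coordinates up to a
    lattice vector, so membership in the periodic set \<open>P\<close> becomes a Borel condition on
    \<open>fracv x\<close>.\<close>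
  define L where "L t = (\<Sum>i\<in>UNIV. (t $ i) *\<^sub>R a i)" for t :: "real ^ 'd"
  have L: "L \<in> borel_measurable borel"
    unfolding L_def by (intro borel_measurable_continuous_onI continuous_intros)
  have LP: "L -` P \<in> sets borel" using measurable_sets[OF L P] by simp
  have LPx: "fracv x \<in> L -` P \<longleftrightarrow> x \<in> P" for x
  proof -
    define X where "X = (\<Sum>i\<in>UNIV. of_int (- \<lfloor>b i \<bullet> x\<rfloor>) *\<^sub>R a i)"
    have "X \<in> \<Gamma>" unfolding X_def mem_iff by (simp only: coordinates) simp
    moreover have "L (fracv x) = x + X"
    proof -
      have "L (fracv x) = (\<Sum>i\<in>UNIV. (b i \<bullet> x) *\<^sub>R a i) + X"
        by (simp add: L_def fracv_def X_def frac_def scaleR_diff_left sum_subtractf sum_negf)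
      then show ?thesis using expand[of x] by simp
    qed
    ultimately show ?thesis using Pinv by simp
  qed
  have meas: "(\<lambda>x. u x * of_real (indicator B x)) \<in> borel_measurable (cell \<Gamma>)" if [measurable]: "B \<in> sets borel" for B
  proof -
    have "(\<lambda>x. indicator B x :: real) \<in> borel_measurable (cell \<Gamma>)" by (rule measurable_cell_borel) measurable
    then show ?thesis by measurable
  qed
  have "(\<integral>x. u x * of_real (indicator A x) \<partial>cell \<Gamma>) = (\<integral>x. u x * of_real (indicator P x) \<partial>cell \<Gamma>)"
  proof (rule integral_cong_AE)
    show "AE x in cell \<Gamma>. u x * of_real (indicator A x) = u x * of_real (indicator P x)"
      unfolding AE_cell using AE_unique_cell
    proof eventually_elim
      case (elim x)
      show ?case
      proof
        assume "x \<in> F"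
        have "x \<in> P \<longleftrightarrow> x \<in> A"
        proof
          assume "x \<in> P"
          then obtain X where X: "X \<in> \<Gamma>" "x + X \<in> A" by (auto simp: P_def)
          then have "X = 0" using elim \<open>x \<in> F\<close> A(2) by blast
          then show "x \<in> A" using X by simp
        qed (use zero_mem in \<open>auto simp: P_def intro!: bexI[of _ 0]\<close>)
        then show "u x * of_real (indicator A x) = u x * of_real (indicator P x)" by (simp add: indicator_def)
      qed
    qed
  qed (intro meas A P)+
  also have "\<dots> = (\<integral>x. u x * of_real (indicator (L -` P) (fracv x)) \<partial>cell \<Gamma>)"
    using LPx by (simp add: indicator_def)
  also have "\<dots> = 0" by (rule fracv_set[OF one LP])
  finally show ?thesis .
qed

end

text \<open>Only an upper bound is drawn; equality with zero comes from applying it to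
  \<open>w\<close> and \<open>- w\<close>. The test set must be Borel while \<open>w\<close> is
  merely Lebesgue measurable, hence the Borel representative \<open>g\<close>.\<close>

lemma AE_zero_of_set_integrals:
  fixes w :: "real ^ 'd \<Rightarrow> real"
  assumes w: "integrable (cell \<Gamma>) w"
    and zero: "\<And>A. A \<in> sets borel \<Longrightarrow> A \<subseteq> F \<Longrightarrow> (\<integral>x. w x * indicator A x \<partial>cell \<Gamma>) = 0"
  shows "AE x in cell \<Gamma>. w x \<le> 0"
proof -
  have "(\<lambda>x. indicator F x *\<^sub>R w x) \<in> borel_measurable lebesgue"
    using borel_measurable_integrable[OF w] unfolding cell_def
    by (subst (asm) borel_measurable_restrict_space_iff) (auto simp: mult.commute)
  then obtain g where g [measurable]: "g \<in> borel_measurable borel" and gw: "AE x in lebesgue. indicator F x *\<^sub>R w x = g x"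
    using completion_ex_borel_measurable_real[of "\<lambda>x. indicator F x *\<^sub>R w x" lborel] AE_completion by fastforce
  have gw': "AE x in cell \<Gamma>. w x = g x" unfolding AE_cell using gw by eventually_elim auto
  define A where "A = F \<inter> {x. 0 < g x}"
  have A [measurable]: "A \<in> sets borel" unfolding A_def by measurable
  have Am: "(\<lambda>x. indicator A x :: real) \<in> borel_measurable (cell \<Gamma>)" by (rule measurable_cell_borel) measurable
  have wm: "w \<in> borel_measurable (cell \<Gamma>)" using w by (rule borel_measurable_integrable)
  have gA: "g \<in> borel_measurable (cell \<Gamma>)" by (rule measurable_cell_borel[OF g])
  have int: "integrable (cell \<Gamma>) (\<lambda>x. g x * indicator A x)"
  proof (rule Bochner_Integration.integrable_bound[OF w])
    show "(\<lambda>x. g x * indicator A x) \<in> borel_measurable (cell \<Gamma>)" using gA Am by measurable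
    show "AE x in cell \<Gamma>. norm (g x * indicator A x) \<le> norm (w x)"
      using gw' by eventually_elim (auto simp: indicator_def)
  qed
  have "(\<integral>x. g x * indicator A x \<partial>cell \<Gamma>) = (\<integral>x. w x * indicator A x \<partial>cell \<Gamma>)"
  proof (rule integral_cong_AE)
    show "AE x in cell \<Gamma>. g x * indicator A x = w x * indicator A x" using gw' by eventually_elim simp
  qed (use gA Am wm in measurable)
  also have "\<dots> = 0" by (rule zero[OF A]) (simp add: A_def)
  finally have "AE x in cell \<Gamma>. g x * indicator A x = 0"
    by (subst (asm) integral_nonneg_eq_0_iff_AE[OF int]) (auto simp: A_def indicator_def)
  moreover have "AE x in cell \<Gamma>. x \<in> F" unfolding AE_cell by simp
  ultimately show ?thesis
    using gw'
  proof eventually_elim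
    case (elim x)
    then show ?case by (auto simp: A_def indicator_def split: if_splits)
  qed
qed

lemma wave_complete:
  assumes u: "u \<in> l2 (cell \<Gamma>)" and zero: "\<And>n. l2ip (cell \<Gamma>) u (wave n) = 0"
  shows "AE x in cell \<Gamma>. u x = 0"
proof -
  have "good u (\<lambda>_. 1)"
    unfolding good_def
  proof (intro conjI ballI)
    fix \<xi> assume "\<xi> \<in> dual_lattice \<Gamma>"
    \<comment> \<open>The inner product conjugates the wave, so frequency \<open>\<xi>\<close> is
      tested by the wave of frequency \<open>- \<xi>\<close>.\<close>
    then obtain n where n: "- \<xi> = freq n" using freq_surj recip.uminus_mem by blast
    have e: "u x * of_real 1 * cis (\<xi> \<bullet> x) = of_real (sqrt vol) * (u x * cnj (wave n x))" for x
      using vol_pos by (simp add: wave_def n[symmetric] cis_cnj)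
    show "(\<integral>x. u x * of_real 1 * cis (\<xi> \<bullet> x) \<partial>cell \<Gamma>) = 0"
      unfolding e using zero[of n] by (simp add: l2ip_def)
  qed auto
  note set0 = cell_set_integral[OF u this]
  have ui: "integrable (cell \<Gamma>) u" by (rule l2_integrable_cell[OF u])
  have uA: "integrable (cell \<Gamma>) (\<lambda>x. u x * of_real (indicator A x))" if "A \<in> sets borel" for A
    using good_integrable[OF u, of "indicator A" 1 0] that by (simp add: indicator_def)
  have Re0: "(\<integral>x. Re (u x) * indicator A x \<partial>cell \<Gamma>) = 0" "(\<integral>x. Im (u x) * indicator A x \<partial>cell \<Gamma>) = 0"
    if "A \<in> sets borel" "A \<subseteq> F" for A
    using arg_cong[OF set0[OF that], of Re] arg_cong[OF set0[OF that], of Im] uA[OF that(1)]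
    by (simp_all flip: integral_Re integral_Im)
  have "AE x in cell \<Gamma>. Re (u x) \<le> 0"
    by (rule AE_zero_of_set_integrals) (use ui Re0 in auto)
  moreover have "AE x in cell \<Gamma>. - Re (u x) \<le> 0"
    by (rule AE_zero_of_set_integrals) (use ui Re0 in auto)
  moreover have "AE x in cell \<Gamma>. Im (u x) \<le> 0"
    by (rule AE_zero_of_set_integrals) (use ui Re0 in auto)
  moreover have "AE x in cell \<Gamma>. - Im (u x) \<le> 0"
    by (rule AE_zero_of_set_integrals) (use ui Re0 in auto)
  ultimately show ?thesis
    by eventually_elim (simp add: complex_eq_iff)
qed

lemma ortho_l2_wave: "ortho_l2 (cell \<Gamma>) wave"
  by standard (rule wave_l2 wave_ortho wave_complete; assumption)+

end

section \<open>The Bloch operator in Fourier coordinates\<close>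

lemma partial_deriv_has_derivative:
  assumes "\<phi> differentiable_on UNIV"
  shows "((\<lambda>t. \<phi> (x + t *\<^sub>R axis j 1)) has_derivative (\<lambda>h. h *\<^sub>R partial_deriv j \<phi> (x + t *\<^sub>R axis j 1))) (at t)"
proof -
  let ?y = "x + t *\<^sub>R axis j 1"
  have d: "(\<phi> has_derivative frechet_derivative \<phi> (at ?y)) (at ?y)"
    using assms by (simp add: differentiable_on_def frechet_derivative_works)
  have "((\<lambda>t. x + t *\<^sub>R axis j 1) has_derivative (\<lambda>h. h *\<^sub>R axis j 1)) (at t)"
    by (auto intro!: derivative_eq_intros)
  from has_derivative_compose[OF this d]
  have "((\<lambda>t. \<phi> (x + t *\<^sub>R axis j 1)) has_derivative (\<lambda>h. frechet_derivative \<phi> (at ?y) (h *\<^sub>R axis j 1))) (at t)" .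
  then show ?thesis
    unfolding partial_deriv_def linear_scale[OF has_derivative_linear[OF d]] .
qed

lemma partial_deriv_eqI:
  assumes "(\<phi> has_derivative D) (at x)" shows "partial_deriv j \<phi> x = D (axis j 1)"
  unfolding partial_deriv_def frechet_derivative_at[OF assms, symmetric] ..

lemma cis_has_derivative:
  "((\<lambda>x :: real ^ 'd. c * cis (\<zeta> \<bullet> x)) has_derivative (\<lambda>h. c * (\<i> * of_real (\<zeta> \<bullet> h) * cis (\<zeta> \<bullet> x)))) (at x)"
proof -
  have "((\<lambda>x. \<i> * of_real (\<zeta> \<bullet> x)) has_derivative (\<lambda>h. \<i> * of_real (\<zeta> \<bullet> h))) (at x)"
    by (intro has_derivative_mult_right has_derivative_of_real has_derivative_inner_right has_derivative_ident)
  from has_derivative_mult_right[OF has_derivative_compose[OF this DERIV_exp[unfolded has_field_derivative_def]], of c]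
  show ?thesis unfolding cis_conv_exp by (simp add: mult_ac)
qed

lemma partial_deriv_cis:
  "partial_deriv j (\<lambda>x :: real ^ 'd. c * cis (\<zeta> \<bullet> x)) = (\<lambda>x. (\<i> * of_real (\<zeta> $ j) * c) * cis (\<zeta> \<bullet> x))"
  by (rule ext) (simp add: partial_deriv_eqI[OF cis_has_derivative] inner_axis mult_ac)

lemma cis_differentiable_on: "(\<lambda>x :: real ^ 'd. c * cis (\<zeta> \<bullet> x)) differentiable_on S"
  unfolding differentiable_on_def differentiable_def using has_derivative_at_withinI[OF cis_has_derivative] by blast

lemma smooth_cis: "smooth (\<lambda>x :: real ^ 'd. c * cis (\<zeta> \<bullet> x))"
  unfolding smooth_def
proof
  fix js
  have "\<exists>c'. foldr partial_deriv js (\<lambda>x :: real ^ 'd. c * cis (\<zeta> \<bullet> x)) = (\<lambda>x. c' * cis (\<zeta> \<bullet> x))"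
    by (induction js) (auto simp: partial_deriv_cis)
  then obtain c' where "foldr partial_deriv js (\<lambda>x :: real ^ 'd. c * cis (\<zeta> \<bullet> x)) = (\<lambda>x. c' * cis (\<zeta> \<bullet> x))" by blast
  moreover have "(\<lambda>x :: real ^ 'd. c' * cis (\<zeta> \<bullet> x)) differentiable_on UNIV"
    by (rule cis_differentiable_on)
  ultimately show "foldr partial_deriv js (\<lambda>x :: real ^ 'd. c * cis (\<zeta> \<bullet> x)) differentiable_on UNIV" by simp
qed

section \<open>Weak derivatives and the potential in Fourier coordinates\<close>

context lattice_basis
begin

lemma periodic_bounded:
  fixes f :: "real ^ 'd \<Rightarrow> complex"
  assumes "continuous_on UNIV f" "\<And>X x. X \<in> \<Gamma> \<Longrightarrow> f (x + X) = f x"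
  shows "\<exists>C. \<forall>x. cmod (f x) \<le> C"
proof -
  have "bounded (f ` F)"
    by (intro compact_imp_bounded compact_continuous_image compact_voronoi continuous_on_subset[OF assms(1)]) auto
  then obtain C where C: "\<And>x. x \<in> F \<Longrightarrow> cmod (f x) \<le> C" by (auto simp: bounded_iff)
  have "cmod (f x) \<le> C" for x
    using nearest[of x] C assms(2) by metis
  then show ?thesis by blast
qed

text \<open>By translation invariance the difference quotients of \<open>\<psi>\<close> already have integral zero.\<close>
lemma integral_deriv_zero:
  fixes \<psi> D :: "real ^ 'd \<Rightarrow> complex"
  assumes \<psi>: "continuous_on UNIV \<psi>" "\<And>X x. X \<in> \<Gamma> \<Longrightarrow> \<psi> (x + X) = \<psi> x"
    and D: "continuous_on UNIV D" "\<And>X x. X \<in> \<Gamma> \<Longrightarrow> D (x + X) = D x"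
    and deriv: "\<And>x t. ((\<lambda>t. \<psi> (x + t *\<^sub>R v)) has_derivative (\<lambda>h. h *\<^sub>R D (x + t *\<^sub>R v))) (at t)"
  shows "(\<integral>x. D x \<partial>cell \<Gamma>) = 0"
proof -
  obtain C where C: "\<And>x. cmod (D x) \<le> C" using periodic_bounded[OF D] by blast
  obtain C' where C': "\<And>x. cmod (\<psi> x) \<le> C'" using periodic_bounded[OF \<psi>] by blast
  define s where "s k = inverse (real (Suc k))" for k
  have s0: "s \<longlonglongrightarrow> 0" unfolding s_def by (rule LIMSEQ_inverse_real_of_nat)
  have spos: "0 < s k" for k by (simp add: s_def)
  have m: "\<psi> \<in> borel_measurable borel" "D \<in> borel_measurable borel"
    using \<psi>(1) D(1) by (auto intro: borel_measurable_continuous_onI)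
  have m2: "(\<lambda>x. \<psi> (x + y)) \<in> borel_measurable borel" for y
  proof (rule borel_measurable_continuous_onI)
    have "continuous_on UNIV (\<lambda>x. x + y)" by (intro continuous_intros)
    then show "continuous_on UNIV (\<lambda>x. \<psi> (x + y))" by (rule continuous_on_compose2[OF \<psi>(1)]) simp
  qed
  have mc: "\<psi> \<in> borel_measurable (cell \<Gamma>)" "D \<in> borel_measurable (cell \<Gamma>)" "\<And>y. (\<lambda>x. \<psi> (x + y)) \<in> borel_measurable (cell \<Gamma>)"
    using m m2 by (auto intro: measurable_cell_borel)
  have lim: "(\<lambda>k. \<integral>x. (\<psi> (x + s k *\<^sub>R v) - \<psi> x) /\<^sub>R s k \<partial>cell \<Gamma>) \<longlonglongrightarrow> (\<integral>x. D x \<partial>cell \<Gamma>)"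
  proof (rule integral_dominated_convergence[where w = "\<lambda>_. C"])
    show "D \<in> borel_measurable (cell \<Gamma>)" by (rule mc)
    show "(\<lambda>x. (\<psi> (x + s k *\<^sub>R v) - \<psi> x) /\<^sub>R s k) \<in> borel_measurable (cell \<Gamma>)" for k
      using mc(1) mc(3)[of "s k *\<^sub>R v"] by measurable
    show "integrable (cell \<Gamma>) (\<lambda>_. C)" by (rule integrable_cell_bounded[of _ "norm C"]) auto
    show "AE x in cell \<Gamma>. (\<lambda>k. (\<psi> (x + s k *\<^sub>R v) - \<psi> x) /\<^sub>R s k) \<longlonglongrightarrow> D x"
    proof (rule AE_I2)
      fix x
      have "((\<lambda>h. norm (\<psi> (x + h *\<^sub>R v) - \<psi> x - h *\<^sub>R D x) / norm h) \<longlongrightarrow> 0) (at 0)"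
        using deriv[of x 0] by (simp add: has_derivative_at)
      moreover have "filterlim s (at 0) sequentially"
        unfolding filterlim_at using s0 spos by (auto intro!: always_eventually simp: less_imp_neq[symmetric])
      ultimately have "(\<lambda>k. norm (\<psi> (x + s k *\<^sub>R v) - \<psi> x - s k *\<^sub>R D x) / norm (s k)) \<longlonglongrightarrow> 0"
        by (rule filterlim_compose)
      moreover have "norm (A - s k *\<^sub>R D x) / norm (s k) = norm (A /\<^sub>R s k - D x)" for A k
      proof -
        have "A /\<^sub>R s k - D x = (A - s k *\<^sub>R D x) /\<^sub>R s k"
          using spos[of k] by (simp add: scaleR_diff_right)
        then show ?thesis by (simp add: divide_inverse mult.commute)
      qed
      ultimately have "(\<lambda>k. norm ((\<psi> (x + s k *\<^sub>R v) - \<psi> x) /\<^sub>R s k - D x)) \<longlonglongrightarrow> 0" by simp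
      then show "(\<lambda>k. (\<psi> (x + s k *\<^sub>R v) - \<psi> x) /\<^sub>R s k) \<longlonglongrightarrow> D x"
        unfolding tendsto_norm_zero_iff LIM_zero_iff .
    qed
    \<comment> \<open>The mean value inequality bounds the difference quotients by the bound on
      \<open>D\<close>, a constant majorant that is integrable over the cell.\<close>
    show "AE x in cell \<Gamma>. norm ((\<psi> (x + s k *\<^sub>R v) - \<psi> x) /\<^sub>R s k) \<le> C" for k
    proof (rule AE_I2)
      fix x
      have "norm (\<psi> (x + s k *\<^sub>R v) - \<psi> (x + 0 *\<^sub>R v)) \<le> C * norm (s k - 0)"
      proof (rule differentiable_bound[of UNIV "\<lambda>t. \<psi> (x + t *\<^sub>R v)" "\<lambda>t h. h *\<^sub>R D (x + t *\<^sub>R v)"])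
        show "onorm (\<lambda>h. h *\<^sub>R D (x + t *\<^sub>R v)) \<le> C" for t
          using C order_trans[OF norm_ge_zero C] by (intro onorm_bound) (auto simp: mult.commute[of C] mult_left_mono)
      qed (use deriv in auto)
      then show "norm ((\<psi> (x + s k *\<^sub>R v) - \<psi> x) /\<^sub>R s k) \<le> C"
      proof -
        have "norm ((\<psi> (x + s k *\<^sub>R v) - \<psi> x) /\<^sub>R s k) = norm (\<psi> (x + s k *\<^sub>R v) - \<psi> x) / s k"
          using spos[of k] by (simp add: divide_inverse mult.commute)
        moreover have "norm (\<psi> (x + s k *\<^sub>R v) - \<psi> x) \<le> C * s k"
          using spos[of k] \<open>norm (\<psi> (x + s k *\<^sub>R v) - \<psi> (x + 0 *\<^sub>R v)) \<le> C * norm (s k - 0)\<close> by simp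
        ultimately show ?thesis using spos[of k] by (simp add: pos_divide_le_eq)
      qed
    qed
  qed
  have zero: "(\<integral>x. (\<psi> (x + s k *\<^sub>R v) - \<psi> x) /\<^sub>R s k \<partial>cell \<Gamma>) = 0" for k
  proof -
    have "(\<integral>x. \<psi> (x + s k *\<^sub>R v) \<partial>cell \<Gamma>) = (\<integral>x. \<psi> x \<partial>cell \<Gamma>)"
      using voronoi_integral_translate[OF \<psi>] by (simp add: lint_cell)
    moreover have "integrable (cell \<Gamma>) \<psi>" "integrable (cell \<Gamma>) (\<lambda>x. \<psi> (x + s k *\<^sub>R v))"
      using mc C' by (auto intro: integrable_cell_bounded)
    ultimately show ?thesis by simp
  qed
  from lim show ?thesis unfolding zero by (simp add: LIMSEQ_const_iff)
qed

lemma test_function_props: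
  assumes "\<phi> \<in> test_functions \<Gamma>"
  shows "\<phi> differentiable_on UNIV" "continuous_on UNIV \<phi>" "X \<in> \<Gamma> \<Longrightarrow> \<phi> (x + X) = \<phi> x"
    "continuous_on UNIV (partial_deriv j \<phi>)" "X \<in> \<Gamma> \<Longrightarrow> partial_deriv j \<phi> (x + X) = partial_deriv j \<phi> x"
proof -
  have s: "foldr partial_deriv js \<phi> differentiable_on UNIV" for js
    using assms by (simp add: test_functions_def smooth_def)
  have per: "\<phi> (x + X) = \<phi> x" if "X \<in> \<Gamma>" for x X using assms that by (auto simp: test_functions_def)
  show d: "\<phi> differentiable_on UNIV" using s[of "[]"] by simp
  then show "continuous_on UNIV \<phi>" by (rule differentiable_imp_continuous_on)
  show "continuous_on UNIV (partial_deriv j \<phi>)" using s[of "[j]"] by (simp add: differentiable_imp_continuous_on)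
  show "\<phi> (x + X) = \<phi> x" if "X \<in> \<Gamma>" by (rule per[OF that])
  show "partial_deriv j \<phi> (x + X) = partial_deriv j \<phi> x" if X: "X \<in> \<Gamma>"
  proof -
    have d1: "(\<phi> has_derivative frechet_derivative \<phi> (at (x + X))) (at (x + X))"
      using d by (simp add: differentiable_on_def frechet_derivative_works)
    have "((\<lambda>y. y + X) has_derivative (\<lambda>h. h)) (at x)" by (auto intro!: derivative_eq_intros)
    from has_derivative_compose[OF this d1]
    have "(\<phi> has_derivative frechet_derivative \<phi> (at (x + X))) (at x)" by (simp add: per[OF X])
    from partial_deriv_eqI[OF this] show ?thesis by (simp add: partial_deriv_def)
  qed
qed

lemma partial_deriv_wave: "partial_deriv j (wave n) = (\<lambda>x. \<i> * of_real (freq n $ j) * wave n x)"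
  unfolding wave_def[abs_def] partial_deriv_cis by (simp add: mult_ac)

text \<open>The partial derivative of the periodic product of \<open>\<phi>\<close> and
  \<open>wave n\<close> integrates to zero.\<close>

lemma voronoi_by_parts:
  assumes \<phi>: "\<phi> \<in> test_functions \<Gamma>"
  shows "(\<integral>x. partial_deriv j \<phi> x * wave n x \<partial>cell \<Gamma>) = - (\<i> * of_real (freq n $ j)) * (\<integral>x. \<phi> x * wave n x \<partial>cell \<Gamma>)"
proof -
  note p = test_function_props[OF \<phi>]
  let ?z = "\<i> * of_real (freq n $ j)"
  have cw: "continuous_on UNIV (wave n)"
    unfolding wave_def[abs_def] by (intro continuous_intros continuous_cis)
  have zero: "(\<integral>x. partial_deriv j \<phi> x * wave n x + \<phi> x * (?z * wave n x) \<partial>cell \<Gamma>) = 0"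
  proof (rule integral_deriv_zero[where \<psi> = "\<lambda>x. \<phi> x * wave n x" and v = "axis j 1"])
    fix x t
    have w: "((\<lambda>t. wave n (x + t *\<^sub>R axis j 1)) has_derivative (\<lambda>h. h *\<^sub>R (?z * wave n (x + t *\<^sub>R axis j 1)))) (at t)"
    proof -
      have "wave n differentiable_on UNIV"
        unfolding wave_def[abs_def] by (rule cis_differentiable_on)
      from partial_deriv_has_derivative[OF this] show ?thesis
        unfolding partial_deriv_wave .
    qed
    show "((\<lambda>t. \<phi> (x + t *\<^sub>R axis j 1) * wave n (x + t *\<^sub>R axis j 1)) has_derivative
       (\<lambda>h. h *\<^sub>R (partial_deriv j \<phi> (x + t *\<^sub>R axis j 1) * wave n (x + t *\<^sub>R axis j 1) + \<phi> (x + t *\<^sub>R axis j 1) * (?z * wave n (x + t *\<^sub>R axis j 1))))) (at t)"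
      using has_derivative_mult[OF partial_deriv_has_derivative[OF p(1)] w]
      by (rule has_derivative_eq_rhs) (auto simp: scaleR_conv_of_real algebra_simps)
  qed (use p wave_periodic in \<open>auto intro!: continuous_intros cw\<close>)
  have ints: "integrable (cell \<Gamma>) (\<lambda>x. partial_deriv j \<phi> x * wave n x)" "integrable (cell \<Gamma>) (\<lambda>x. \<phi> x * wave n x)"
  proof -
    have int: "integrable (cell \<Gamma>) f" if f: "continuous_on UNIV f" "\<And>X x. X \<in> \<Gamma> \<Longrightarrow> f (x + X) = f x" for f :: "real ^ 'd \<Rightarrow> complex"
    proof -
      obtain C where "\<And>x. cmod (f x) \<le> C" using periodic_bounded[OF f] by blast
      then show ?thesis
        by (intro integrable_cell_bounded[of _ C] measurable_cell_borel borel_measurable_continuous_onI f) auto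
    qed
    show "integrable (cell \<Gamma>) (\<lambda>x. partial_deriv j \<phi> x * wave n x)"
      by (rule int) (use p wave_periodic in \<open>auto intro!: continuous_intros cw\<close>)
    show "integrable (cell \<Gamma>) (\<lambda>x. \<phi> x * wave n x)"
      by (rule int) (use p wave_periodic in \<open>auto intro!: continuous_intros cw\<close>)
  qed
  have "\<phi> x * (?z * wave n x) = ?z * (\<phi> x * wave n x)" for x by simp
  then have "(\<integral>x. partial_deriv j \<phi> x * wave n x \<partial>cell \<Gamma>) + ?z * (\<integral>x. \<phi> x * wave n x \<partial>cell \<Gamma>) = 0"
    using zero by (simp only: Bochner_Integration.integral_add ints integrable_mult_right integral_mult_right_zero)
  then show ?thesis by (simp add: eq_neg_iff_add_eq_0)
qed

sublocale L2: ortho_l2 "cell \<Gamma>" wave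
  by (rule ortho_l2_wave)

lemma L2_torus_iff:
  "u \<in> L2_torus \<Gamma> \<longleftrightarrow> u \<in> borel_measurable lebesgue \<and> (AE x in lebesgue. \<forall>X\<in>\<Gamma>. u (x + X) = u x) \<and> u \<in> l2 (cell \<Gamma>)"
proof -
  have "set_integrable lebesgue F (\<lambda>x. (cmod (u x))\<^sup>2) \<longleftrightarrow> integrable (cell \<Gamma>) (\<lambda>x. (cmod (u x))\<^sup>2)"
    unfolding cell_def set_integrable_def by (rule integrable_restrict_space[symmetric]) simp
  then show ?thesis
    using measurable_cell[of u] unfolding L2_torus_def l2_def by blast
qed

lemma torus_l2: "u \<in> L2_torus \<Gamma> \<Longrightarrow> u \<in> l2 (cell \<Gamma>)"
  by (simp add: L2_torus_iff)

lemma torus_add: "u \<in> L2_torus \<Gamma> \<Longrightarrow> v \<in> L2_torus \<Gamma> \<Longrightarrow> (\<lambda>x. u x + v x) \<in> L2_torus \<Gamma>"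
  unfolding L2_torus_iff
proof (elim conjE, intro conjI)
  assume "AE x in lebesgue. \<forall>X\<in>\<Gamma>. u (x + X) = u x" "AE x in lebesgue. \<forall>X\<in>\<Gamma>. v (x + X) = v x"
  then show "AE x in lebesgue. \<forall>X\<in>\<Gamma>. u (x + X) + v (x + X) = u x + v x" by eventually_elim simp
qed (auto intro: l2_add borel_measurable_add)

lemma torus_scale: "u \<in> L2_torus \<Gamma> \<Longrightarrow> (\<lambda>x. c * u x) \<in> L2_torus \<Gamma>"
  unfolding L2_torus_iff
proof (elim conjE, intro conjI)
  assume "AE x in lebesgue. \<forall>X\<in>\<Gamma>. u (x + X) = u x"
  then show "AE x in lebesgue. \<forall>X\<in>\<Gamma>. c * u (x + X) = c * u x" by eventually_elim simp
qed (auto intro: l2_scale borel_measurable_times)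

lemma torus_diff: "u \<in> L2_torus \<Gamma> \<Longrightarrow> v \<in> L2_torus \<Gamma> \<Longrightarrow> (\<lambda>x. u x - v x) \<in> L2_torus \<Gamma>"
  using torus_add[of u "\<lambda>x. -1 * v x"] torus_scale[of v "-1"] by simp

lemma torus_zero: "(\<lambda>x. 0) \<in> L2_torus \<Gamma>"
  by (simp add: L2_torus_iff l2_zero)

lemma torus_sum: "(\<And>i. i \<in> I \<Longrightarrow> f i \<in> L2_torus \<Gamma>) \<Longrightarrow> (\<lambda>x. \<Sum>i\<in>I. f i x) \<in> L2_torus \<Gamma>"
  by (induction I rule: infinite_finite_induct) (auto simp: torus_zero torus_add)

lemma torus_fn: "L2.fn y \<in> L2_torus \<Gamma>"
proof -
  obtain r where r: "L2.fn y = (\<lambda>x. lim (\<lambda>k. psum wave y (r k) x))" by (rule L2.fn_props)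
  have "psum wave y N \<in> borel_measurable borel" for N
    unfolding psum_def[abs_def] by measurable
  then have "(\<lambda>x. lim (\<lambda>k. psum wave y (r k) x)) \<in> borel_measurable borel"
    by (intro borel_measurable_lim_metric)
  then have "L2.fn y \<in> borel_measurable lebesgue" unfolding r by (intro measurable_completion) simp
  moreover have "L2.fn y (x + X) = L2.fn y x" if "X \<in> \<Gamma>" for X x
    unfolding r psum_def using wave_periodic[OF that] by simp
  ultimately show ?thesis by (simp add: L2_torus_iff L2.fn_l2)
qed

lemma torus_vec_eq_iff:
  assumes "u \<in> L2_torus \<Gamma>" "v \<in> L2_torus \<Gamma>"
  shows "L2.vec u = L2.vec v \<longleftrightarrow> (AE x in lebesgue. u x = v x)"
proof
  assume "L2.vec u = L2.vec v"
  then have "AE x in cell \<Gamma>. u x = v x" using L2.vec_eq_iff assms torus_l2 by blast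
  then have 1: "AE x in lebesgue. x \<in> F \<longrightarrow> u x = v x" by (simp add: AE_cell)
  have "AE x in lebesgue. \<forall>X\<in>\<Gamma>. u (x + X) = u x" "AE x in lebesgue. \<forall>X\<in>\<Gamma>. v (x + X) = v x"
    using assms by (auto simp: L2_torus_iff)
  then have "AE x in lebesgue. \<forall>X\<in>\<Gamma>. u (x + X) = v (x + X) \<longrightarrow> u x = v x" by eventually_elim simp
  with 1 show "AE x in lebesgue. u x = v x" by (rule AE_from_cell)
next
  assume "AE x in lebesgue. u x = v x"
  then have "AE x in cell \<Gamma>. u x = v x" unfolding AE_cell by eventually_elim simp
  then show "L2.vec u = L2.vec v" using L2.vec_eq_iff assms torus_l2 by blast
qed

text \<open>Forward, the conjugate waves are themselves test functions. Backward, the coefficients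
  of an arbitrary test function obey the same multiplier rule by integration by parts, and Parseval
  pairs them with those of \<open>u\<close>; conjugating the imaginary factor supplies the minus
  sign.\<close>

lemma weak_deriv_iff:
  assumes u: "u \<in> L2_torus \<Gamma>" and w: "w \<in> L2_torus \<Gamma>"
  shows "weak_deriv \<Gamma> j u w \<longleftrightarrow> (\<forall>n. coord (L2.vec w) n = \<i> * of_real (freq n $ j) * coord (L2.vec u) n)"
proof
  assume wd: "weak_deriv \<Gamma> j u w"
  show "\<forall>n. coord (L2.vec w) n = \<i> * of_real (freq n $ j) * coord (L2.vec u) n"
  proof
    fix n
    let ?z = "\<i> * of_real (freq n $ j)"
    define c where "c = complex_of_real (1 / sqrt vol)"
    define \<phi> where "\<phi> x = c * cis ((- freq n) \<bullet> x)" for x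
    have \<phi>: "\<phi> x = cnj (wave n x)" for x by (simp add: \<phi>_def wave_def c_def cis_cnj)
    have "\<phi> \<in> test_functions \<Gamma>"
    proof -
      have "smooth \<phi>" unfolding \<phi>_def[abs_def] by (rule smooth_cis)
      then show ?thesis by (simp add: test_functions_def \<phi> wave_periodic)
    qed
    then have "(LINT x:F|lebesgue. u x * partial_deriv j \<phi> x) = - (LINT x:F|lebesgue. w x * \<phi> x)"
      using wd by (auto simp: weak_deriv_def)
    moreover have "partial_deriv j \<phi> x = - ?z * cnj (wave n x)" for x
      unfolding \<phi>[symmetric] unfolding \<phi>_def[abs_def] unfolding partial_deriv_cis by simp
    ultimately have "(\<integral>x. u x * (- ?z * cnj (wave n x)) \<partial>cell \<Gamma>) = - (\<integral>x. w x * cnj (wave n x) \<partial>cell \<Gamma>)"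
      by (simp add: lint_cell \<phi>)
    moreover have "(\<integral>x. u x * (- ?z * cnj (wave n x)) \<partial>cell \<Gamma>) = - ?z * (\<integral>x. u x * cnj (wave n x) \<partial>cell \<Gamma>)"
    proof -
      have "u x * (- ?z * cnj (wave n x)) = - ?z * (u x * cnj (wave n x))" for x by simp
      then show ?thesis by (simp only: integral_mult_right_zero)
    qed
    ultimately show "coord (L2.vec w) n = ?z * coord (L2.vec u) n"
      using u w by (simp add: L2.coord_vec torus_l2 l2ip_def)
  qed
next
  assume c: "\<forall>n. coord (L2.vec w) n = \<i> * of_real (freq n $ j) * coord (L2.vec u) n"
  show "weak_deriv \<Gamma> j u w"
    unfolding weak_deriv_def
  proof (intro conjI ballI u w)
    fix \<phi> assume \<phi>: "\<phi> \<in> test_functions \<Gamma>"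
    note p = test_function_props[OF \<phi>]
    have l2c: "(\<lambda>x. cnj (f x)) \<in> l2 (cell \<Gamma>)" if f: "continuous_on UNIV f" "\<And>X x. X \<in> \<Gamma> \<Longrightarrow> f (x + X) = f x"
      for f :: "real ^ 'd \<Rightarrow> complex"
    proof -
      obtain C where "\<And>x. cmod (f x) \<le> C" using periodic_bounded[OF f] by blast
      then show ?thesis
        by (intro l2_cnj l2_bounded[of _ C] measurable_cell_borel borel_measurable_continuous_onI f) auto
    qed
    have l1: "(\<lambda>x. cnj (\<phi> x)) \<in> l2 (cell \<Gamma>)" and l2: "(\<lambda>x. cnj (partial_deriv j \<phi> x)) \<in> l2 (cell \<Gamma>)"
      using p by (auto intro: l2c)
    have cf: "l2ip (cell \<Gamma>) (\<lambda>x. cnj (f x)) (wave n) = cnj (\<integral>x. f x * wave n x \<partial>cell \<Gamma>)" for f n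
      unfolding l2ip_def by (simp flip: Bochner_Integration.integral_cnj)
    have d: "coord (L2.vec (\<lambda>x. cnj (partial_deriv j \<phi> x))) n = \<i> * of_real (freq n $ j) * coord (L2.vec (\<lambda>x. cnj (\<phi> x))) n" for n
      unfolding L2.coord_vec[OF l1] L2.coord_vec[OF l2] cf voronoi_by_parts[OF \<phi>] by simp
    have "(LINT x:F|lebesgue. u x * partial_deriv j \<phi> x) = l2ip (cell \<Gamma>) u (\<lambda>x. cnj (partial_deriv j \<phi> x))"
      by (simp add: lint_cell l2ip_def)
    also have "\<dots> = ip (L2.vec u) (L2.vec (\<lambda>x. cnj (partial_deriv j \<phi> x)))"
      by (rule L2.parseval[OF torus_l2[OF u] l2])
    also have "\<dots> = (\<Sum>n. - (coord (L2.vec w) n * cnj (coord (L2.vec (\<lambda>x. cnj (\<phi> x))) n)))"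
      unfolding ip_def d using c by (simp add: mult_ac)
    also have "\<dots> = - ip (L2.vec w) (L2.vec (\<lambda>x. cnj (\<phi> x)))"
      unfolding ip_def by (rule suminf_minus[OF summable_ip])
    also have "\<dots> = - l2ip (cell \<Gamma>) w (\<lambda>x. cnj (\<phi> x))"
      by (simp only: L2.parseval[OF torus_l2[OF w] l1])
    also have "\<dots> = - (LINT x:F|lebesgue. w x * \<phi> x)" by (simp add: lint_cell l2ip_def)
    finally show "(LINT x:F|lebesgue. u x * partial_deriv j \<phi> x) = - (LINT x:F|lebesgue. w x * \<phi> x)" .
  qed
qed

lemma bloch_deriv_iff:
  assumes u: "u \<in> L2_torus \<Gamma>" and v: "v \<in> L2_torus \<Gamma>"
  shows "bloch_deriv \<Gamma> k j u v \<longleftrightarrow> (\<forall>n. coord (L2.vec v) n = \<i> * of_real ((freq n + k) $ j) * coord (L2.vec u) n)"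
proof -
  have d: "(\<lambda>x. v x - \<i> * of_real (k $ j) * u x) \<in> L2_torus \<Gamma>" by (intro torus_diff torus_scale u v)
  have e: "coord (L2.vec (\<lambda>x. v x - \<i> * of_real (k $ j) * u x)) n = coord (L2.vec v) n - \<i> * of_real (k $ j) * coord (L2.vec u) n" for n
    using torus_l2[OF d] torus_l2[OF u] torus_l2[OF v]
    by (simp add: L2.coord_vec l2ip_diff_left l2_scale l2ip_scale_left L2.e_l2)
  show ?thesis
    unfolding bloch_deriv_def weak_deriv_iff[OF u d] e by (simp add: diff_eq_eq algebra_simps)
qed

text \<open>The symbol of one minus the Laplacian, independent of \<open>k\<close>, so that one
  weight serves all quasi-momenta.\<close>

definition weight :: "nat \<Rightarrow> real" where "weight n = 1 + (norm (freq n))\<^sup>2"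

definition symb :: "real ^ 'd \<Rightarrow> nat \<Rightarrow> real" where "symb k n = (norm (freq n + k))\<^sup>2"

text \<open>Multiplication by \<open>V\<close> transported to coefficient sequences.
  \<open>fn y\<close> is just one representative; by \<open>pot_vec\<close> any other gives the same
  vector.\<close>

definition pot :: "(real ^ 'd \<Rightarrow> real) \<Rightarrow> ell2 \<Rightarrow> ell2" where
  "pot V y = L2.vec (\<lambda>x. of_real (V x) * L2.fn y x)"

lemma symb_eq: "symb k n = (\<Sum>j\<in>UNIV. ((freq n + k) $ j)\<^sup>2)"
  unfolding symb_def power2_norm_eq_inner inner_vec_def by (simp add: power2_eq_square)

lemma admissibleD:
  assumes "V \<in> admissible \<Gamma> Vmax"
  shows "V \<in> borel_measurable lebesgue" "AE x in lebesgue. \<forall>X\<in>\<Gamma>. V (x + X) = V x"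
    "AE x in lebesgue. V x \<in> {0..Vmax}"
proof -
  have ae: "AE x in lebesgue. (\<forall>X\<in>\<Gamma>. V (x + X) = V x) \<and> V x \<in> {0..Vmax}"
    using assms unfolding admissible_def by blast
  show "V \<in> borel_measurable lebesgue" using assms unfolding admissible_def by blast
  show "AE x in lebesgue. \<forall>X\<in>\<Gamma>. V (x + X) = V x" using ae by eventually_elim blast
  show "AE x in lebesgue. V x \<in> {0..Vmax}" using ae by eventually_elim blast
qed

lemma admissible_complex_measurable:
  assumes "V \<in> admissible \<Gamma> Vmax"
  shows "(\<lambda>x. complex_of_real (V x)) \<in> borel_measurable lebesgue"
proof -
  have [measurable]: "V \<in> borel_measurable lebesgue" by (rule admissibleD(1)[OF assms])
  show ?thesis by measurable
qed

lemma pot_l2: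
  assumes V: "V \<in> admissible \<Gamma> Vmax" and u: "u \<in> l2 (cell \<Gamma>)"
  shows "(\<lambda>x. of_real (V x) * u x) \<in> l2 (cell \<Gamma>)"
proof (rule l2_bounded_mult[OF u, of _ Vmax])
  show "(\<lambda>x. complex_of_real (V x)) \<in> borel_measurable (cell \<Gamma>)"
    by (rule measurable_cell[OF admissible_complex_measurable[OF V]])
  show "AE x in cell \<Gamma>. cmod (complex_of_real (V x)) \<le> Vmax"
    unfolding AE_cell using admissibleD(3)[OF V] by eventually_elim auto
qed

lemma pot_torus:
  assumes V: "V \<in> admissible \<Gamma> Vmax" and u: "u \<in> L2_torus \<Gamma>"
  shows "(\<lambda>x. of_real (V x) * u x) \<in> L2_torus \<Gamma>"
  unfolding L2_torus_iff
proof (intro conjI pot_l2[OF V torus_l2[OF u]])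
  have "u \<in> borel_measurable lebesgue" using u by (simp add: L2_torus_iff)
  then show "(\<lambda>x. complex_of_real (V x) * u x) \<in> borel_measurable lebesgue"
    by (intro borel_measurable_times admissible_complex_measurable[OF V])
  note admissibleD(2)[OF V]
  moreover have "AE x in lebesgue. \<forall>X\<in>\<Gamma>. u (x + X) = u x" using u by (simp add: L2_torus_iff)
  ultimately show "AE x in lebesgue. \<forall>X\<in>\<Gamma>. complex_of_real (V (x + X)) * u (x + X) = complex_of_real (V x) * u x"
    by eventually_elim simp
qed

lemma pot_vec:
  assumes V: "V \<in> admissible \<Gamma> Vmax" and u: "u \<in> l2 (cell \<Gamma>)"
  shows "pot V (L2.vec u) = L2.vec (\<lambda>x. of_real (V x) * u x)"
proof -
  have "AE x in cell \<Gamma>. of_real (V x) * L2.fn (L2.vec u) x = of_real (V x) * u x"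
    using L2.fn_vec[OF u] by eventually_elim simp
  then show ?thesis
    unfolding pot_def using L2.vec_eq_iff[OF pot_l2[OF V L2.fn_l2] pot_l2[OF V u]] by blast
qed

lemma norm_vec: "u \<in> l2 (cell \<Gamma>) \<Longrightarrow> (norm (L2.vec u))\<^sup>2 = sqn (cell \<Gamma>) u"
proof -
  assume u: "u \<in> l2 (cell \<Gamma>)"
  have "complex_of_real ((norm (L2.vec u))\<^sup>2) = of_real (sqn (cell \<Gamma>) u)"
    unfolding ip_self[symmetric] L2.parseval[OF u u, symmetric] l2ip_self[OF u] ..
  then show ?thesis by (simp only: of_real_eq_iff)
qed

lemma ip_pot: "V \<in> admissible \<Gamma> Vmax \<Longrightarrow> u \<in> l2 (cell \<Gamma>) \<Longrightarrow> v \<in> l2 (cell \<Gamma>) \<Longrightarrow>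
    ip (pot V (L2.vec u)) (L2.vec v) = (\<integral>x. of_real (V x) * u x * cnj (v x) \<partial>cell \<Gamma>)"
  by (simp add: pot_vec L2.parseval[symmetric] pot_l2 l2ip_def)

lemma weight_weight: "Submission.weight weight"
proof
  show "1 \<le> weight n" for n by (simp add: weight_def)
  show "finite {n. weight n \<le> C}" for C
  proof (rule finite_subset[OF _ finite_freq[of "sqrt (C - 1)"]])
    show "{n. weight n \<le> C} \<subseteq> {n. norm (freq n) \<le> sqrt (C - 1)}"
      by (auto simp: weight_def intro!: real_le_rsqrt)
  qed
qed

lemma norm_add_square_le: "(norm (x + y :: real ^ 'd))\<^sup>2 \<le> 2 * (norm x)\<^sup>2 + 2 * (norm y)\<^sup>2"
proof -
  have "(norm (x + y))\<^sup>2 \<le> (norm x + norm y)\<^sup>2" by (simp add: norm_triangle_ineq)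
  also have "\<dots> \<le> 2 * (norm x)\<^sup>2 + 2 * (norm y)\<^sup>2"
    using sum_squares_bound[of "norm x" "norm y"] by (simp add: power2_sum)
  finally show ?thesis .
qed

text \<open>The bound \<open>|x + y|^2 \<le> 2 |x|^2 + 2 |y|^2\<close>, applied in both directions,
  makes \<open>1 + |\<xi>|^2\<close> and \<open>1 + |\<xi> + k|^2\<close> comparable with a constant
  depending only on \<open>R\<close>. Boundedness and positivity of the potential part come from the
  range \<open>{0..Vmax}\<close>.\<close>

lemma form_pot:
  assumes V: "V \<in> admissible \<Gamma> Vmax" and Vmax0: "0 \<le> Vmax" and k: "norm k \<le> R"
  shows "form weight (symb k) (pot V) (2 + 2 * R\<^sup>2) Vmax"
proof -
  interpret Submission.weight weight by (rule weight_weight)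
  have kR: "(norm k)\<^sup>2 \<le> R\<^sup>2" using k by (simp add: power_mono)
  have V0: "AE x in cell \<Gamma>. 0 \<le> V x \<and> V x \<le> Vmax"
    unfolding AE_cell using admissibleD(3)[OF V] by eventually_elim auto
  have Vm: "(\<lambda>x. V x) \<in> borel_measurable (cell \<Gamma>)"
    by (intro measurable_cell admissibleD(1)[OF V])
  show ?thesis
  proof
    fix n
    show "0 \<le> symb k n" by (simp add: symb_def)
    have "(norm (freq n))\<^sup>2 \<le> 2 * symb k n + 2 * (norm k)\<^sup>2"
      using norm_add_square_le[of "freq n + k" "- k"] by (simp add: symb_def)
    then have "weight n \<le> 2 * (1 + symb k n) + 2 * R\<^sup>2 * 1" using kR by (simp add: weight_def)
    also have "\<dots> \<le> 2 * (1 + symb k n) + 2 * R\<^sup>2 * (1 + symb k n)"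
      by (intro add_left_mono mult_left_mono) (auto simp: symb_def)
    finally show "weight n \<le> (2 + 2 * R\<^sup>2) * (1 + symb k n)" by (simp add: algebra_simps)
    have "symb k n \<le> 2 * (norm (freq n))\<^sup>2 + 2 * R\<^sup>2 * 1"
      using norm_add_square_le[of "freq n" k] kR by (simp add: symb_def)
    also have "\<dots> \<le> 2 * weight n + 2 * R\<^sup>2 * weight n"
      by (intro add_mono mult_left_mono) (auto simp: weight_def)
    finally show "symb k n \<le> (2 + 2 * R\<^sup>2) * weight n" by (simp add: algebra_simps)
  next
    fix a b
    have "L2.vec (\<lambda>x. L2.fn a x + L2.fn b x) = a + b" using L2.vec_add[OF L2.fn_l2 L2.fn_l2, of a b] by (simp only: L2.vec_fn)
    then have "pot V (a + b) = L2.vec (\<lambda>x. of_real (V x) * (L2.fn a x + L2.fn b x))"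
      using pot_vec[OF V l2_add[OF L2.fn_l2 L2.fn_l2], of a b] by simp
    also have "\<dots> = pot V a + pot V b"
      unfolding pot_def using L2.vec_add[OF pot_l2[OF V L2.fn_l2] pot_l2[OF V L2.fn_l2], of a b]
      by (simp add: distrib_left)
    finally show "pot V (a + b) = pot V a + pot V b" .
    show "ip (pot V a) b = ip a (pot V b)"
    proof -
      have "ip (pot V a) b = (\<integral>x. of_real (V x) * L2.fn a x * cnj (L2.fn b x) \<partial>cell \<Gamma>)"
        using ip_pot[OF V L2.fn_l2 L2.fn_l2, of a b] by (simp add: L2.vec_fn)
      also have "\<dots> = (\<integral>x. cnj (of_real (V x) * L2.fn b x * cnj (L2.fn a x)) \<partial>cell \<Gamma>)"
      proof -
        have e: "of_real (V x) * L2.fn a x * cnj (L2.fn b x) = cnj (of_real (V x) * L2.fn b x * cnj (L2.fn a x))" for x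
          by simp
        show ?thesis unfolding e ..
      qed
      also have "\<dots> = cnj (ip (pot V b) a)"
        using ip_pot[OF V L2.fn_l2 L2.fn_l2, of b a] by (simp only: L2.vec_fn Bochner_Integration.integral_cnj)
      finally show ?thesis unfolding ip_commute[of a "pot V b"] .
    qed
  next
    fix z a
    have "L2.vec (\<lambda>x. z * L2.fn a x) = z *\<^sub>C a" using L2.vec_scale[OF L2.fn_l2, of z a] by (simp only: L2.vec_fn)
    then have "pot V (z *\<^sub>C a) = L2.vec (\<lambda>x. of_real (V x) * (z * L2.fn a x))"
      using pot_vec[OF V l2_scale[OF L2.fn_l2], of z a] by simp
    also have "\<dots> = z *\<^sub>C pot V a"
      unfolding pot_def using L2.vec_scale[OF pot_l2[OF V L2.fn_l2], of z a] by (simp add: mult.left_commute)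
    finally show "pot V (z *\<^sub>C a) = z *\<^sub>C pot V a" .
  next
    fix a
    have "(norm (pot V a))\<^sup>2 = sqn (cell \<Gamma>) (\<lambda>x. of_real (V x) * L2.fn a x)"
      unfolding pot_def by (rule norm_vec[OF pot_l2[OF V L2.fn_l2]])
    also have "\<dots> \<le> (\<integral>x. Vmax\<^sup>2 * (cmod (L2.fn a x))\<^sup>2 \<partial>cell \<Gamma>)"
      unfolding sqn_def
    proof (rule integral_mono_AE)
      show "integrable (cell \<Gamma>) (\<lambda>x. (cmod (complex_of_real (V x) * L2.fn a x))\<^sup>2)"
        using pot_l2[OF V L2.fn_l2, of a] unfolding l2_def by blast
      show "integrable (cell \<Gamma>) (\<lambda>x. Vmax\<^sup>2 * (cmod (L2.fn a x))\<^sup>2)"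
        using L2.fn_l2[of a] unfolding l2_def by (intro integrable_mult_right) blast
      show "AE x in cell \<Gamma>. (cmod (complex_of_real (V x) * L2.fn a x))\<^sup>2 \<le> Vmax\<^sup>2 * (cmod (L2.fn a x))\<^sup>2"
        using V0
      proof eventually_elim
        case (elim x)
        then have "(V x)\<^sup>2 \<le> Vmax\<^sup>2" by (intro power_mono) auto
        then show ?case by (simp add: norm_mult power_mult_distrib mult_right_mono)
      qed
    qed
    also have "\<dots> = (Vmax * norm a)\<^sup>2"
      using norm_vec[OF L2.fn_l2, of a]
      by (simp only: L2.vec_fn sqn_def power_mult_distrib integral_mult_right_zero)
    finally show "norm (pot V a) \<le> Vmax * norm a"
      by (rule power2_le_imp_le) (simp add: Vmax0)
    have "ip (pot V a) a = (\<integral>x. of_real (V x * (cmod (L2.fn a x))\<^sup>2) \<partial>cell \<Gamma>)"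
      using ip_pot[OF V L2.fn_l2 L2.fn_l2, of a a] by (simp only: L2.vec_fn of_real_mult complex_norm_square mult.assoc)
    then have "inner (pot V a) a = (\<integral>x. V x * (cmod (L2.fn a x))\<^sup>2 \<partial>cell \<Gamma>)"
      unfolding Re_ip[symmetric] integral_complex_of_real by simp
    also have "0 \<le> \<dots>"
      by (rule integral_nonneg_AE) (use V0 in \<open>eventually_elim, auto\<close>)
    finally show "0 \<le> inner (pot V a) a" .
  qed
qed

end

section \<open>Bands\<close>

text \<open>If there were more independent eigenfunctions than spanning ones, their coefficient
  matrix would admit a nontrivial relation, which holds almost everywhere because only finitely many
  null sets are involved.\<close>

lemma has_multiplicity_le:
  assumes "has_multiplicity \<Gamma> V k \<mu> n" "has_multiplicity \<Gamma> V k \<mu> n'"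
  shows "n' \<le> n"
proof (rule ccontr)
  assume "\<not> n' \<le> n"
  then have lt: "n < n'" by simp
  obtain u where span: "\<forall>w\<in>eigenspace \<Gamma> V k \<mu>. \<exists>c :: nat \<Rightarrow> complex. AE x in lebesgue. w x = (\<Sum>i<n. c i * u i x)"
    using assms(1) unfolding has_multiplicity_def by blast
  obtain u' where u': "\<forall>i<n'. u' i \<in> eigenspace \<Gamma> V k \<mu>"
    and indep: "\<forall>c :: nat \<Rightarrow> complex. (AE x in lebesgue. (\<Sum>i<n'. c i * u' i x) = 0) \<longrightarrow> (\<forall>i<n'. c i = 0)"
    using assms(2) unfolding has_multiplicity_def by blast
  have "\<forall>j. \<exists>c :: nat \<Rightarrow> complex. j < n' \<longrightarrow> (AE x in lebesgue. u' j x = (\<Sum>i<n. c i * u i x))"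
    using span u' by blast
  from choice[OF this] obtain M :: "nat \<Rightarrow> nat \<Rightarrow> complex"
    where M: "\<forall>j. j < n' \<longrightarrow> (AE x in lebesgue. u' j x = (\<Sum>i<n. M j i * u i x))" by (elim exE)
  obtain c where c: "\<exists>j\<in>{..<n'}. c j \<noteq> 0" "\<forall>i\<in>{..<n}. (\<Sum>j\<in>{..<n'}. c j * M j i) = 0"
    using linear_system_nontrivial[of "{..<n}" "{..<n'}" M] lt by auto
  have "AE x in lebesgue. \<forall>j\<in>{..<n'}. u' j x = (\<Sum>i<n. M j i * u i x)"
    using M by (intro AE_finite_allI) auto
  then have "AE x in lebesgue. (\<Sum>j<n'. c j * u' j x) = 0"
  proof eventually_elim
    case (elim x)
    then have "(\<Sum>j<n'. c j * u' j x) = (\<Sum>j<n'. \<Sum>i<n. c j * M j i * u i x)"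
      by (intro sum.cong refl) (simp add: sum_distrib_left mult.assoc)
    also have "\<dots> = (\<Sum>i<n. (\<Sum>j<n'. c j * M j i) * u i x)"
      by (subst sum.swap) (simp add: sum_distrib_right)
    also have "\<dots> = 0" using c(2) by (intro sum.neutral) simp
    finally show ?case .
  qed
  then have "\<forall>i<n'. c i = 0" using indep by blast
  then show False using c(1) by auto
qed

text \<open>If \<open>E i < E' i\<close> at the first disagreement, monotonicity confines the
  indices where \<open>E'\<close> takes the value \<open>E i\<close> to those below
  \<open>i\<close>, where the lists agree. The fibre of \<open>E\<close> contains \<open>i\<close>
  in addition, so the cardinalities differ.\<close>

lemma mono_fibre_unique:
  fixes E E' :: "nat \<Rightarrow> real"
  assumes mono: "mono E" "mono E'" and fin: "\<And>\<mu>. finite {i. E i = \<mu>}"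
    and card: "\<And>\<mu>. card {i. E i = \<mu>} = card {i. E' i = \<mu>}"
    and least: "\<And>j. j < i \<Longrightarrow> E j = E' j"
  shows "E' i \<le> E i"
proof (rule ccontr)
  assume "\<not> E' i \<le> E i"
  then have lt: "E i < E' i" by simp
  have sub: "{j. E' j = E i} \<subset> {j. E j = E i}"
  proof
    show "{j. E' j = E i} \<subseteq> {j. E j = E i}"
    proof
      fix j assume j: "j \<in> {j. E' j = E i}"
      then have "j < i" using monoD[OF mono(2), of i j] lt by (cases "i \<le> j") auto
      then show "j \<in> {j. E j = E i}" using j least by simp
    qed
    show "{j. E' j = E i} \<noteq> {j. E j = E i}"
    proof
      assume "{j. E' j = E i} = {j. E j = E i}"
      then have "i \<in> {j. E' j = E i}" by simp
      then show False using lt by simp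
    qed
  qed
  from psubset_card_mono[OF fin sub] card[of "E i"] show False by simp
qed

lemma eigenvalue_list_unique:
  assumes E: "eigenvalue_list \<Gamma> V k E" and E': "eigenvalue_list \<Gamma> V k E'"
  shows "E = E'"
proof
  have card: "card {i. E i = \<mu>} = card {i. E' i = \<mu>}" for \<mu>
    using E E' has_multiplicity_le unfolding eigenvalue_list_def by (meson order_antisym)
  fix i
  show "E i = E' i"
  proof (induction i rule: less_induct)
    case (less i)
    have "E' i \<le> E i"
      by (rule mono_fibre_unique) (use E E' card less in \<open>auto simp: eigenvalue_list_def\<close>)
    moreover have "E i \<le> E' i"
      by (rule mono_fibre_unique) (use E E' card less in \<open>auto simp: eigenvalue_list_def\<close>)
    ultimately show ?case by simp
  qed
qed

lemma imaginary_twice: "\<i> * of_real z * (\<i> * of_real z * c) = - (of_real (z\<^sup>2) * c)"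
  by (rule complex_eqI) (simp_all add: power2_eq_square algebra_simps)

text \<open>Boundedness lets the fixed vector \<open>x\<close> be truncated at a cost uniform in
  \<open>p\<close>; then only finitely many coordinates remain.\<close>

lemma weak_tendsto:
  fixes a :: "nat \<Rightarrow> ell2"
  assumes bound: "\<And>p. norm (a p) \<le> C" and coords: "\<And>n. (\<lambda>p. coord (a p) n) \<longlonglongrightarrow> coord l n"
  shows "(\<lambda>p. ip (a p) x) \<longlonglongrightarrow> ip l x"
proof (rule LIMSEQ_I)
  fix e :: real assume e: "0 < e"
  define tr where "tr N = (\<Sum>n<N. coord x n *\<^sub>C delta n)" for N
  have "(\<lambda>N. C * norm (x - tr N) + norm l * norm (x - tr N)) \<longlonglongrightarrow> C * norm (x - x) + norm l * norm (x - x)"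
    unfolding tr_def by (intro tendsto_intros truncation_tendsto)
  then have "eventually (\<lambda>N. C * norm (x - tr N) + norm l * norm (x - tr N) < e / 2) sequentially"
    using e by (intro order_tendstoD(2)) auto
  then obtain N where N: "C * norm (x - tr N) + norm l * norm (x - tr N) < e / 2"
    by (auto simp: eventually_sequentially)
  have "(\<lambda>p. ip (a p) (tr N)) \<longlonglongrightarrow> ip l (tr N)"
    unfolding tr_def ip_simps ip_delta_right by (intro tendsto_intros coords)
  then obtain P where P: "\<And>p. p \<ge> P \<Longrightarrow> norm (ip (a p) (tr N) - ip l (tr N)) < e / 2"
    using LIMSEQ_D[of _ _ "e / 2"] e by (meson half_gt_zero)
  have "norm (ip (a p) x - ip l x) < e" if "p \<ge> P" for p
  proof -
    have "ip (a p) x - ip l x = ip (a p) (x - tr N) + (ip (a p) (tr N) - ip l (tr N)) - ip l (x - tr N)"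
      by (simp add: ip_simps)
    also have "norm \<dots> \<le> norm (ip (a p) (x - tr N)) + norm (ip (a p) (tr N) - ip l (tr N)) + norm (ip l (x - tr N))"
      by norm
    finally have "norm (ip (a p) x - ip l x) \<le> \<dots>" .
    moreover have "norm (ip (a p) (x - tr N)) \<le> C * norm (x - tr N)"
      by (rule order_trans[OF norm_ip_le mult_right_mono[OF bound]]) simp
    moreover have "norm (ip l (x - tr N)) \<le> norm l * norm (x - tr N)" by (rule norm_ip_le)
    ultimately show ?thesis using N P[OF that] by linarith
  qed
  then show "\<exists>P. \<forall>p\<ge>P. norm (ip (a p) x - ip l x) < e" by blast
qed

section \<open>Eigenvalue lists and continuity of the bands\<close>

context lattice_basis
begin

definition eigvec :: "(real ^ 'd \<Rightarrow> real) \<Rightarrow> real ^ 'd \<Rightarrow> real \<Rightarrow> ell2 \<Rightarrow> bool" where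
  "eigvec V k \<mu> y \<longleftrightarrow> (\<forall>n. of_real (symb k n) * coord y n + coord (pot V y) n = of_real \<mu> * coord y n)"

text \<open>Left to right applies the multiplier rule twice. The converse has to produce the
  derivatives demanded by \<open>bloch_operator\<close>, which is elliptic regularity: the equation
  equates \<open>symb k n * coord y n\<close> with the coordinates of
  \<open>\<mu> y - pot V y\<close>, hence it is square-summable.\<close>

lemma eigenspace_iff:
  assumes V: "V \<in> admissible \<Gamma> Vmax" and Vmax: "0 \<le> Vmax"
  shows "u \<in> eigenspace \<Gamma> V k \<mu> \<longleftrightarrow> u \<in> L2_torus \<Gamma> \<and> eigvec V k \<mu> (L2.vec u)"
proof
  assume "u \<in> eigenspace \<Gamma> V k \<mu>"
  then obtain v w where u: "u \<in> L2_torus \<Gamma>" and vt: "\<And>j. v j \<in> L2_torus \<Gamma>" and wt: "\<And>j. w j \<in> L2_torus \<Gamma>"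
    and uv: "\<And>j. bloch_deriv \<Gamma> k j u (v j)" and vw: "\<And>j. bloch_deriv \<Gamma> k j (v j) (w j)"
    and ae: "AE x in lebesgue. of_real \<mu> * u x = - (\<Sum>j\<in>UNIV. w j x) + of_real (V x) * u x"
    unfolding eigenspace_def bloch_operator_def by blast
  have cw: "coord (L2.vec (w j)) n = - (of_real (((freq n + k) $ j)\<^sup>2) * coord (L2.vec u) n)" for j n
  proof -
    have "coord (L2.vec (w j)) n = (\<i> * of_real ((freq n + k) $ j)) * ((\<i> * of_real ((freq n + k) $ j)) * coord (L2.vec u) n)"
      using uv[of j] vw[of j] unfolding bloch_deriv_iff[OF u vt] bloch_deriv_iff[OF vt wt] by (simp only:)
    then show ?thesis by (simp only: imaginary_twice)
  qed
  define s where "s x = (\<Sum>j\<in>UNIV. w j x)" for x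
  have st: "s \<in> L2_torus \<Gamma>" unfolding s_def[abs_def] by (intro torus_sum wt)
  have cs: "coord (L2.vec s) n = - (of_real (symb k n) * coord (L2.vec u) n)" for n
    unfolding s_def[abs_def] using L2.vec_sum[of UNIV w] torus_l2[OF wt]
    by (simp add: cw symb_eq sum_negf sum_distrib_right del: vector_add_component)
  have nt: "(\<lambda>x. (-1) * s x) \<in> L2_torus \<Gamma>" by (rule torus_scale[OF st])
  have pt: "(\<lambda>x. of_real (V x) * u x) \<in> L2_torus \<Gamma>" by (rule pot_torus[OF V u])
  have "AE x in lebesgue. of_real \<mu> * u x = (-1) * s x + of_real (V x) * u x"
    using ae by (simp add: s_def)
  then have "L2.vec (\<lambda>x. of_real \<mu> * u x) = L2.vec (\<lambda>x. (-1) * s x + of_real (V x) * u x)"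
    using torus_vec_eq_iff[OF torus_scale[OF u] torus_add[OF nt pt]] by blast
  then have eq: "of_real \<mu> *\<^sub>C L2.vec u = (-1) *\<^sub>C L2.vec s + pot V (L2.vec u)"
    unfolding L2.vec_add[OF torus_l2[OF nt] torus_l2[OF pt]] L2.vec_scale[OF torus_l2[OF u]] L2.vec_scale[OF torus_l2[OF st]]
      pot_vec[OF V torus_l2[OF u]] .
  have "eigvec V k \<mu> (L2.vec u)"
    unfolding eigvec_def
  proof
    fix n
    from arg_cong[OF eq, of "\<lambda>y. coord y n"]
    show "of_real (symb k n) * coord (L2.vec u) n + coord (pot V (L2.vec u)) n = of_real \<mu> * coord (L2.vec u) n"
      by (simp add: cs)
  qed
  then show "u \<in> L2_torus \<Gamma> \<and> eigvec V k \<mu> (L2.vec u)" using u by blast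
next
  assume asm: "u \<in> L2_torus \<Gamma> \<and> eigvec V k \<mu> (L2.vec u)"
  then have u: "u \<in> L2_torus \<Gamma>" by blast
  define y where "y = L2.vec u"
  have y: "of_real (symb k n) * coord y n = coord (of_real \<mu> *\<^sub>C y - pot V y) n" for n
    using asm unfolding y_def eigvec_def by (simp add: eq_diff_eq)
  interpret form weight "symb k" "pot V" "2 + 2 * (norm k)\<^sup>2" Vmax
    by (rule form_pot[OF V Vmax order_refl])
  have "eig \<mu> y" using asm unfolding y_def eigvec_def eig_def by blast
  then have "y \<in> wdom (symb k)" by (intro wdom_T eig_wdom)
  then have s1: "summable (\<lambda>n. symb k n * (cmod (coord y n))\<^sup>2)" by (simp add: wdom_def)
  have s2: "summable (\<lambda>n. (cmod (of_real (symb k n) * coord y n))\<^sup>2)" unfolding y by (rule summable_coord)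
  \<comment> \<open>The derivatives are defined by their Fourier multipliers. The coefficients of
    \<open>v j\<close> are square-summable by finite energy (\<open>s1\<close>), those of
    \<open>w j\<close> by \<open>s2\<close>.\<close>
  define v where "v j = L2.fn (Ell2 (\<lambda>n. \<i> * of_real ((freq n + k) $ j) * coord y n))" for j
  define w where "w j = L2.fn (Ell2 (\<lambda>n. - (of_real (((freq n + k) $ j)\<^sup>2) * coord y n)))" for j
  have le: "((freq n + k) $ j)\<^sup>2 \<le> symb k n" for n j
    unfolding symb_eq by (rule member_le_sum) auto
  have cv: "coord (L2.vec (v j)) n = \<i> * of_real ((freq n + k) $ j) * coord y n" for j n
  proof -
    have "summable (\<lambda>n. (cmod (\<i> * of_real ((freq n + k) $ j) * coord y n))\<^sup>2)"
    proof (rule summable_comparison_test'[OF s1, of 0])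
      fix n
      show "norm ((cmod (\<i> * of_real ((freq n + k) $ j) * coord y n))\<^sup>2) \<le> symb k n * (cmod (coord y n))\<^sup>2"
        using mult_right_mono[OF le[of n j], of "(cmod (coord y n))\<^sup>2"]
        by (simp add: norm_mult power_mult_distrib del: vector_add_component)
    qed
    then show ?thesis unfolding v_def L2.vec_fn by (simp only: coord_Ell2)
  qed
  have cw: "coord (L2.vec (w j)) n = - (of_real (((freq n + k) $ j)\<^sup>2) * coord y n)" for j n
  proof -
    have "summable (\<lambda>n. (cmod (- (of_real (((freq n + k) $ j)\<^sup>2) * coord y n)))\<^sup>2)"
    proof (rule summable_comparison_test'[OF s2, of 0])
      fix n
      have "((freq n + k) $ j)\<^sup>2 * cmod (coord y n) \<le> symb k n * cmod (coord y n)"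
        by (rule mult_right_mono[OF le]) simp
      then have "(((freq n + k) $ j)\<^sup>2 * cmod (coord y n))\<^sup>2 \<le> (symb k n * cmod (coord y n))\<^sup>2"
        by (rule power_mono) simp
      then show "norm ((cmod (- (of_real (((freq n + k) $ j)\<^sup>2) * coord y n)))\<^sup>2) \<le> (cmod (of_real (symb k n) * coord y n))\<^sup>2"
        by (simp add: norm_mult T_nonneg del: of_real_power vector_add_component)
    qed
    then show ?thesis unfolding w_def L2.vec_fn by (simp only: coord_Ell2)
  qed
  have vt: "v j \<in> L2_torus \<Gamma>" and wt: "w j \<in> L2_torus \<Gamma>" for j unfolding v_def w_def by (rule torus_fn)+
  have uv: "bloch_deriv \<Gamma> k j u (v j)" for j
    unfolding bloch_deriv_iff[OF u vt] using cv by (simp only: y_def) simp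
  have vw: "bloch_deriv \<Gamma> k j (v j) (w j)" for j
    unfolding bloch_deriv_iff[OF vt wt] cv cw imaginary_twice by simp
  define s where "s x = (\<Sum>j\<in>UNIV. w j x)" for x
  have st: "s \<in> L2_torus \<Gamma>" unfolding s_def[abs_def] by (intro torus_sum wt)
  have cs: "coord (L2.vec s) n = - (of_real (symb k n) * coord y n)" for n
    unfolding s_def[abs_def] using L2.vec_sum[of UNIV w] torus_l2[OF wt]
    by (simp add: cw symb_eq sum_negf sum_distrib_right del: vector_add_component)
  have nt: "(\<lambda>x. (-1) * s x) \<in> L2_torus \<Gamma>" by (rule torus_scale[OF st])
  have pt: "(\<lambda>x. of_real (V x) * u x) \<in> L2_torus \<Gamma>" by (rule pot_torus[OF V u])
  have ut: "(\<lambda>x. of_real \<mu> * u x) \<in> L2_torus \<Gamma>" by (rule torus_scale[OF u])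
  have "of_real \<mu> *\<^sub>C y = (-1) *\<^sub>C L2.vec s + pot V y"
    by (rule ell2_eqI) (simp add: cs y)
  then have "L2.vec (\<lambda>x. of_real \<mu> * u x) = L2.vec (\<lambda>x. (-1) * s x + of_real (V x) * u x)"
    unfolding L2.vec_add[OF torus_l2[OF nt] torus_l2[OF pt]] L2.vec_scale[OF torus_l2[OF u]] L2.vec_scale[OF torus_l2[OF st]]
      pot_vec[OF V torus_l2[OF u], symmetric] y_def .
  then have "AE x in lebesgue. of_real \<mu> * u x = (-1) * s x + of_real (V x) * u x"
    using torus_vec_eq_iff[OF ut torus_add[OF nt pt]] by blast
  then have ae: "AE x in lebesgue. of_real \<mu> * u x = - (\<Sum>j\<in>UNIV. w j x) + of_real (V x) * u x"
    by (simp add: s_def)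
  show "u \<in> eigenspace \<Gamma> V k \<mu>"
    unfolding eigenspace_def bloch_operator_def mem_Collect_eq
    using u ut vt wt uv vw ae by (intro conjI exI[of _ v] exI[of _ w] allI)
qed

text \<open>The vectors with \<open>E i = \<mu>\<close> are a basis of the eigenspace, independent
  by orthonormality and spanning by \<open>spectral_eig_span\<close>. When no index has this value,
  the same argument shows that \<open>\<mu>\<close> is not an eigenvalue.\<close>

lemma eigenvalue_list_spectral:
  assumes V: "V \<in> admissible \<Gamma> Vmax" and Vmax: "0 \<le> Vmax"
    and sp: "spectral weight (symb k) (pot V) y E"
  shows "eigenvalue_list \<Gamma> V k E"
  unfolding eigenvalue_list_def
proof (intro conjI allI)
  interpret form weight "symb k" "pot V" "2 + 2 * (norm k)\<^sup>2" Vmax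
    by (rule form_pot[OF V Vmax order_refl])
  show "mono E" using sp by (simp add: spectral_def)
  fix \<mu>
  show fin: "finite {i. E i = \<mu>}"
    by (rule finite_subset[of _ "{i. E i \<le> \<mu>}"]) (use sp in \<open>auto simp: spectral_def\<close>)
  have ortho: "\<And>i j. ip (y i) (y j) = (if i = j then 1 else 0)" using sp by (simp add: spectral_def)
  obtain h where h: "bij_betw h {..<card {i. E i = \<mu>}} {i. E i = \<mu>}"
    using ex_bij_betw_nat_finite[OF fin] by (auto simp: lessThan_atLeast0)
  define N where "N = card {i. E i = \<mu>}"
  have hE: "E (h i) = \<mu>" if "i < N" for i using h that by (auto simp: bij_betw_def N_def)
  have hinj: "h i = h j \<longleftrightarrow> i = j" if "i < N" "j < N" for i j
    using h that by (auto simp: bij_betw_def N_def inj_on_def)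
  define u where "u i = L2.fn (y (h i))" for i
  have ut: "u i \<in> L2_torus \<Gamma>" for i unfolding u_def by (rule torus_fn)
  have comb: "L2.vec (\<lambda>x. \<Sum>i<N. c i * u i x) = (\<Sum>i<N. c i *\<^sub>C y (h i))" for c
  proof -
    have "L2.vec (\<lambda>x. \<Sum>i<N. c i * u i x) = (\<Sum>i<N. L2.vec (\<lambda>x. c i * u i x))"
      by (rule L2.vec_sum) (intro l2_scale torus_l2 ut)
    also have "\<dots> = (\<Sum>i<N. c i *\<^sub>C y (h i))"
      unfolding L2.vec_scale[OF torus_l2[OF ut]] unfolding u_def L2.vec_fn ..
    finally show ?thesis .
  qed
  have combt: "(\<lambda>x. \<Sum>i<N. c i * u i x) \<in> L2_torus \<Gamma>" for c by (intro torus_sum torus_scale ut)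
  show "has_multiplicity \<Gamma> V k \<mu> (card {i. E i = \<mu>})"
    unfolding has_multiplicity_def N_def[symmetric]
  proof (intro exI[of _ u] conjI allI impI ballI)
    fix i assume i: "i < N"
    have "eigvec V k \<mu> (y (h i))"
      using sp hE[OF i] unfolding eigvec_def spectral_def by auto
    then show "u i \<in> eigenspace \<Gamma> V k \<mu>"
      unfolding eigenspace_iff[OF V Vmax] using ut[of i] by (simp add: u_def L2.vec_fn)
  next
    fix c i assume ae: "AE x in lebesgue. (\<Sum>i<N. c i * u i x) = 0" and i: "i < N"
    have "L2.vec (\<lambda>x. \<Sum>i<N. c i * u i x) = L2.vec (\<lambda>x. 0)"
      using torus_vec_eq_iff[OF combt torus_zero] ae by blast
    then have z: "(\<Sum>i<N. c i *\<^sub>C y (h i)) = 0" unfolding comb L2.vec_zero .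
    have "ip (\<Sum>i<N. c i *\<^sub>C y (h i)) (y (h i)) = (\<Sum>j<N. if j = i then c j else 0)"
      unfolding ip_simps using hinj i by (intro sum.cong) (auto simp: ortho)
    also have "\<dots> = c i" by (subst sum.delta) (use i in auto)
    finally show "c i = 0" unfolding z by (simp add: ip_simps)
  next
    fix w assume "w \<in> eigenspace \<Gamma> V k \<mu>"
    then have wt: "w \<in> L2_torus \<Gamma>" and we: "eig \<mu> (L2.vec w)"
      unfolding eigenspace_iff[OF V Vmax] eigvec_def eig_def by auto
    define c where "c i = ip (L2.vec w) (y (h i))" for i
    have "L2.vec w = (\<Sum>i\<in>{i. E i = \<mu>}. ip (L2.vec w) (y i) *\<^sub>C y i)"
      by (rule spectral_eig_span[OF sp we])
    also have "\<dots> = (\<Sum>i<N. c i *\<^sub>C y (h i))"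
      unfolding c_def N_def by (rule sum.reindex_bij_betw[OF h, symmetric])
    also have "\<dots> = L2.vec (\<lambda>x. \<Sum>i<N. c i * u i x)" unfolding comb ..
    finally show "\<exists>c :: nat \<Rightarrow> complex. AE x in lebesgue. w x = (\<Sum>i<N. c i * u i x)"
      using torus_vec_eq_iff[OF wt combt] by blast
  qed
qed

text \<open>Uniqueness of the list resolves the definite description; the shift reconciles bands
  counted from 1 with lists indexed from 0.\<close>

lemma band_spectral:
  assumes V: "V \<in> admissible \<Gamma> Vmax" and Vmax: "0 \<le> Vmax"
  obtains y E where "spectral weight (symb k) (pot V) y E" "\<And>m. band \<Gamma> V m k = E (m - 1)"
proof -
  interpret form weight "symb k" "pot V" "2 + 2 * (norm k)\<^sup>2" Vmax
    by (rule form_pot[OF V Vmax order_refl])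
  obtain y E where sp: "spectral weight (symb k) (pot V) y E" using spectral_exists by blast
  have E: "eigenvalue_list \<Gamma> V k E" by (rule eigenvalue_list_spectral[OF V Vmax sp])
  have "(THE E. eigenvalue_list \<Gamma> V k E) = E"
    by (rule the_equality[of "eigenvalue_list \<Gamma> V k", OF E]) (rule eigenvalue_list_unique[OF _ E])
  then show ?thesis using that[OF sp] by (simp add: band_def)
qed

lemma vec_wave: "L2.vec (wave n) = delta n"
  by (rule ell2_eqI) (simp add: L2.coord_vec L2.e_l2 L2.e_ortho)

text \<open>Expanding the square around \<open>freq n + k\<close> leaves a cross term linear in
  \<open>freq n\<close>, absorbed by \<open>weight n\<close> because \<open>t \<le> 1 + t^2\<close>.
  The coefficient vanishes as \<open>k'\<close> tends to \<open>k\<close>, which is the uniformity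
  that \<open>spectral_tendsto\<close> asks for.\<close>

lemma symb_le:
  "symb k' n \<le> symb k n + (2 * (1 + norm k) * norm (k' - k) + (norm (k' - k))\<^sup>2) * weight n"
proof -
  define d where "d = k' - k"
  have w1: "1 \<le> weight n" by (simp add: weight_def)
  have fw: "norm (freq n) \<le> weight n"
    using sum_squares_bound[of "norm (freq n)" 1] norm_ge_zero[of "freq n"]
    unfolding weight_def by (simp only: mult_1_right power_one)
  have "symb k' n = (norm ((freq n + k) + d))\<^sup>2" by (simp add: symb_def d_def)
  also have "\<dots> = symb k n + 2 * ((freq n + k) \<bullet> d) + (norm d)\<^sup>2"
    by (simp add: symb_def power2_norm_eq_inner inner_add_left inner_add_right inner_commute)
  also have "(freq n + k) \<bullet> d \<le> norm (freq n + k) * norm d" by (rule norm_cauchy_schwarz)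
  also have "norm (freq n + k) * norm d \<le> ((1 + norm k) * weight n) * norm d"
  proof (rule mult_right_mono)
    have "norm (freq n + k) \<le> norm (freq n) + norm k" by (rule norm_triangle_ineq)
    also have "\<dots> \<le> weight n + norm k * weight n"
      using fw mult_left_mono[OF w1 norm_ge_zero[of k]] by simp
    finally show "norm (freq n + k) \<le> (1 + norm k) * weight n" by (simp add: algebra_simps)
  qed simp
  finally have "symb k' n \<le> symb k n + 2 * (((1 + norm k) * weight n) * norm d) + (norm d)\<^sup>2" by simp
  moreover have "(norm d)\<^sup>2 \<le> (norm d)\<^sup>2 * weight n" using mult_left_mono[OF w1, of "(norm d)\<^sup>2"] by simp
  ultimately show ?thesis by (simp add: d_def algebra_simps)
qed

lemma band_tendsto:
  assumes U: "\<And>p. U p \<in> admissible \<Gamma> Vmax" and V: "V \<in> admissible \<Gamma> Vmax" and Vmax: "0 \<le> Vmax"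
    and entries: "\<And>n m. (\<lambda>p. ip (pot (U p) (delta n)) (delta m)) \<longlonglongrightarrow> ip (pot V (delta n)) (delta m)"
    and k: "\<kappa> \<longlonglongrightarrow> k"
  shows "(\<lambda>p. band \<Gamma> (U p) m (\<kappa> p)) \<longlonglongrightarrow> band \<Gamma> V m k"
proof -
  \<comment> \<open>Convergent quasi-momenta are bounded, so a single \<open>R\<close> gives all the
    forms the same constants.\<close>
  obtain R where R: "\<And>p. norm (\<kappa> p) \<le> R"
    using convergent_imp_Bseq[OF convergentI[OF k]] by (auto simp: Bseq_def)
  have kR: "norm k \<le> R" by (rule LIMSEQ_le_const2[OF tendsto_norm[OF k]]) (use R in auto)
  note forms = form_pot[OF U Vmax R] and form' = form_pot[OF V Vmax kR]
  have "\<exists>yE. spectral weight (symb (\<kappa> p)) (pot (U p)) (fst yE) (snd yE) \<and> (\<forall>m. band \<Gamma> (U p) m (\<kappa> p) = snd yE (m - 1))" for p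
    using band_spectral[OF U Vmax, of "\<kappa> p" p] by (metis fst_conv snd_conv)
  then have "\<forall>p. \<exists>yE. spectral weight (symb (\<kappa> p)) (pot (U p)) (fst yE) (snd yE) \<and> (\<forall>m. band \<Gamma> (U p) m (\<kappa> p) = snd yE (m - 1))" by blast
  from choice[OF this] obtain yE where yE: "\<And>p. spectral weight (symb (\<kappa> p)) (pot (U p)) (fst (yE p)) (snd (yE p))"
    "\<And>p m. band \<Gamma> (U p) m (\<kappa> p) = snd (yE p) (m - 1)" by blast
  obtain y E where sp: "spectral weight (symb k) (pot V) y E" "\<And>m. band \<Gamma> V m k = E (m - 1)"
    by (rule band_spectral[OF V Vmax]) blast
  define \<epsilon> where "\<epsilon> p = 2 * (1 + norm k) * norm (\<kappa> p - k) + (norm (\<kappa> p - k))\<^sup>2" for p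
  have "\<epsilon> \<longlonglongrightarrow> 2 * (1 + norm k) * norm (k - k) + (norm (k - k))\<^sup>2"
    unfolding \<epsilon>_def by (intro tendsto_intros k)
  then have eps: "\<epsilon> \<longlonglongrightarrow> 0" by simp
  have "(\<lambda>p. snd (yE p) (m - 1)) \<longlonglongrightarrow> E (m - 1)"
  proof (rule spectral_tendsto[OF forms form' _ _ _ eps yE(1) sp(1)])
    show "(\<lambda>p. ip (pot (U p) x) y) \<longlonglongrightarrow> ip (pot V x) y" for x y
      by (rule weak_from_entries[OF forms form' entries])
    show "(\<lambda>p. symb (\<kappa> p) n) \<longlonglongrightarrow> symb k n" for n
      unfolding symb_def by (intro tendsto_intros k)
    show "symb (\<kappa> p) n \<le> symb k n + \<epsilon> p * weight n" for p n
      unfolding \<epsilon>_def by (rule symb_le)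
  qed
  then show ?thesis by (simp add: yE(2) sp(2))
qed

interpretation recip: lattice_basis "\<lambda>i. (2 * pi) *\<^sub>R b i" "\<lambda>i. (1 / (2 * pi)) *\<^sub>R a i" "dual_lattice \<Gamma>"
  by (rule dual_lattice_basis)

lemma brillouin_compact: "compact (brillouin_zone \<Gamma>)"
  unfolding brillouin_zone_def by (rule recip.compact_voronoi)

lemma brillouin_nonempty: "brillouin_zone \<Gamma> \<noteq> {}"
  unfolding brillouin_zone_def using recip.nearest[of 0] by blast

text \<open>This is \<open>band_tendsto\<close> for a constant sequence of potentials.\<close>

lemma band_continuous:
  assumes V: "V \<in> admissible \<Gamma> Vmax" and Vmax: "0 \<le> Vmax"
  shows "continuous_on (brillouin_zone \<Gamma>) (band \<Gamma> V m)"
  unfolding continuous_on_sequentially comp_def using band_tendsto[OF V V Vmax tendsto_const] by blast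

text \<open>Continuity on the compact zone makes the maximum attained, so \<open>GREATEST\<close>
  denotes it.\<close>

lemma band_top:
  assumes V: "V \<in> admissible \<Gamma> Vmax" and Vmax: "0 \<le> Vmax"
  shows "\<exists>k\<in>brillouin_zone \<Gamma>. band_top \<Gamma> V m = band \<Gamma> V m k"
    "k \<in> brillouin_zone \<Gamma> \<Longrightarrow> band \<Gamma> V m k \<le> band_top \<Gamma> V m"
proof -
  obtain k0 where k0: "k0 \<in> brillouin_zone \<Gamma>" "\<And>k. k \<in> brillouin_zone \<Gamma> \<Longrightarrow> band \<Gamma> V m k \<le> band \<Gamma> V m k0"
    using continuous_attains_sup[OF brillouin_compact brillouin_nonempty band_continuous[OF V Vmax]] by blast
  have "band_top \<Gamma> V m = band \<Gamma> V m k0"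
    unfolding band_top_def by (rule Greatest_equality) (use k0 in auto)
  then show "\<exists>k\<in>brillouin_zone \<Gamma>. band_top \<Gamma> V m = band \<Gamma> V m k"
    "k \<in> brillouin_zone \<Gamma> \<Longrightarrow> band \<Gamma> V m k \<le> band_top \<Gamma> V m" using k0 by auto
qed

lemma next_band_bottom:
  assumes V: "V \<in> admissible \<Gamma> Vmax" and Vmax: "0 \<le> Vmax"
  shows "\<exists>k\<in>brillouin_zone \<Gamma>. next_band_bottom \<Gamma> V m = band \<Gamma> V (m + 1) k"
    "k \<in> brillouin_zone \<Gamma> \<Longrightarrow> next_band_bottom \<Gamma> V m \<le> band \<Gamma> V (m + 1) k"
proof -
  obtain k0 where k0: "k0 \<in> brillouin_zone \<Gamma>" "\<And>k. k \<in> brillouin_zone \<Gamma> \<Longrightarrow> band \<Gamma> V (m + 1) k0 \<le> band \<Gamma> V (m + 1) k"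
    using continuous_attains_inf[OF brillouin_compact brillouin_nonempty band_continuous[OF V Vmax]] by blast
  have "next_band_bottom \<Gamma> V m = band \<Gamma> V (m + 1) k0"
    unfolding next_band_bottom_def by (rule Least_equality) (use k0 in auto)
  then show "\<exists>k\<in>brillouin_zone \<Gamma>. next_band_bottom \<Gamma> V m = band \<Gamma> V (m + 1) k"
    "k \<in> brillouin_zone \<Gamma> \<Longrightarrow> next_band_bottom \<Gamma> V m \<le> band \<Gamma> V (m + 1) k" using k0 by auto
qed

lemma band_nonneg:
  assumes V: "V \<in> admissible \<Gamma> Vmax" and Vmax: "0 \<le> Vmax"
  shows "0 \<le> band \<Gamma> V m k"
proof -
  interpret form weight "symb k" "pot V" "2 + 2 * (norm k)\<^sup>2" Vmax
    by (rule form_pot[OF V Vmax order_refl])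
  obtain y E where sp: "spectral weight (symb k) (pot V) y E" "\<And>m. band \<Gamma> V m k = E (m - 1)"
    by (rule band_spectral[OF V Vmax]) blast
  define i where "i = m - 1"
  have y: "y i \<in> wdom weight" "eig (E i) (y i)" "ip (y i) (y i) = 1"
    using sp(1) by (auto simp: spectral_def eig_def)
  then have "(norm (y i))\<^sup>2 = 1" by (simp add: ip_self flip: of_real_power)
  then have "E i = fq (symb k) (pot V) (y i)" using fq_eig[OF y(2)] by simp
  then show ?thesis using fq_nonneg[OF y(1)] sp(2)[of m] by (simp add: i_def)
qed

text \<open>Off the dual lattice no frequency cancels \<open>k\<close>, so every kinetic entry is
  positive and a unit eigenvector has positive energy even if the potential vanishes.\<close>

lemma band_pos:
  assumes V: "V \<in> admissible \<Gamma> Vmax" and Vmax: "0 \<le> Vmax" and k: "k \<notin> dual_lattice \<Gamma>"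
  shows "0 < band \<Gamma> V m k"
proof -
  interpret form weight "symb k" "pot V" "2 + 2 * (norm k)\<^sup>2" Vmax
    by (rule form_pot[OF V Vmax order_refl])
  obtain y E where sp: "spectral weight (symb k) (pot V) y E" "\<And>m. band \<Gamma> V m k = E (m - 1)"
    by (rule band_spectral[OF V Vmax]) blast
  define i where "i = m - 1"
  have y: "y i \<in> wdom weight" "eig (E i) (y i)" "ip (y i) (y i) = 1"
    using sp(1) by (auto simp: spectral_def eig_def)
  have n1: "(norm (y i))\<^sup>2 = 1" using y(3) by (simp add: ip_self flip: of_real_power)
  have symb_pos: "0 < symb k n" for n
  proof -
    have "freq n + k \<noteq> 0"
    proof
      assume "freq n + k = 0"
      then have "k = - freq n" by (simp add: eq_neg_iff_add_eq_0 add.commute)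
      then show False using k recip.uminus_mem[OF freq_mem] by simp
    qed
    then show ?thesis by (simp add: symb_def)
  qed
  have "y i \<noteq> 0" using n1 by auto
  then obtain n where n: "coord (y i) n \<noteq> 0" using ell2_eqI[of "y i" 0] by auto
  have s: "summable (\<lambda>n. symb k n * (cmod (coord (y i) n))\<^sup>2)" using wdom_T[OF y(1)] by (simp add: wdom_def)
  have "0 < kin (symb k) (y i)"
    unfolding kin_def using n symb_pos by (intro suminf_pos2[OF s, of n]) (auto simp: less_imp_le)
  also have "\<dots> \<le> fq (symb k) (pot V) (y i)" using A_pos by (simp add: fq_def)
  also have "\<dots> = E i" using fq_eig[OF y(2)] n1 by simp
  finally show ?thesis using sp(2)[of m] by (simp add: i_def)
qed

text \<open>The zone contains a point off the dual lattice: a ball is uncountable while the lattice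
  is countable, and moving a point into the zone by a lattice vector keeps it off the
  lattice.\<close>

lemma band_top_pos:
  assumes V: "V \<in> admissible \<Gamma> Vmax" and Vmax: "0 \<le> Vmax"
  shows "0 < band_top \<Gamma> V m"
proof -
  have "uncountable (ball (0 :: real ^ 'd) 1)" by (rule uncountable_ball) simp
  then obtain x where x: "x \<notin> dual_lattice \<Gamma>" using countable_subset[OF _ recip.countable_lattice] by blast
  obtain X where X: "X \<in> dual_lattice \<Gamma>" "x + X \<in> brillouin_zone \<Gamma>"
    using recip.nearest[of x] by (auto simp: brillouin_zone_def)
  have "x + X \<notin> dual_lattice \<Gamma>" using recip.diff_mem[OF _ X(1), of "x + X"] x by auto
  then show ?thesis using band_pos[OF V Vmax] band_top(2)[OF V Vmax X(2)] by (meson less_le_trans)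
qed

section \<open>Weak compactness of the admissible potentials\<close>

lemma AE_nonneg_of_integral:
  fixes w :: "real ^ 'd \<Rightarrow> real"
  assumes w: "integrable (cell \<Gamma>) w" and nonneg: "0 \<le> (\<integral>x. w x * indicator {x. w x < 0} x \<partial>cell \<Gamma>)"
  shows "AE x in cell \<Gamma>. 0 \<le> w x"
proof -
  \<comment> \<open>Testing \<open>w\<close> on its own negativity set gives minus the integral of
    its negative part, which the hypothesis forces to be zero.\<close>
  have eq: "w x * indicator {x. w x < 0} x = - max 0 (- w x)" for x by (simp add: indicator_def)
  have int: "integrable (cell \<Gamma>) (\<lambda>x. max 0 (- w x))" using w by (intro integrable_max) auto
  have "0 \<le> (\<integral>x. max 0 (- w x) \<partial>cell \<Gamma>)" by (rule Bochner_Integration.integral_nonneg) simp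
  then have "(\<integral>x. max 0 (- w x) \<partial>cell \<Gamma>) = 0" using nonneg unfolding eq Bochner_Integration.integral_minus by linarith
  then have "AE x in cell \<Gamma>. max 0 (- w x) = 0"
    by (subst (asm) integral_nonneg_eq_0_iff_AE[OF int]) auto
  then show ?thesis by eventually_elim linarith
qed

lemma admissible_l2:
  assumes "V \<in> admissible \<Gamma> Vmax"
  shows "(\<lambda>x. complex_of_real (V x)) \<in> l2 (cell \<Gamma>)"
  using pot_l2[OF assms l2_bounded[of "\<lambda>_. 1" 1]] by simp

lemma ip_pot_delta:
  assumes "V \<in> admissible \<Gamma> Vmax"
  shows "ip (pot V (delta n)) (delta m) = l2ip (cell \<Gamma>) (\<lambda>x. of_real (V x)) (\<lambda>x. cnj (wave n x) * wave m x)"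
  unfolding vec_wave[symmetric] ip_pot[OF assms wave_l2 wave_l2] l2ip_def by (simp add: mult.assoc)

text \<open>Coordinatewise convergence of the bounded Fourier coefficients amounts to weak
  convergence of the potentials in \<open>L^2\<close>. The pointwise constraints survive because
  each is tested by integrating over the set where the limit would violate it, and the matrix
  entries converge because they pair the potential with a product of two waves.\<close>

lemma admissible_weakly_compact:
  assumes U: "\<And>p. U p \<in> admissible \<Gamma> Vmax" and Vmax: "0 \<le> Vmax"
  shows "\<exists>r V. strict_mono (r :: nat \<Rightarrow> nat) \<and> V \<in> admissible \<Gamma> Vmax \<and>
    (\<forall>n m. (\<lambda>p. ip (pot (U (r p)) (delta n)) (delta m)) \<longlonglongrightarrow> ip (pot V (delta n)) (delta m))"
proof -
  define a' where "a' p = L2.vec (\<lambda>x. of_real (U p x))" for p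
  have Ul: "(\<lambda>x. complex_of_real (U p x)) \<in> l2 (cell \<Gamma>)" for p by (rule admissible_l2[OF U])
  have UAE: "AE x in cell \<Gamma>. 0 \<le> U p x \<and> U p x \<le> Vmax" for p
    unfolding AE_cell using admissibleD(3)[OF U] by eventually_elim auto
  obtain C where C: "\<And>p. norm (a' p) \<le> C"
  proof
    fix p
    have one: "(\<lambda>_. 1) \<in> l2 (cell \<Gamma>)" by (rule l2_bounded[of _ 1]) auto
    have "a' p = pot (U p) (L2.vec (\<lambda>_. 1))" unfolding a'_def using pot_vec[OF U one] by simp
    then show "norm (a' p) \<le> Vmax * norm (L2.vec (\<lambda>_. 1))"
      using form.A_bound[OF form_pot[OF U Vmax order_refl[of "norm (0 :: real ^ 'd)"]]] by simp
  qed
  have "norm (coord (a' p) n) \<le> C" for p n using norm_coord_le[of "a' p" n] C[of p] by linarith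
  then obtain r where r: "strict_mono r" "\<And>n. \<exists>l. (\<lambda>p. coord (a' (r p)) n) \<longlonglongrightarrow> l"
    using function_convergent_subsequence[of UNIV "\<lambda>p n. coord (a' p) n" C] by (metis UNIV_I countableI_type)
  then obtain f where f: "\<And>n. (\<lambda>p. coord (a' (r p)) n) \<longlonglongrightarrow> f n" by metis
  \<comment> \<open>With all diagonal entries equal to 1, \<open>kin\<close> is the squared norm,
    and \<open>kin_Fatou\<close> makes the limit coefficients square-summable.\<close>
  have "summable (\<lambda>n. 1 * (cmod (f n))\<^sup>2)"
  proof (rule kin_Fatou(1)[of "\<lambda>p. a' (r p)" f "\<lambda>_ _. 1" _ "\<lambda>_. C\<^sup>2" "C\<^sup>2"])
    show "kin (\<lambda>_. 1) (a' (r p)) \<le> C\<^sup>2" for p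
      unfolding kin_def using C[of "r p"] by (simp add: norm_square_ell2[symmetric] power_mono)
  qed (auto simp: f wdom_def summable_coord)
  then have fs: "summable (\<lambda>n. (cmod (f n))\<^sup>2)" by simp
  define l where "l = Ell2 f"
  have l: "coord l = f" unfolding l_def by (rule coord_Ell2[OF fs])
  define g where "g = L2.fn l"
  have gl: "g \<in> l2 (cell \<Gamma>)" and gt: "g \<in> L2_torus \<Gamma>" unfolding g_def by (rule L2.fn_l2 torus_fn)+
  have weak: "(\<lambda>p. l2ip (cell \<Gamma>) (\<lambda>x. of_real (U (r p) x)) h) \<longlonglongrightarrow> l2ip (cell \<Gamma>) g h" if h: "h \<in> l2 (cell \<Gamma>)" for h
  proof -
    have "(\<lambda>p. ip (a' (r p)) (L2.vec h)) \<longlonglongrightarrow> ip l (L2.vec h)"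
      by (rule weak_tendsto[of _ C]) (use C f l in auto)
    moreover have "l2ip (cell \<Gamma>) g h = ip l (L2.vec h)"
      unfolding L2.parseval[OF gl h] unfolding g_def L2.vec_fn ..
    moreover have "l2ip (cell \<Gamma>) (\<lambda>x. of_real (U p x)) h = ip (a' p) (L2.vec h)" for p
      unfolding a'_def by (rule L2.parseval[OF Ul h])
    ultimately show ?thesis by (simp only:)
  qed
  have gm [measurable]: "g \<in> borel_measurable (cell \<Gamma>)" using gl by (rule l2_measurable)
  have gi: "integrable (cell \<Gamma>) g" by (rule l2_integrable_cell[OF gl])
  have Ui: "integrable (cell \<Gamma>) (\<lambda>x. complex_of_real (U p x))" for p by (rule l2_integrable_cell[OF Ul])
  have test: "(\<lambda>p. \<integral>x. U (r p) x * indicator A x \<partial>cell \<Gamma>) \<longlonglongrightarrow> (\<integral>x. Re (g x) * indicator A x \<partial>cell \<Gamma>)"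
    "(\<integral>x. Im (g x) * indicator A x \<partial>cell \<Gamma>) = 0" if A: "(\<lambda>x. indicator A x :: real) \<in> borel_measurable (cell \<Gamma>)" for A
  proof -
    define h where "h x = complex_of_real (indicator A x)" for x
    have hm: "h \<in> borel_measurable (cell \<Gamma>)" unfolding h_def using A by measurable
    have h: "h \<in> l2 (cell \<Gamma>)"
      by (rule l2_bounded[OF hm, of 1]) (simp add: h_def indicator_def)
    have eq: "l2ip (cell \<Gamma>) (\<lambda>x. of_real (U p x)) h = of_real (\<integral>x. U p x * indicator A x \<partial>cell \<Gamma>)" for p
      unfolding l2ip_def h_def integral_complex_of_real[symmetric] by simp
    have gh: "integrable (cell \<Gamma>) (\<lambda>x. g x * cnj (h x))" by (rule l2_integrable_mult[OF gl h])
    have R: "Re (l2ip (cell \<Gamma>) g h) = (\<integral>x. Re (g x) * indicator A x \<partial>cell \<Gamma>)"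
      unfolding l2ip_def integral_Re[OF gh, symmetric] by (simp add: h_def)
    have I: "Im (l2ip (cell \<Gamma>) g h) = (\<integral>x. Im (g x) * indicator A x \<partial>cell \<Gamma>)"
      unfolding l2ip_def integral_Im[OF gh, symmetric] by (simp add: h_def)
    from tendsto_Re[OF weak[OF h]]
    show "(\<lambda>p. \<integral>x. U (r p) x * indicator A x \<partial>cell \<Gamma>) \<longlonglongrightarrow> (\<integral>x. Re (g x) * indicator A x \<partial>cell \<Gamma>)"
      unfolding eq R by simp
    from tendsto_Im[OF weak[OF h]] show "(\<integral>x. Im (g x) * indicator A x \<partial>cell \<Gamma>) = 0"
      unfolding eq I by (simp add: LIMSEQ_const_iff)
  qed
  have Am: "(\<lambda>x. indicator {x. w x < 0} x :: real) \<in> borel_measurable (cell \<Gamma>)"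
    if [measurable]: "w \<in> borel_measurable (cell \<Gamma>)" for w :: "real ^ 'd \<Rightarrow> real"
  proof -
    have "(\<lambda>x. indicator {x. w x < 0} x :: real) = (\<lambda>x. if w x < 0 then 1 else 0)" by (auto simp: indicator_def)
    then show ?thesis by simp
  qed
  have Re0: "AE x in cell \<Gamma>. 0 \<le> Re (g x)"
  proof (rule AE_nonneg_of_integral)
    show "integrable (cell \<Gamma>) (\<lambda>x. Re (g x))" using gi by simp
    show "0 \<le> (\<integral>x. Re (g x) * indicator {x. Re (g x) < 0} x \<partial>cell \<Gamma>)"
    proof (rule LIMSEQ_le_const[OF test(1)[OF Am]])
      have "0 \<le> (\<integral>x. U (r p) x * indicator {x. Re (g x) < 0} x \<partial>cell \<Gamma>)" for p
      proof (rule integral_nonneg_AE)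
        show "AE x in cell \<Gamma>. 0 \<le> U (r p) x * indicator {x. Re (g x) < 0} x"
          using UAE[of "r p"] by eventually_elim simp
      qed
      then show "\<exists>N. \<forall>p\<ge>N. 0 \<le> (\<integral>x. U (r p) x * indicator {x. Re (g x) < 0} x \<partial>cell \<Gamma>)" by blast
    qed measurable
  qed
  have Re1: "AE x in cell \<Gamma>. 0 \<le> Vmax - Re (g x)"
  proof (rule AE_nonneg_of_integral)
    let ?A = "{x. Vmax - Re (g x) < 0}"
    have Am': "(\<lambda>x. indicator ?A x :: real) \<in> borel_measurable (cell \<Gamma>)" by (rule Am) measurable
    have Ai: "integrable (cell \<Gamma>) (\<lambda>x. Vmax * indicator ?A x)"
      by (rule integrable_cell_bounded[of _ "\<bar>Vmax\<bar>"]) (use Am' in \<open>auto simp: indicator_def\<close>)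
    have Ri: "integrable (cell \<Gamma>) (\<lambda>x. w x * indicator ?A x)" if "integrable (cell \<Gamma>) w" for w :: "real ^ 'd \<Rightarrow> real"
    proof (rule Bochner_Integration.integrable_bound[OF that])
      show "(\<lambda>x. w x * indicator ?A x) \<in> borel_measurable (cell \<Gamma>)"
        using borel_measurable_integrable[OF that] Am' by measurable
    qed (simp add: indicator_def)
    show "integrable (cell \<Gamma>) (\<lambda>x. Vmax - Re (g x))"
      using gi integrable_cell_bounded[of "\<lambda>_. Vmax" "\<bar>Vmax\<bar>"] by (intro Bochner_Integration.integrable_diff) auto
    have eq: "(\<integral>x. (Vmax - w x) * indicator ?A x \<partial>cell \<Gamma>) = (\<integral>x. Vmax * indicator ?A x \<partial>cell \<Gamma>) - (\<integral>x. w x * indicator ?A x \<partial>cell \<Gamma>)"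
      if "integrable (cell \<Gamma>) w" for w :: "real ^ 'd \<Rightarrow> real"
      unfolding left_diff_distrib by (rule Bochner_Integration.integral_diff[OF Ai Ri[OF that]])
    have Ur: "integrable (cell \<Gamma>) (U p)" for p using Ui[of p] by (simp add: complex_of_real_integrable_eq)
    have lim: "(\<lambda>p. \<integral>x. (Vmax - U (r p) x) * indicator ?A x \<partial>cell \<Gamma>) \<longlonglongrightarrow> (\<integral>x. (Vmax - Re (g x)) * indicator ?A x \<partial>cell \<Gamma>)"
      unfolding eq[OF Ur] eq[OF integrable_Re[OF gi]] by (intro tendsto_diff tendsto_const test(1)[OF Am'])
    show "0 \<le> (\<integral>x. (Vmax - Re (g x)) * indicator ?A x \<partial>cell \<Gamma>)"
    proof (rule LIMSEQ_le_const[OF lim])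
      have "0 \<le> (\<integral>x. (Vmax - U (r p) x) * indicator ?A x \<partial>cell \<Gamma>)" for p
      proof (rule integral_nonneg_AE)
        show "AE x in cell \<Gamma>. 0 \<le> (Vmax - U (r p) x) * indicator ?A x"
          using UAE[of "r p"] by eventually_elim simp
      qed
      then show "\<exists>N. \<forall>p\<ge>N. 0 \<le> (\<integral>x. (Vmax - U (r p) x) * indicator ?A x \<partial>cell \<Gamma>)" by blast
    qed
  qed
  have Im0: "AE x in cell \<Gamma>. 0 \<le> Im (g x)"
    by (rule AE_nonneg_of_integral) (use gi test(2)[OF Am, of "\<lambda>x. Im (g x)"] in auto)
  have Im1: "AE x in cell \<Gamma>. 0 \<le> - Im (g x)"
    by (rule AE_nonneg_of_integral) (use gi test(2)[OF Am, of "\<lambda>x. - Im (g x)"] in auto)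
  \<comment> \<open>\<open>g\<close> is known to satisfy the constraints only almost everywhere on
    the cell; clamping its real part gives values in \<open>{0..Vmax}\<close> everywhere and keeps
    the periodicity of \<open>g\<close>.\<close>
  define V where "V x = max 0 (min Vmax (Re (g x)))" for x
  have Vg: "AE x in cell \<Gamma>. complex_of_real (V x) = g x"
    using Re0 Re1 Im0 Im1 by eventually_elim (auto simp: V_def complex_eq_iff)
  have V: "V \<in> admissible \<Gamma> Vmax"
    unfolding admissible_def
  proof (intro CollectI conjI)
    have [measurable]: "g \<in> borel_measurable lebesgue" using gt by (simp add: L2_torus_iff)
    show "V \<in> borel_measurable lebesgue" unfolding V_def by measurable
    have "AE x in lebesgue. \<forall>X\<in>\<Gamma>. g (x + X) = g x" using gt by (simp add: L2_torus_iff)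
    then show "AE x in lebesgue. (\<forall>X\<in>\<Gamma>. V (x + X) = V x) \<and> V x \<in> {0..Vmax}"
      by eventually_elim (use Vmax in \<open>auto simp: V_def\<close>)
  qed
  have "(\<lambda>p. ip (pot (U (r p)) (delta n)) (delta m)) \<longlonglongrightarrow> ip (pot V (delta n)) (delta m)" for n m
  proof -
    define h where "h x = cnj (wave n x) * wave m x" for x
    have h: "h \<in> l2 (cell \<Gamma>)"
    proof (rule l2_bounded[of _ "1 / sqrt vol * (1 / sqrt vol)"])
      have [measurable]: "wave n \<in> borel_measurable (cell \<Gamma>)" "wave m \<in> borel_measurable (cell \<Gamma>)"
        by (auto intro: measurable_cell_borel)
      show "h \<in> borel_measurable (cell \<Gamma>)" unfolding h_def by measurable
      show "cmod (h x) \<le> 1 / sqrt vol * (1 / sqrt vol)" for x by (simp add: h_def norm_mult norm_wave)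
    qed
    have hm [measurable]: "h \<in> borel_measurable (cell \<Gamma>)" using h by (rule l2_measurable)
    have [measurable]: "(\<lambda>x. complex_of_real (V x)) \<in> borel_measurable (cell \<Gamma>)"
      by (rule measurable_cell[OF admissible_complex_measurable[OF V]])
    have "l2ip (cell \<Gamma>) g h = l2ip (cell \<Gamma>) (\<lambda>x. of_real (V x)) h"
      unfolding l2ip_def
    proof (rule integral_cong_AE)
      show "AE x in cell \<Gamma>. g x * cnj (h x) = of_real (V x) * cnj (h x)" using Vg by eventually_elim simp
    qed measurable
    then show ?thesis
      unfolding ip_pot_delta[OF U] ip_pot_delta[OF V] h_def[symmetric] using weak[OF h] by simp
  qed
  with r(1) V show ?thesis by blast
qed

end

section \<open>Monotonicity of the gap ratio and the maximiser\<close>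

lemma gap_ratio_mono:
  fixes x y \<alpha> \<beta> :: real
  assumes "0 < x" "x \<le> \<alpha>" "0 \<le> \<beta>" "\<beta> \<le> y"
  shows "(\<beta> - \<alpha>) / ((\<alpha> + \<beta>) / 2) \<le> (y - x) / ((x + y) / 2)"
proof -
  have pos: "0 < \<alpha> + \<beta>" "0 < x + y" using assms by auto
  \<comment> \<open>After cross-multiplication and cancellation the claim reduces to this
    inequality.\<close>
  have "x * \<beta> \<le> \<alpha> * y" using assms by (intro mult_mono) auto
  then have "(\<beta> - \<alpha>) * (x + y) \<le> (y - x) * (\<alpha> + \<beta>)" by (simp add: algebra_simps)
  then show ?thesis using pos by (simp add: divide_simps) (simp add: algebra_simps)
qed

theorem theorem1p1:
  fixes \<Gamma> :: "(real ^ 'd) set" and m :: nat and Vmax :: real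
  assumes "bravais_lattice \<Gamma>" and "m \<ge> 1" and "Vmax > 0"
  shows "\<exists>Vopt\<in>admissible \<Gamma> Vmax.
           ereal (gap_to_midgap \<Gamma> m Vopt) = (SUP V\<in>admissible \<Gamma> Vmax. ereal (gap_to_midgap \<Gamma> m V))"
proof -
  obtain a b where "lattice_basis a b \<Gamma>" using bravais_lattice_basis[OF assms(1)] by blast
  then interpret lattice_basis a b \<Gamma> .
  have Vmax: "0 \<le> Vmax" using assms(3) by simp
  let ?G = "\<lambda>V. ereal (gap_to_midgap \<Gamma> m V)"
  let ?S = "SUP V\<in>admissible \<Gamma> Vmax. ?G V"
  have "(\<lambda>_. 0) \<in> admissible \<Gamma> Vmax" using Vmax by (simp add: admissible_def)
  then have "?G ` admissible \<Gamma> Vmax \<noteq> {}" by blast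
  \<comment> \<open>In the extended reals the supremum is the limit of an increasing sequence of gap
    values, whether or not these are bounded a priori.\<close>
  from Sup_countable_SUP[OF this] obtain f :: "nat \<Rightarrow> ereal"
    where f: "incseq f" "range f \<subseteq> ?G ` admissible \<Gamma> Vmax" "?S = (SUP i. f i)" by blast
  have "\<forall>p. \<exists>V. V \<in> admissible \<Gamma> Vmax \<and> f p = ?G V" using f(2) by blast
  from choice[OF this] obtain U where U: "\<And>p. U p \<in> admissible \<Gamma> Vmax" "\<And>p. f p = ?G (U p)" by blast
  have lim: "f \<longlonglongrightarrow> ?S" unfolding f(3) by (rule LIMSEQ_SUP[OF f(1)])
  obtain r V where r: "strict_mono r" and V: "V \<in> admissible \<Gamma> Vmax"
    and entries: "\<And>n m. (\<lambda>p. ip (pot (U (r p)) (delta n)) (delta m)) \<longlonglongrightarrow> ip (pot V (delta n)) (delta m)"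
    using admissible_weakly_compact[of U, OF U(1) Vmax] by blast
  obtain k1 where k1: "k1 \<in> brillouin_zone \<Gamma>" "band_top \<Gamma> V m = band \<Gamma> V m k1"
    using band_top(1)[OF V Vmax] by blast
  obtain k2 where k2: "k2 \<in> brillouin_zone \<Gamma>" "next_band_bottom \<Gamma> V m = band \<Gamma> V (m + 1) k2"
    using next_band_bottom(1)[OF V Vmax] by blast
  \<comment> \<open>The bands of \<open>U (r p)\<close> are evaluated at the extremal quasi-momenta
    of \<open>V\<close>, not at their own: \<open>x p\<close> is at most the band top of
    \<open>U (r p)\<close> and \<open>y p\<close> at least its next band bottom, so once
    \<open>x p\<close> is positive the ratio built from them can only overestimate the gap of
    \<open>U (r p)\<close>.\<close>
  define x where "x p = band \<Gamma> (U (r p)) m k1" for p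
  define y where "y p = band \<Gamma> (U (r p)) (m + 1) k2" for p
  have xlim: "x \<longlonglongrightarrow> band_top \<Gamma> V m"
    unfolding x_def k1(2) by (rule band_tendsto[OF U(1) V Vmax entries tendsto_const])
  have ylim: "y \<longlonglongrightarrow> next_band_bottom \<Gamma> V m"
    unfolding y_def k2(2) by (rule band_tendsto[OF U(1) V Vmax entries tendsto_const])
  have top: "0 < band_top \<Gamma> V m" by (rule band_top_pos[OF V Vmax])
  have bot: "0 \<le> next_band_bottom \<Gamma> V m" unfolding k2(2) by (rule band_nonneg[OF V Vmax])
  have "(\<lambda>p. (y p - x p) / ((x p + y p) / 2)) \<longlonglongrightarrow> gap_to_midgap \<Gamma> m V"
    unfolding gap_to_midgap_def using top bot by (intro tendsto_intros xlim ylim) auto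
  then have glim: "(\<lambda>p. ereal ((y p - x p) / ((x p + y p) / 2))) \<longlonglongrightarrow> ?G V" by simp
  \<comment> \<open>\<open>gap_ratio_mono\<close> asks for a positive \<open>x p\<close>; positivity
    of the limit provides it for large \<open>p\<close>, which is enough to compare limits.\<close>
  have "eventually (\<lambda>p. 0 < x p) sequentially" using order_tendstoD(1)[OF xlim top] .
  then have le: "eventually (\<lambda>p. f (r p) \<le> ereal ((y p - x p) / ((x p + y p) / 2))) sequentially"
  proof eventually_elim
    case (elim p)
    have "x p \<le> band_top \<Gamma> (U (r p)) m" unfolding x_def by (rule band_top(2)[OF U(1) Vmax k1(1)])
    moreover have "next_band_bottom \<Gamma> (U (r p)) m \<le> y p" unfolding y_def by (rule next_band_bottom(2)[OF U(1) Vmax k2(1)])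
    moreover have "0 \<le> next_band_bottom \<Gamma> (U (r p)) m"
      using next_band_bottom(1)[OF U(1)[of "r p"] Vmax, of m] band_nonneg[OF U(1)[of "r p"] Vmax] by auto
    ultimately show ?case
      unfolding U(2) gap_to_midgap_def ereal_less_eq using elim by (intro gap_ratio_mono)
  qed
  have "(\<lambda>p. f (r p)) \<longlonglongrightarrow> ?S" using LIMSEQ_subseq_LIMSEQ[OF lim r] by (simp add: comp_def)
  from tendsto_le[OF _ glim this le] have "?S \<le> ?G V" by simp
  moreover have "?G V \<le> ?S" by (rule SUP_upper[OF V])
  ultimately show ?thesis using V by (intro bexI[of _ V]) auto
qed

end
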